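(* Let $m\in\mathbb{Z}$, let $\mathbf{c},\mathbf{d}\in\mathbb{C}$ be not both zero, and put $\alpha=\mathbf{d}\,c+\mathbf{c}\,d$. (1) If $\mathbf{c}+n=m$ for some positive integer $n$, then $$L_{\widehat{H}_4}(1,(m,1),\mathbf{1}_\alpha)=V_{\widehat{H}_4}(1,(m,1),\mathbf{1}_\alpha)/U(\widehat{H}_4)u^1$$ is irreducible, where $$u^1=\sum_{\lambda\in P(n)}\Big(a_\lambda\, c(-\lambda)\,b(m)+\sum_{i=1}^{k_\lambda}b_{\lambda\setminus\lambda_i,\lambda_i}\,c(-\lambda\setminus\lambda_i)\,b(-\lambda_i+m)\Big)\mathbf{1}_\alpha$$ and the complex coefficients (not all zero) satisfy, for all $\lambda\in P(n)$, $i=1,\dots,k_\lambda$, $$a_\lambda q_i\lambda_i-b_{\lambda\setminus\lambda_i,\lambda_i}=0,\qquad b_{\lambda\setminus\lambda_i,\lambda_i}(-n+\lambda_i)+\sum_{j=1}^{k_\lambda}b_{\lambda\setminus\lambda_i\setminus\lambda_j,\ \lambda_i+\lambda_j}=0.$$ (2) If $\mathbf{c}-n=m$ for some positive integer $n$, then $$L_{\widehat{H}_4}(1,(m,1),\mathbf{1}_\alpha)=V_{\widehat{H}_4}(1,(m,1),\mathbf{1}_\alpha)/U(\widehat{H}_4)u^1$$ is irreducible, where $$u^1=\sum_{\lambda\in P(n)}\sum_{i=1}^{k_\lambda}c_{\lambda\setminus\lambda_i,\lambda_i}\,c(-\lambda\setminus\lambda_i)\,a(-\lambda_i-m)\,\mathbf{1}_\alpha$$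 and the complex coefficients (not all zero) satisfy, for all $\lambda\in P(n)$, $$q_i\lambda_i\,c_{\lambda\setminus\lambda_j,\lambda_j}+c_{\lambda\setminus\lambda_i\setminus\lambda_j,\ \lambda_i+\lambda_j}=0\quad(i\ne j),\qquad c_{\lambda\setminus\lambda_i,\lambda_i}(-n+\lambda_i)-\sum_{j=1}^{k_\lambda}c_{\lambda\setminus\lambda_i\setminus\lambda_j,\ \lambda_i+\lambda_j}=0,$$ where $i,j=1,\dots,k_\lambda$.
   Context: $H_4$ is the complex Lie algebra with basis $a,b,c,d$ and brackets $[a,b]=c$, $[d,a]=a$, $[d,b]=-b$, $[c,d]=[c,a]=[c,b]=0$, with the symmetric bilinear form $(a,b)=1$, $(c,d)=1$, all other pairings of basis vectors $0$. The affine Nappi-Witten algebra is $\widehat{H}_4=H_4\otimes\mathbb{C}[t,t^{-1}]\oplus\mathbb{C}\mathbf{k}$ with $\mathbf k$ central and $[x\otimes t^p,y\otimes t^q]=[x,y]\otimes t^{p+q}+p\,(x,y)\,\delta_{p+q,0}\,\mathbf{k}$. Write $x(n)$ for the action of $x\otimes t^n$. $\mathfrak{h}=\mathbb{C}c\oplus\mathbb{C}d$ is identified with $\mathfrak h^*$ via the form, so $\alpha=\mathbf{d}c+\mathbf{c}d$ has $\alpha(c)=\mathbf{c}$, $\alpha(d)=\mathbf{d}$ ($\mathbf c,\mathbf d$ are complex numbers, $c,d\in H_4$). For $m\in\mathbb{Z}$ let $$\widehat{H}_4(m,1)=\bigoplus_{n\ge -m}\mathbb{C}\,a\otimes t^n\oplus\bigoplus_{n\ge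 m+1}\mathbb{C}\,b\otimes t^n\oplus(\mathbb{C}c\oplus\mathbb{C}d)\otimes\mathbb{C}[t]\oplus\mathbb{C}\mathbf{k},$$ and let $\mathbb{C}_\alpha=\mathbb{C}\mathbf{1}_\alpha$ be the one-dimensional $\widehat{H}_4(m,1)$-module on which $a\otimes t^s$ ($s\ge -m$), $b\otimes t^r$ ($r\ge m+1$), $c\otimes t^l,d\otimes t^l$ ($l\ge1$) act as $0$ and $c\otimes t^0,d\otimes t^0,\mathbf{k}$ act as $\mathbf{c},\mathbf{d},1$. Put $V_{\widehat{H}_4}(1,(m,1),\mathbf{1}_\alpha)=U(\widehat{H}_4)\otimes_{U(\widehat{H}_4(m,1))}\mathbb{C}_\alpha$. Partitions: $P(n)$ is the set of partitions of $n$. Each $\lambda\in P(n)$ is written $\lambda=(\lambda_1^{(q_1)},\dots,\lambda_{k_\lambda}^{(q_{k_\lambda})})$, with distinct parts $\lambda_1,\dots,\lambda_{k_\lambda}$ of multiplicities $q_i\ge1$, $\sum_i q_i\lambda_i=n$; $\lambda\setminus\lambda_i$ is $\lambda$ with one copy of $\lambda_i$ removed. For a partition $\rho=(\rho_1,\dots,\rho_r)$, $c(-\rho)=c(-\rho_1)\cdots c(-\rho_r)$, with $c(-\emptyset)=1$. The coefficients $a_\lambda$ are indexed by $\lambda\in P(n)$; $b_{\rho,p}$ and $c_{\rho,p}$ are indexed by pairs of a partition $\rho$ and an integer $p\ge1$ with $|\rho|+p=n$. A coefficient whose index $\lambda\setminus\lambda_i\setminus\lambda_j$ is undefined (i.e.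 $j=i$ and $q_i=1$) is taken to be $0$. *)

theory Defs
  imports
    "HOL-Analysis.Finite_Cartesian_Product"
    "HOL-Analysis.Product_Vector"
    "HOL-Library.Poly_Mapping"
    "HOL-Library.Multiset"
    "HOL-Algebra.QuotRing"
    "HOL-Algebra.Module"
    "HOL-Algebra.Free_Abelian_Groups"
begin

section \<open>Left modules over a not necessarily commutative ring\<close>

text \<open>The library locale \<^locale>\<open>module\<close> requires a commutative ring of scalars. The record type and
  the locale \<^locale>\<open>submodule\<close> do not, and are reused here. In every module record below
  the fields \<^term>\<open>monoid.mult\<close> and \<^term>\<open>monoid.one\<close> carry no meaning.\<close>

locale left_module = R?: ring R + M?: abelian_group M for R (structure) and M (structure) +
  assumes lsmult_closed:
      "a \<in> carrier R \<Longrightarrow> x \<in> carrier M \<Longrightarrow> a \<odot>\<^bsub>M\<^esub> x \<in> carrier M"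
    and lsmult_l_distr:
      "a \<in> carrier R \<Longrightarrow> b \<in> carrier R \<Longrightarrow> x \<in> carrier M \<Longrightarrow>
        (a \<oplus> b) \<odot>\<^bsub>M\<^esub> x = a \<odot>\<^bsub>M\<^esub> x \<oplus>\<^bsub>M\<^esub> b \<odot>\<^bsub>M\<^esub> x"
    and lsmult_r_distr:
      "a \<in> carrier R \<Longrightarrow> x \<in> carrier M \<Longrightarrow> y \<in> carrier M \<Longrightarrow>
        a \<odot>\<^bsub>M\<^esub> (x \<oplus>\<^bsub>M\<^esub> y) = a \<odot>\<^bsub>M\<^esub> x \<oplus>\<^bsub>M\<^esub> a \<odot>\<^bsub>M\<^esub> y"
    and lsmult_assoc:
      "a \<in> carrier R \<Longrightarrow> b \<in> carrier R \<Longrightarrow> x \<in> carrier M \<Longrightarrow>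
        (a \<otimes> b) \<odot>\<^bsub>M\<^esub> x = a \<odot>\<^bsub>M\<^esub> (b \<odot>\<^bsub>M\<^esub> x)"
    and lsmult_one: "x \<in> carrier M \<Longrightarrow> \<one> \<odot>\<^bsub>M\<^esub> x = x"

definition irreducible_module :: "('r, 's) ring_scheme \<Rightarrow> ('r, 'm, 't) module_scheme \<Rightarrow> bool"
  where "irreducible_module R M \<longleftrightarrow>
    left_module R M \<and> carrier M \<noteq> {\<zero>\<^bsub>M\<^esub>} \<and>
    (\<forall>N. submodule N R M \<longrightarrow> N = {\<zero>\<^bsub>M\<^esub>} \<or> N = carrier M)"

definition cyclic_submodule ::
    "('r, 's) ring_scheme \<Rightarrow> ('r, 'm, 't) module_scheme \<Rightarrow> 'm \<Rightarrow> 'm set"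
  where "cyclic_submodule R M u = (\<lambda>r. r \<odot>\<^bsub>M\<^esub> u) ` carrier R"

definition quot_module :: "('r, 'm, 't) module_scheme \<Rightarrow> 'm set \<Rightarrow> ('r, 'm set) module"
  where "quot_module M N =
    \<lparr>carrier = a_rcosets\<^bsub>M\<^esub> N,
     monoid.mult = undefined, monoid.one = undefined,
     ring.zero = N, ring.add = set_add M,
     smult = (\<lambda>r X. \<Union>x\<in>X. N +>\<^bsub>M\<^esub> (r \<odot>\<^bsub>M\<^esub> x))\<rparr>"

text \<open>The tensor product \<open>R \<otimes>\<^sub>S N\<close>, where \<open>N\<close> is a left \<open>S\<close>-module and \<open>R\<close> is a right \<open>S\<close>-module
  via a ring homomorphism \<open>\<phi> : S \<rightarrow> R\<close>: the free abelian group on the pairs \<open>(r, v)\<close>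
  modulo the subgroup generated by the biadditivity and balancing relators, with \<open>R\<close> acting by left
  multiplication on the first factor.\<close>

definition tensor_relators ::
    "('r, 'p) ring_scheme \<Rightarrow> ('s, 'q) ring_scheme \<Rightarrow> ('s \<Rightarrow> 'r) \<Rightarrow> ('s, 'm, 't) module_scheme \<Rightarrow>
      ('r \<times> 'm \<Rightarrow>\<^sub>0 int) set"
  where "tensor_relators R S \<phi> N =
    {frag_of (r \<oplus>\<^bsub>R\<^esub> r', v) - frag_of (r, v) - frag_of (r', v) | r r' v.
        r \<in> carrier R \<and> r' \<in> carrier R \<and> v \<in> carrier N} \<union>
    {frag_of (r, v \<oplus>\<^bsub>N\<^esub> v') - frag_of (r, v) - frag_of (r, v') | r v v'.
        r \<in> carrier R \<and> v \<in> carrier N \<and> v' \<in> carrier N} \<union>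
    {frag_of (r \<otimes>\<^bsub>R\<^esub> \<phi> s, v) - frag_of (r, s \<odot>\<^bsub>N\<^esub> v) | r s v.
        r \<in> carrier R \<and> s \<in> carrier S \<and> v \<in> carrier N}"

definition tensor_kernel ::
    "('r, 'p) ring_scheme \<Rightarrow> ('s, 'q) ring_scheme \<Rightarrow> ('s \<Rightarrow> 'r) \<Rightarrow> ('s, 'm, 't) module_scheme \<Rightarrow>
      ('r \<times> 'm \<Rightarrow>\<^sub>0 int) set"
  where "tensor_kernel R S \<phi> N =
    generate (free_Abelian_group (carrier R \<times> carrier N)) (tensor_relators R S \<phi> N)"

definition tensor ::
    "('r, 'p) ring_scheme \<Rightarrow> ('s, 'q) ring_scheme \<Rightarrow> ('s \<Rightarrow> 'r) \<Rightarrow> ('s, 'm, 't) module_scheme \<Rightarrow>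
      'r \<Rightarrow> 'm \<Rightarrow> ('r \<times> 'm \<Rightarrow>\<^sub>0 int) set"
  where "tensor R S \<phi> N r v =
    tensor_kernel R S \<phi> N #>\<^bsub>free_Abelian_group (carrier R \<times> carrier N)\<^esub> frag_of (r, v)"

definition tensor_module ::
    "('r, 'p) ring_scheme \<Rightarrow> ('s, 'q) ring_scheme \<Rightarrow> ('s \<Rightarrow> 'r) \<Rightarrow> ('s, 'm, 't) module_scheme \<Rightarrow>
      ('r, ('r \<times> 'm \<Rightarrow>\<^sub>0 int) set) module"
  where "tensor_module R S \<phi> N =
    (let F = free_Abelian_group (carrier R \<times> carrier N);
         T = tensor_kernel R S \<phi> N
     in \<lparr>carrier = rcosets\<^bsub>F\<^esub> T,
         monoid.mult = undefined, monoid.one = undefined,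
         ring.zero = T, ring.add = set_mult F,
         smult = (\<lambda>r X. \<Union>x\<in>X. T #>\<^bsub>F\<^esub> frag_extend (\<lambda>(r', v). frag_of (r \<otimes>\<^bsub>R\<^esub> r', v)) x)\<rparr>)"


section \<open>Complex Lie algebras and universal enveloping algebras\<close>

text \<open>Words under concatenation. The finitely supported functions
  \<open>'g mon \<Rightarrow>\<^sub>0 complex\<close> are then the free unital associative algebra on \<^typ>\<open>'g\<close>, with the
  convolution product of \<^theory>\<open>HOL-Library.Poly_Mapping\<close>.\<close>

datatype 'g mon = Mon (letters: "'g list")

instantiation mon :: (type) monoid_add
begin
definition "0 = Mon []"
definition "v + w = Mon (letters v @ letters w)"
instance by standard (simp_all add: zero_mon_def plus_mon_def)
end

type_synonym 'g falg = "'g mon \<Rightarrow>\<^sub>0 complex"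

definition gen :: "'g \<Rightarrow> 'g falg"
  where "gen x = Poly_Mapping.single (Mon [x]) 1"

definition scal :: "complex \<Rightarrow> 'g falg"
  where "scal s = Poly_Mapping.single 0 s"

definition free_alg :: "'g set \<Rightarrow> 'g falg ring"
  where "free_alg L =
    \<lparr>carrier = {f. \<forall>w\<in>Poly_Mapping.keys f. set (letters w) \<subseteq> L},
     monoid.mult = (*), monoid.one = 1, ring.zero = 0, ring.add = (+)\<rparr>"

text \<open>Below, \<open>L\<close> is the carrier of a complex Lie algebra, a subset of an ambient additive group;
  \<open>sc\<close> and \<open>br\<close> are its scalar multiplication and its bracket. The first two families of relators
  turn the free algebra on the set \<open>L\<close> into the tensor algebra of the vector space \<open>L\<close>.\<close>

definition env_relators ::
    "'g::ab_group_add set \<Rightarrow> (complex \<Rightarrow> 'g \<Rightarrow> 'g) \<Rightarrow> ('g \<Rightarrow> 'g \<Rightarrow> 'g) \<Rightarrow> 'g falg set"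
  where "env_relators L sc br =
    {gen (x + y) - gen x - gen y | x y. x \<in> L \<and> y \<in> L} \<union>
    {gen (sc s x) - scal s * gen x | s x. x \<in> L} \<union>
    {gen x * gen y - gen y * gen x - gen (br x y) | x y. x \<in> L \<and> y \<in> L}"

definition env_ideal ::
    "'g::ab_group_add set \<Rightarrow> (complex \<Rightarrow> 'g \<Rightarrow> 'g) \<Rightarrow> ('g \<Rightarrow> 'g \<Rightarrow> 'g) \<Rightarrow> 'g falg set"
  where "env_ideal L sc br = Idl\<^bsub>free_alg L\<^esub> (env_relators L sc br)"

definition env_alg ::
    "'g::ab_group_add set \<Rightarrow> (complex \<Rightarrow> 'g \<Rightarrow> 'g) \<Rightarrow> ('g \<Rightarrow> 'g \<Rightarrow> 'g) \<Rightarrow> 'g falg set ring"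
  where "env_alg L sc br = free_alg L Quot env_ideal L sc br"

definition env_class ::
    "'g::ab_group_add set \<Rightarrow> (complex \<Rightarrow> 'g \<Rightarrow> 'g) \<Rightarrow> ('g \<Rightarrow> 'g \<Rightarrow> 'g) \<Rightarrow> 'g falg \<Rightarrow> 'g falg set"
  where "env_class L sc br f = env_ideal L sc br +>\<^bsub>free_alg L\<^esub> f"

text \<open>The homomorphism \<open>U(P) \<rightarrow> U(L)\<close> induced by the inclusion of a subalgebra \<open>P \<subseteq> L\<close>.\<close>

definition env_incl ::
    "'g::ab_group_add set \<Rightarrow> (complex \<Rightarrow> 'g \<Rightarrow> 'g) \<Rightarrow> ('g \<Rightarrow> 'g \<Rightarrow> 'g) \<Rightarrow> 'g falg set \<Rightarrow> 'g falg set"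
  where "env_incl L sc br X = (\<Union>f\<in>X. env_class L sc br f)"

text \<open>The one-dimensional module on which \<open>x\<close> acts by the scalar \<open>\<xi> x\<close>, where \<open>\<xi>\<close> is linear on \<open>P\<close>
  and kills brackets, as a module over the enveloping algebra of \<open>P\<close>: \<open>\<xi>\<close> is extended
  multiplicatively and linearly to the free algebra, and the extension is constant on the cosets
  that make up the enveloping algebra.\<close>

definition char_eval :: "('g \<Rightarrow> complex) \<Rightarrow> 'g falg \<Rightarrow> complex"
  where "char_eval \<xi> f =
    (\<Sum>w\<in>Poly_Mapping.keys f. Poly_Mapping.lookup f w * prod_list (map \<xi> (letters w)))"

definition char_module :: "('g \<Rightarrow> complex) \<Rightarrow> ('g falg set, complex) module"
  where "char_module \<xi> =
    \<lparr>carrier = UNIV, monoid.mult = undefined, monoid.one = undefined, ring.zero = 0, ring.add = (+),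
     smult = (\<lambda>X z. (THE s. \<forall>f\<in>X. char_eval \<xi> f = s) * z)\<rparr>"


section \<open>The affine Nappi-Witten algebra\<close>

datatype h4_ix = IA | IB | IC | ID

lemma UNIV_h4_ix: "UNIV = {IA, IB, IC, ID}"
  using h4_ix.exhaust by blast

instance h4_ix :: finite
  by standard (simp add: UNIV_h4_ix)

type_synonym h4 = "complex ^ h4_ix"

abbreviation (input) hA :: h4 where "hA \<equiv> axis IA 1"
abbreviation (input) hB :: h4 where "hB \<equiv> axis IB 1"
abbreviation (input) hC :: h4 where "hC \<equiv> axis IC 1"
abbreviation (input) hD :: h4 where "hD \<equiv> axis ID 1"

fun basis_bracket :: "h4_ix \<Rightarrow> h4_ix \<Rightarrow> h4"
  where
    "basis_bracket IA IB = hC"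
  | "basis_bracket IB IA = - hC"
  | "basis_bracket ID IA = hA"
  | "basis_bracket IA ID = - hA"
  | "basis_bracket ID IB = - hB"
  | "basis_bracket IB ID = hB"
  | "basis_bracket _ _ = 0"

definition h4_bracket :: "h4 \<Rightarrow> h4 \<Rightarrow> h4"
  where "h4_bracket x y = (\<Sum>i\<in>UNIV. \<Sum>j\<in>UNIV. (x $ i * y $ j) *s basis_bracket i j)"

fun basis_form :: "h4_ix \<Rightarrow> h4_ix \<Rightarrow> complex"
  where
    "basis_form IA IB = 1"
  | "basis_form IB IA = 1"
  | "basis_form IC ID = 1"
  | "basis_form ID IC = 1"
  | "basis_form _ _ = 0"

definition h4_form :: "h4 \<Rightarrow> h4 \<Rightarrow> complex"
  where "h4_form x y = (\<Sum>i\<in>UNIV. \<Sum>j\<in>UNIV. x $ i * y $ j * basis_form i j)"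

text \<open>A pair \<open>(f, \<kappa>)\<close> stands for \<open>(\<Sum>p. f p \<otimes> t\<^sup>p) + \<kappa> \<^bold>k\<close>.\<close>

type_synonym nw = "(int \<Rightarrow>\<^sub>0 h4) \<times> complex"

definition nw_elt :: "h4 \<Rightarrow> int \<Rightarrow> nw"
  where "nw_elt x p = (Poly_Mapping.single p x, 0)"

definition nw_scale :: "complex \<Rightarrow> nw \<Rightarrow> nw"
  where "nw_scale s X = (Poly_Mapping.map (\<lambda>x. s *s x) (fst X), s * snd X)"

definition nw_bracket :: "nw \<Rightarrow> nw \<Rightarrow> nw"
  where "nw_bracket X Y =
    (\<Sum>p\<in>Poly_Mapping.keys (fst X). \<Sum>q\<in>Poly_Mapping.keys (fst Y).
      let x = Poly_Mapping.lookup (fst X) p; y = Poly_Mapping.lookup (fst Y) q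
      in (Poly_Mapping.single (p + q) (h4_bracket x y),
          if p + q = 0 then of_int p * h4_form x y else 0))"

definition nw_sub :: "int \<Rightarrow> nw set"
  where "nw_sub m = {X. \<forall>p.
    (Poly_Mapping.lookup (fst X) p $ IA \<noteq> 0 \<longrightarrow> p \<ge> - m) \<and>
    (Poly_Mapping.lookup (fst X) p $ IB \<noteq> 0 \<longrightarrow> p \<ge> m + 1) \<and>
    (Poly_Mapping.lookup (fst X) p $ IC \<noteq> 0 \<longrightarrow> p \<ge> 0) \<and>
    (Poly_Mapping.lookup (fst X) p $ ID \<noteq> 0 \<longrightarrow> p \<ge> 0)}"

text \<open>For \<open>\<alpha>\<close> in the span of \<open>c\<close> and \<open>d\<close>, pairing with \<open>\<alpha>\<close> vanishes on \<open>a\<close> and \<open>b\<close>, so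
  on \<^term>\<open>nw_sub m\<close> this sends \<open>c \<otimes> 1\<close>, \<open>d \<otimes> 1\<close> and \<open>\<^bold>k\<close> to \<open>\<alpha>(c)\<close>, \<open>\<alpha>(d)\<close> and \<open>1\<close>, and all
  the other generators to \<open>0\<close>.\<close>

definition nw_char :: "h4 \<Rightarrow> nw \<Rightarrow> complex"
  where "nw_char \<alpha> X = h4_form \<alpha> (Poly_Mapping.lookup (fst X) 0) + snd X"

abbreviation nw_U :: "nw falg set ring"
  where "nw_U \<equiv> env_alg UNIV nw_scale nw_bracket"

abbreviation nw_U_sub :: "int \<Rightarrow> nw falg set ring"
  where "nw_U_sub m \<equiv> env_alg (nw_sub m) nw_scale nw_bracket"

definition nw_V :: "int \<Rightarrow> h4 \<Rightarrow> (nw falg set, (nw falg set \<times> complex \<Rightarrow>\<^sub>0 int) set) module"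
  where "nw_V m \<alpha> =
    tensor_module nw_U (nw_U_sub m) (env_incl UNIV nw_scale nw_bracket) (char_module (nw_char \<alpha>))"

definition nw_vac :: "int \<Rightarrow> h4 \<Rightarrow> (nw falg set \<times> complex \<Rightarrow>\<^sub>0 int) set"
  where "nw_vac m \<alpha> =
    tensor nw_U (nw_U_sub m) (env_incl UNIV nw_scale nw_bracket) (char_module (nw_char \<alpha>))
      \<one>\<^bsub>nw_U\<^esub> 1"

definition nw_L :: "int \<Rightarrow> h4 \<Rightarrow> nw falg \<Rightarrow>
    (nw falg set, (nw falg set \<times> complex \<Rightarrow>\<^sub>0 int) set set) module"
  where "nw_L m \<alpha> f =
    quot_module (nw_V m \<alpha>)
      (cyclic_submodule nw_U (nw_V m \<alpha>)
        (env_class UNIV nw_scale nw_bracket f \<odot>\<^bsub>nw_V m \<alpha>\<^esub> nw_vac m \<alpha>))"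


section \<open>The singular vectors\<close>

text \<open>A partition is the multiset of its parts: the distinct parts \<open>\<mu>\<^sub>i\<close> of \<open>\<mu>\<close> are the elements of
  \<^term>\<open>set_mset \<mu>\<close>, and \<open>q\<^sub>i\<close> is \<^term>\<open>count \<mu> \<mu>\<^sub>i\<close>.\<close>

definition partitions :: "nat \<Rightarrow> nat multiset set"
  where "partitions n = {\<mu>. 0 \<notin># \<mu> \<and> sum_mset \<mu> = n}"

text \<open>The index set of the coefficients \<open>b\<^bsub>\<rho>,p\<^esub>\<close> and \<open>c\<^bsub>\<rho>,p\<^esub>\<close>.\<close>

definition pair_partitions :: "nat \<Rightarrow> (nat multiset \<times> nat) set"
  where "pair_partitions n = {(\<rho>, p). 0 \<notin># \<rho> \<and> p \<ge> 1 \<and> sum_mset \<rho> + p = n}"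

text \<open>\<open>merge_coeff b \<mu> x y\<close> is the coefficient with index \<open>(\<mu> \<setminus> x \<setminus> y, x + y)\<close> for parts \<open>x, y\<close> of \<open>\<mu>\<close>.\<close>

definition merge_coeff :: "(nat multiset \<Rightarrow> nat \<Rightarrow> complex) \<Rightarrow> nat multiset \<Rightarrow> nat \<Rightarrow> nat \<Rightarrow> complex"
  where "merge_coeff b \<mu> x y =
    (if y \<in># \<mu> - {#x#} then b (\<mu> - {#x#} - {#y#}) (x + y) else 0)"

text \<open>A representative of \<open>c(-\<rho>)\<close>; in the enveloping algebra the order of the factors is
  immaterial.\<close>

definition c_part :: "nat multiset \<Rightarrow> nw falg"
  where "c_part \<rho> = prod_list (map (\<lambda>k. gen (nw_elt hC (- int k))) (sorted_list_of_multiset \<rho>))"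

definition coeffs1 :: "nat \<Rightarrow> (nat multiset \<Rightarrow> complex) \<Rightarrow> (nat multiset \<Rightarrow> nat \<Rightarrow> complex) \<Rightarrow> bool"
  where "coeffs1 n a b \<longleftrightarrow>
    ((\<exists>\<mu>\<in>partitions n. a \<mu> \<noteq> 0) \<or> (\<exists>(\<rho>, p)\<in>pair_partitions n. b \<rho> p \<noteq> 0)) \<and>
    (\<forall>\<mu>\<in>partitions n. \<forall>x\<in>set_mset \<mu>.
      a \<mu> * of_nat (count \<mu> x) * of_nat x - b (\<mu> - {#x#}) x = 0 \<and>
      b (\<mu> - {#x#}) x * (- of_nat n + of_nat x) + (\<Sum>y\<in>set_mset \<mu>. merge_coeff b \<mu> x y) = 0)"

definition vec1 :: "int \<Rightarrow> nat \<Rightarrow> (nat multiset \<Rightarrow> complex) \<Rightarrow>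
    (nat multiset \<Rightarrow> nat \<Rightarrow> complex) \<Rightarrow> nw falg"
  where "vec1 m n a b =
    (\<Sum>\<mu>\<in>partitions n.
      scal (a \<mu>) * c_part \<mu> * gen (nw_elt hB m) +
      (\<Sum>x\<in>set_mset \<mu>.
        scal (b (\<mu> - {#x#}) x) * c_part (\<mu> - {#x#}) * gen (nw_elt hB (- int x + m))))"

definition coeffs2 :: "nat \<Rightarrow> (nat multiset \<Rightarrow> nat \<Rightarrow> complex) \<Rightarrow> bool"
  where "coeffs2 n c \<longleftrightarrow>
    (\<exists>(\<rho>, p)\<in>pair_partitions n. c \<rho> p \<noteq> 0) \<and>
    (\<forall>\<mu>\<in>partitions n. \<forall>x\<in>set_mset \<mu>. \<forall>y\<in>set_mset \<mu>. x \<noteq> y \<longrightarrow>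
      of_nat (count \<mu> x) * of_nat x * c (\<mu> - {#y#}) y + merge_coeff c \<mu> x y = 0) \<and>
    (\<forall>\<mu>\<in>partitions n. \<forall>x\<in>set_mset \<mu>.
      c (\<mu> - {#x#}) x * (- of_nat n + of_nat x) - (\<Sum>y\<in>set_mset \<mu>. merge_coeff c \<mu> x y) = 0)"

definition vec2 :: "int \<Rightarrow> nat \<Rightarrow> (nat multiset \<Rightarrow> nat \<Rightarrow> complex) \<Rightarrow> nw falg"
  where "vec2 m n c =
    (\<Sum>\<mu>\<in>partitions n. \<Sum>x\<in>set_mset \<mu>.
      scal (c (\<mu> - {#x#}) x) * c_part (\<mu> - {#x#}) * gen (nw_elt hA (- int x - m)))"

end

theory Submission
  imports Defs
begin

text \<open>After a spectral flow (and, in case (2), the automorphism exchanging \<open>a\<close> with \<open>b\<close> and negating \<open>c\<close> and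
  \<open>d\<close>) both cases concern modes with \<open>[A p, B q] = C (p + q) + p \<delta>\<^bsub>p+q,0\<^esub>\<close>, \<open>[D p, A q] = A (p + q)\<close>,
  \<open>[D p, B q] = - B (p + q)\<close>, \<open>[C p, D q] = p \<delta>\<^bsub>p+q,0\<^esub>\<close>, a vacuum killed by \<open>A p\<close> (\<open>p \<ge> 0\<close>) and by \<open>B p\<close>,
  \<open>C p\<close>, \<open>D p\<close> (\<open>p \<ge> 1\<close>), and \<open>C 0 = - n\<close>. The recursion for the coefficients forces the coefficient of
  \<open>B (- n)\<close> in the singular vector to be nonzero, so in the quotient that creator is redundant.
  A nonzero vector is then lowered to the vacuum by stripping off creators: the \<open>D (- i)\<close> by \<open>C i\<close>, the
  \<open>B (- i)\<close> by \<open>A i\<close>, the \<open>A (- i)\<close> by \<open>B i\<close>, the \<open>C (- i)\<close> by \<open>D i\<close>. On the vectors that matter these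
  commutators are triangular in \<open>i\<close>, with diagonal entries \<open>i\<close>, \<open>i - n\<close>, \<open>i + n\<close>, \<open>i\<close>.

  That the quotient is not zero follows from a free field realization on a Fock space with fields
  \<open>\<beta>, \<gamma>, C, \<delta>\<close>: \<open>A = \<beta>\<close>, \<open>B = \<partial>\<gamma> + \<gamma> C\<close> and \<open>D = \<delta> + C / 2 - :\<gamma> \<beta>:\<close>. There the vanishing of the
  singular vector is literally the recursion for the coefficients.\<close>

section \<open>Lowering operators modulo a left ideal\<close>

text \<open>The modules are traded for left ideals of the free algebra on the Lie algebra: the
  quotient is that algebra modulo a left ideal \<open>J\<close>, and irreducibility means
  \<open>1 \<notin> J\<close>, together with \<open>1 \<in> N\<close> for every left ideal
  \<open>N\<close> strictly above \<open>J\<close>. The order of stripping is dictated by what each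
  annihilator still meets. \<open>C i\<close> commutes with the creators \<open>A\<close>,
  \<open>B\<close>, \<open>C\<close>, so \<open>D\<close> goes first. \<open>A i\<close> commutes
  with the creators \<open>A\<close> and \<open>C\<close>, so \<open>B\<close> goes next; against
  \<open>B (- j)\<close> with \<open>j < i\<close> it leaves \<open>C (i - j)\<close>, which kills
  everything that is left. The same holds for \<open>B i\<close> against \<open>A (- j)\<close>, and
  \<open>D i\<close> only ever meets the creators \<open>C\<close>. In the realization, \<gamma> C
  yields the \<open>C\<close> in [A, B], and the derivative of \<gamma> yields its central term. The
  product :\<gamma> \<beta>: has commutators - p at p + q = 0, while \<delta> + s C has 2 s p; this
  forces s = 1 / 2. Commutativity of the modes of \<open>D\<close> is the one relation that is not a
  termwise computation; it is reduced to the vacuum.\<close>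

definition left_ideal :: "'r::ring_1 set \<Rightarrow> bool"
  where "left_ideal J \<longleftrightarrow> 0 \<in> J \<and> (\<forall>x\<in>J. \<forall>y\<in>J. x + y \<in> J) \<and> (\<forall>r. \<forall>x\<in>J. r * x \<in> J)"

lemma left_idealD:
  assumes "left_ideal J"
  shows "0 \<in> J" "x \<in> J \<Longrightarrow> y \<in> J \<Longrightarrow> x + y \<in> J" "x \<in> J \<Longrightarrow> r * x \<in> J"
    "x \<in> J \<Longrightarrow> - x \<in> J" "x \<in> J \<Longrightarrow> y \<in> J \<Longrightarrow> x - y \<in> J"
proof -
  show *: "0 \<in> J" "x \<in> J \<Longrightarrow> y \<in> J \<Longrightarrow> x + y \<in> J" "x \<in> J \<Longrightarrow> r * x \<in> J" for x y r
    using assms by (auto simp: left_ideal_def)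
  show **: "x \<in> J \<Longrightarrow> - x \<in> J" for x using *(3)[of x "-1"] by simp
  show "x \<in> J \<Longrightarrow> y \<in> J \<Longrightarrow> x - y \<in> J" using *(2)[of x "-y"] **[of y] by simp
qed

lemma left_ideal_adjoin:
  assumes "left_ideal K"
  shows "left_ideal {j + r * u | j r. j \<in> K}" "K \<subseteq> {j + r * u | j r. j \<in> K}"
    "u \<in> {j + r * u | j r. j \<in> K}"
proof -
  note K = left_idealD[OF assms]
  show sub: "K \<subseteq> {j + r * u | j r. j \<in> K}"
  proof
    fix j assume "j \<in> K"
    moreover have "j = j + 0 * u" by simp
    ultimately show "j \<in> {j + r * u | j r. j \<in> K}" by blast
  qed
  have "u = 0 + 1 * u" by simp
  then show "u \<in> {j + r * u | j r. j \<in> K}" using K(1) by blast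
  have "x + y \<in> {j + r * u | j r. j \<in> K}"
    if xy: "x \<in> {j + r * u | j r. j \<in> K}" "y \<in> {j + r * u | j r. j \<in> K}" for x y
  proof -
    obtain j r j' r' where *: "x = j + r * u" "y = j' + r' * u" "j \<in> K" "j' \<in> K" using xy by auto
    then have "x + y = (j + j') + (r + r') * u" "j + j' \<in> K" using K(2) by (auto simp: algebra_simps)
    then show ?thesis by blast
  qed
  moreover have "s * x \<in> {j + r * u | j r. j \<in> K}" if x: "x \<in> {j + r * u | j r. j \<in> K}" for s x
  proof -
    obtain j r where *: "x = j + r * u" "j \<in> K" using x by auto
    then have "s * x = s * j + (s * r) * u" "s * j \<in> K" using K(3) by (auto simp: algebra_simps)
    then show ?thesis by blast
  qed
  ultimately show "left_ideal {j + r * u | j r. j \<in> K}"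
    unfolding left_ideal_def using sub K(1) by blast
qed

section \<open>Subspaces spanned by words of operators\<close>

locale scalars =
  fixes sc :: "complex \<Rightarrow> 'r::ring_1"
  assumes sc_add: "sc (s + t) = sc s + sc t"
    and sc_mult: "sc (s * t) = sc s * sc t"
    and sc_1 [simp]: "sc 1 = 1"
    and sc_central: "sc s * x = x * sc s"
begin

lemma sc_0 [simp]: "sc 0 = 0"
  using sc_add[of 0 0] by simp

lemma sc_minus: "sc (- s) = - sc s"
  using sc_add[of s "-s"] by (simp add: eq_neg_iff_add_eq_0 add.commute)

definition linsub :: "'r set \<Rightarrow> bool"
  where "linsub M \<longleftrightarrow> 0 \<in> M \<and> (\<forall>x\<in>M. \<forall>y\<in>M. x + y \<in> M) \<and> (\<forall>s. \<forall>x\<in>M. sc s * x \<in> M)"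

lemma linsubD:
  assumes "linsub M"
  shows "0 \<in> M" "x \<in> M \<Longrightarrow> y \<in> M \<Longrightarrow> x + y \<in> M" "x \<in> M \<Longrightarrow> sc s * x \<in> M"
    "x \<in> M \<Longrightarrow> - x \<in> M" "x \<in> M \<Longrightarrow> y \<in> M \<Longrightarrow> x - y \<in> M"
proof -
  show *: "0 \<in> M" "x \<in> M \<Longrightarrow> y \<in> M \<Longrightarrow> x + y \<in> M" "x \<in> M \<Longrightarrow> sc r * x \<in> M" for x y r
    using assms by (auto simp: linsub_def)
  show **: "x \<in> M \<Longrightarrow> - x \<in> M" for x using *(3)[of x "-1"] by (simp add: sc_minus)
  show "x \<in> M \<Longrightarrow> y \<in> M \<Longrightarrow> x - y \<in> M" using *(2)[of x "-y"] **[of y] by simp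
qed

lemma linsub_left_ideal: "left_ideal J \<Longrightarrow> linsub J"
  by (simp add: left_ideal_def linsub_def)

inductive_set gspan :: "'r set \<Rightarrow> 'r set \<Rightarrow> 'r set" for Q M
  where
    base: "x \<in> M \<Longrightarrow> x \<in> gspan Q M"
  | add: "x \<in> gspan Q M \<Longrightarrow> y \<in> gspan Q M \<Longrightarrow> x + y \<in> gspan Q M"
  | scal: "x \<in> gspan Q M \<Longrightarrow> sc s * x \<in> gspan Q M"
  | op: "q \<in> Q \<Longrightarrow> x \<in> gspan Q M \<Longrightarrow> q * x \<in> gspan Q M"

lemma linsub_gspan: "linsub M \<Longrightarrow> linsub (gspan Q M)"
  by (auto simp: linsub_def intro: gspan.intros)

lemma gspan_mono:
  assumes "Q \<subseteq> Q'" "w \<in> gspan Q M"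
  shows "w \<in> gspan Q' M"
  using assms(2) by induction (use assms(1) in \<open>auto intro: gspan.intros\<close>)

text \<open>Polynomials of degree at most \<open>d\<close> in the operator \<open>q\<close> with
  coefficients in \<open>M\<close>, in Horner form.\<close>

primrec poly_span :: "'r \<Rightarrow> 'r set \<Rightarrow> nat \<Rightarrow> 'r set"
  where "poly_span q M 0 = M"
  | "poly_span q M (Suc d) = {q * x + y | x y. x \<in> poly_span q M d \<and> y \<in> M}"

lemma poly_span_SucI: "z = q * x + y \<Longrightarrow> x \<in> poly_span q M d \<Longrightarrow> y \<in> M \<Longrightarrow> z \<in> poly_span q M (Suc d)"
  by auto

lemma linsub_poly_span:
  assumes "linsub M" shows "linsub (poly_span q M d)"
proof (induction d)
  case (Suc d)
  note l = linsubD[OF Suc] linsubD[OF assms]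
  have "0 \<in> poly_span q M (Suc d)" using l(1) l(6) by force
  moreover have "x + y \<in> poly_span q M (Suc d)"
    if "x \<in> poly_span q M (Suc d)" "y \<in> poly_span q M (Suc d)" for x y
  proof -
    from that obtain a b a' b' where
      *: "x = q * a + b" "y = q * a' + b'" "a \<in> poly_span q M d" "a' \<in> poly_span q M d" "b \<in> M" "b' \<in> M"
      by auto
    hence "x + y = q * (a + a') + (b + b')" by (simp add: algebra_simps)
    then show ?thesis by (rule poly_span_SucI) (use * l in auto)
  qed
  moreover have "sc s * x \<in> poly_span q M (Suc d)" if "x \<in> poly_span q M (Suc d)" for x s
  proof -
    from that obtain a b where
      *: "x = q * a + b" "a \<in> poly_span q M d" "b \<in> M" by auto
    have "sc s * x = q * (sc s * a) + sc s * b"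
      using * by (simp add: algebra_simps) (metis mult.assoc sc_central)
    then show ?thesis by (rule poly_span_SucI) (use * l in auto)
  qed
  ultimately show ?case by (simp only: linsub_def) blast
qed (simp add: assms)

lemma poly_span_Suc: "linsub M \<Longrightarrow> x \<in> poly_span q M d \<Longrightarrow> x \<in> poly_span q M (Suc d)"
proof (induction d arbitrary: x)
  case 0
  then show ?case using linsubD(1)[OF 0(1)] by force
next
  case (Suc d)
  then obtain a b where *: "x = q * a + b" "a \<in> poly_span q M d" "b \<in> M" by auto
  show ?case by (rule poly_span_SucI[OF *(1) Suc.IH[OF Suc.prems(1) *(2)] *(3)])
qed

lemma poly_span_le: "linsub M \<Longrightarrow> d \<le> d' \<Longrightarrow> x \<in> poly_span q M d \<Longrightarrow> x \<in> poly_span q M d'"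
  by (rule dec_induct[of d d' "\<lambda>d'. x \<in> poly_span q M d'"]) (use poly_span_Suc in auto)

text \<open>The relation [X, Y] = Z for operators on the quotient by \<open>J\<close>. The factor
  \<open>w\<close> cannot be dropped: a left ideal need not absorb multiplication from the
  right.\<close>

definition comm_mod :: "'r set \<Rightarrow> 'r \<Rightarrow> 'r \<Rightarrow> 'r \<Rightarrow> bool"
  where "comm_mod J X Y Z \<longleftrightarrow> (\<forall>w. (X * Y - Y * X - Z) * w \<in> J)"

lemma comm_mod_sym: "linsub J \<Longrightarrow> comm_mod J X Y Z \<Longrightarrow> comm_mod J Y X (- Z)"
  unfolding comm_mod_def
proof
  fix w assume J: "linsub J" and *: "\<forall>w. (X * Y - Y * X - Z) * w \<in> J"
  have "(Y * X - X * Y - - Z) * w = - ((X * Y - Y * X - Z) * w)" by (simp add: algebra_simps)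
  then show "(Y * X - X * Y - - Z) * w \<in> J" using * linsubD(4)[OF J] by metis
qed

lemma comm_mod_swap:
  assumes "comm_mod J X Y Z" "linsub M" "J \<subseteq> M" "Y * (X * w) \<in> M" "Z * w \<in> M"
  shows "X * (Y * w) \<in> M"
proof -
  have "X * (Y * w) = Y * (X * w) + Z * w + (X * Y - Y * X - Z) * w" by (simp add: algebra_simps)
  then show ?thesis using assms linsubD[OF assms(2)] unfolding comm_mod_def by (metis subsetD)
qed

text \<open>The Euler operator \<open>q p\<close> acts on the associated graded space of the filtration by degree
  in \<open>q\<close> as the degree times the commutator \<open>c\<close>.\<close>

lemma poly_span_euler:
  assumes J: "left_ideal J" and M: "linsub M" "J \<subseteq> M"
    and pM: "\<And>x. x \<in> M \<Longrightarrow> p * x \<in> J"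
    and pq: "comm_mod J p q (sc c)"
    and w: "w \<in> poly_span q M (Suc d)"
  shows "p * w \<in> poly_span q M d" "q * (p * w) - sc (c * of_nat (Suc d)) * w \<in> poly_span q M d"
proof -
  have JT: "x \<in> poly_span q M d" if "x \<in> J" for x d
    using poly_span_le[of M 0 d x q] that M by auto
  have "p * w \<in> poly_span q M d \<and> q * (p * w) - sc (c * of_nat (Suc d)) * w \<in> poly_span q M d"
    using w
  proof (induction d arbitrary: w)
    case 0
    then obtain x y where xy: "w = q * x + y" "x \<in> M" "y \<in> M" by auto
    define j where "j = (p * q - q * p - sc c) * x"
    have j: "j \<in> J" using pq by (auto simp: comm_mod_def j_def)
    have e: "p * w = sc c * x + (q * (p * x) + p * y + j)"
      by (simp add: xy j_def algebra_simps)
    have k: "q * (p * x) + p * y + j \<in> J" "q * (q * (p * x) + p * y + j) \<in> J"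
      using left_idealD(2,3)[OF J] j pM xy by auto
    have "q * (p * w) - sc c * w = q * (q * (p * x) + p * y + j) - sc c * y"
    proof -
      have "q * (sc c * x) = sc c * (q * x)" by (metis mult.assoc sc_central)
      then show ?thesis unfolding e by (simp add: xy algebra_simps)
    qed
    moreover have "p * w \<in> M"
      unfolding e using linsubD(2)[OF M(1) linsubD(3)[OF M(1) xy(2)]] k(1) M(2) by blast
    ultimately show ?case
      using linsubD(5)[OF M(1) subsetD[OF M(2) k(2)] linsubD(3)[OF M(1) xy(3)]] by simp
  next
    case (Suc d)
    then obtain x y where xy: "w = q * x + y" "x \<in> poly_span q M (Suc d)" "y \<in> M" by auto
    define j where "j = (p * q - q * p - sc c) * x"
    define t where "t = q * (p * x) - sc (c * of_nat (Suc d)) * x"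
    have T: "linsub (poly_span q M d)" for d by (rule linsub_poly_span[OF M(1)])
    have t: "t \<in> poly_span q M d" and px: "p * x \<in> poly_span q M d"
      using Suc.IH[OF xy(2)] by (auto simp: t_def)
    have j: "j \<in> J" using pq by (auto simp: comm_mod_def j_def)
    have e: "p * w = q * (p * x) + sc c * x + (p * y + j)"
      by (simp add: xy j_def algebra_simps)
    have k: "p * y + j \<in> J" "q * (p * y + j) \<in> J"
      using left_idealD(2,3)[OF J] j pM xy by auto
    have y: "y \<in> poly_span q M (Suc d)" using xy(3) poly_span_le[OF M(1), of 0 "Suc d" y q] by simp
    have q1: "q * z \<in> poly_span q M (Suc d)" if "z \<in> poly_span q M d" for z d
      using that linsubD(1)[OF M(1)] by force
    have "p * w \<in> poly_span q M (Suc d)"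
      unfolding e using q1[OF px] JT[OF k(1), of "Suc d"] xy(2) by (metis linsubD(2,3)[OF T])
    moreover have "q * (p * w) - sc (c * of_nat (Suc (Suc d))) * w =
        q * t + q * (p * y + j) - sc (c * of_nat (Suc (Suc d))) * y"
    proof -
      have *: "q * (sc s * x) = sc s * (q * x)" for s by (metis mult.assoc sc_central)
      have "sc (c * of_nat (Suc (Suc d))) = sc (c * of_nat (Suc d)) + sc c"
        by (simp add: sc_add[symmetric] algebra_simps)
      then show ?thesis unfolding e t_def by (simp add: xy * algebra_simps)
    qed
    moreover have "\<dots> \<in> poly_span q M (Suc d)"
      using q1[OF t] JT[OF k(2), of "Suc d"] linsubD(3)[OF T y] by (metis linsubD(2,5)[OF T])
    ultimately show ?case by simp
  qed
  then show "p * w \<in> poly_span q M d" "q * (p * w) - sc (c * of_nat (Suc d)) * w \<in> poly_span q M d"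
    by auto
qed

text \<open>Induction on the degree in \<open>q\<close>. Either \<open>p * w\<close> is a vector of
  \<open>N\<close> outside \<open>J\<close> of lower degree, or it lies in \<open>J\<close>, and
  then the Euler relation puts a nonzero multiple of \<open>w\<close> itself into the span of lower
  degree.\<close>

lemma poly_span_lowering:
  assumes J: "left_ideal J" and M: "linsub M" "J \<subseteq> M" and N: "left_ideal N"
    and pM: "\<And>x. x \<in> M \<Longrightarrow> p * x \<in> J"
    and pq: "comm_mod J p q (sc c)" and c: "c \<noteq> 0"
    and w: "w \<in> poly_span q M d" "w \<in> N" "w \<notin> J"
  shows "\<exists>w'. w' \<in> M \<and> w' \<in> N \<and> w' \<notin> J"
  using w
proof (induction d arbitrary: w)
  case (Suc d)
  note euler = poly_span_euler[OF J M pM pq Suc.prems(1)]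
  show ?case
  proof (cases "p * w \<in> J")
    case False
    then show ?thesis using Suc.IH[of "p * w"] euler(1) Suc.prems(2) left_idealD(3)[OF N] by blast
  next
    case True
    have T: "linsub (poly_span q M d)" by (rule linsub_poly_span[OF M(1)])
    have "q * (p * w) \<in> poly_span q M d"
      using left_idealD(3)[OF J True] poly_span_le[of M 0 d _ q] M by auto
    then have "sc (c * of_nat (Suc d)) * w \<in> poly_span q M d"
      using linsubD(5)[OF T _ euler(2)] by fastforce
    then have "sc (1 / (c * of_nat (Suc d))) * (sc (c * of_nat (Suc d)) * w) \<in> poly_span q M d"
      by (rule linsubD(3)[OF T])
    then have "w \<in> poly_span q M d"
      using c by (simp add: mult.assoc[symmetric] sc_mult[symmetric] del: of_nat_Suc)
    then show ?thesis using Suc by blast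
  qed
qed auto

text \<open>Modulo \<open>J\<close> the operators in \<open>Q\<close> commute with \<open>q\<close>,
  so in every word the factors \<open>q\<close> move to the front and the rest is collected into
  coefficients from \<open>gspan Q M\<close>.\<close>

lemma gspan_insert_poly_span:
  assumes J: "left_ideal J" and M: "linsub M" "J \<subseteq> M"
    and comm: "\<And>r. r \<in> Q \<Longrightarrow> comm_mod J r q 0"
    and w: "w \<in> gspan (insert q Q) M"
  shows "\<exists>d. w \<in> poly_span q (gspan Q M) d"
proof -
  let ?M = "gspan Q M"
  have lM: "linsub ?M" by (rule linsub_gspan[OF M(1)])
  have T: "linsub (poly_span q ?M d)" for d by (rule linsub_poly_span[OF lM])
  have J': "x \<in> poly_span q ?M d" if "x \<in> J" for x d
    using poly_span_le[OF lM, of 0 d x q] that M by (auto intro: gspan.base)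
  have stable: "r * x \<in> poly_span q ?M d" if "r \<in> Q" "x \<in> poly_span q ?M d" for r x d
    using that(2)
  proof (induction d arbitrary: x)
    case 0
    then show ?case using that by (auto intro: gspan.op)
  next
    case (Suc d)
    then obtain a b where ab: "x = q * a + b" "a \<in> poly_span q ?M d" "b \<in> ?M" by auto
    have "q * (r * a) \<in> poly_span q ?M (Suc d)"
      using Suc.IH[OF ab(2)] linsubD(1)[OF lM] by force
    then have 1: "r * (q * a) \<in> poly_span q ?M (Suc d)"
      using comm_mod_swap[OF comm[OF that(1)] T[of "Suc d"] subsetI[OF J']] linsubD(1)[OF T]
      by (metis mult_zero_left)
    have "r * b \<in> poly_span q ?M (Suc d)"
      using poly_span_le[OF lM, of 0 "Suc d" "r * b" q] ab(3) that(1) by (auto intro: gspan.op)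
    then show ?case using linsubD(2)[OF T 1] by (simp add: ab(1) distrib_left)
  qed
  show ?thesis using w
  proof induction
    case (base x)
    then show ?case by (intro exI[of _ 0]) (auto intro: gspan.base)
  next
    case (add x y)
    then obtain d e where "x \<in> poly_span q ?M d" "y \<in> poly_span q ?M e" by auto
    then have "x \<in> poly_span q ?M (max d e)" "y \<in> poly_span q ?M (max d e)"
      using poly_span_le[OF lM] by (meson max.cobounded1 max.cobounded2)+
    then show ?case using linsubD(2)[OF T] by blast
  next
    case (scal x s)
    then show ?case using linsubD(3)[OF T] by blast
  next
    case (op r x)
    then obtain d where d: "x \<in> poly_span q ?M d" by auto
    show ?case
    proof (cases "r = q")
      case True
      have "q * x \<in> poly_span q ?M (Suc d)" using d linsubD(1)[OF lM] by force
      then show ?thesis using True by blast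
    next
      case False
      then show ?thesis using op stable d by blast
    qed
  qed
qed

text \<open>Induction over words, pushing \<open>X\<close> past one creator at a time. A whole
  family is carried along because the commutator with a creator may be another member of it.\<close>

lemma gspan_stable:
  assumes J: "left_ideal J" and G: "linsub G" "J \<subseteq> G" "\<And>q x. q \<in> Q \<Longrightarrow> x \<in> G \<Longrightarrow> q * x \<in> G"
    and base: "\<And>X x. X \<in> \<X> \<Longrightarrow> x \<in> M \<Longrightarrow> X * x \<in> G"
    and comm: "\<And>X q. X \<in> \<X> \<Longrightarrow> q \<in> Q \<Longrightarrow> \<exists>Z. comm_mod J X q Z \<and>
        (\<forall>w\<in>gspan Q M. (\<forall>X'\<in>\<X>. X' * w \<in> G) \<longrightarrow> Z * w \<in> G)"
    and w: "w \<in> gspan Q M" and X: "X \<in> \<X>"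
  shows "X * w \<in> G"
  using w X
proof (induction arbitrary: X)
  case (base x)
  then show ?case by (intro assms(5))
next
  case (add x y)
  then show ?case using linsubD(2)[OF G(1)] by (simp add: distrib_left)
next
  case (scal x s)
  have "X * (sc s * x) = sc s * (X * x)" by (metis mult.assoc sc_central)
  then show ?case using scal linsubD(3)[OF G(1)] by simp
next
  case (op q x)
  obtain Z where Z: "comm_mod J X q Z" "(\<forall>X'\<in>\<X>. X' * x \<in> G) \<longrightarrow> Z * x \<in> G"
    using comm[OF op(4,1)] op(2) by auto
  show ?case
    by (rule comm_mod_swap[OF Z(1) G(1,2)]) (use op Z G(3) in auto)
qed

lemma gspan_stable1:
  assumes J: "left_ideal J" and G: "linsub G" "J \<subseteq> G" "\<And>i x. i \<in> I \<Longrightarrow> x \<in> G \<Longrightarrow> q i * x \<in> G"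
    and base: "\<And>x. x \<in> M \<Longrightarrow> X * x \<in> G"
    and comm: "\<And>i. i \<in> I \<Longrightarrow> comm_mod J X (q i) (Z i)"
      "\<And>i w. i \<in> I \<Longrightarrow> w \<in> gspan (q ` I) M \<Longrightarrow> Z i * w \<in> G"
    and w: "w \<in> gspan (q ` I) M"
  shows "X * w \<in> G"
  by (rule gspan_stable[of J G "q ` I" "{X}" M]) (use assms in blast)+

lemma gspan_kill:
  assumes J: "left_ideal J" and M0: "\<And>x. x \<in> M \<Longrightarrow> p * x \<in> J"
    and comm: "\<And>q. q \<in> Q \<Longrightarrow> \<exists>Z. comm_mod J p q Z \<and> (\<forall>w\<in>gspan Q M. Z * w \<in> J)"
    and w: "w \<in> gspan Q M"
  shows "p * w \<in> J"
  by (rule gspan_stable[of J J Q "{p}" M w p])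
    (use assms left_idealD(3)[OF J] linsub_left_ideal[OF J] in blast)+

text \<open>The commutators of the annihilators \<open>p i\<close> with the creators \<open>q j\<close> are only triangular: nothing
  is assumed about \<open>p i\<close> and \<open>q j\<close> for \<open>i < j\<close>. The creators are stripped off one at a time,
  those with the largest index first.\<close>

lemma gspan_lowering:
  fixes q p :: "nat \<Rightarrow> 'r" and I :: "nat set"
  assumes J: "left_ideal J" and M: "linsub M" "J \<subseteq> M" and N: "left_ideal N"
    and qq: "\<And>i j. i \<in> I \<Longrightarrow> j \<in> I \<Longrightarrow> comm_mod J (q i) (q j) 0"
    and pM: "\<And>i x. i \<in> I \<Longrightarrow> x \<in> M \<Longrightarrow> p i * x \<in> J"
    and pq: "\<And>i. i \<in> I \<Longrightarrow> comm_mod J (p i) (q i) (sc (c i))" "\<And>i. i \<in> I \<Longrightarrow> c i \<noteq> 0"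
    and tri: "\<And>i j. i \<in> I \<Longrightarrow> j \<in> I \<Longrightarrow> j < i \<Longrightarrow>
        \<exists>Z. comm_mod J (p i) (q j) Z \<and> (\<forall>w\<in>gspan (q ` I) M. Z * w \<in> J)"
    and w: "w \<in> gspan (q ` I) M" "w \<in> N" "w \<notin> J"
  shows "\<exists>w'. w' \<in> M \<and> w' \<in> N \<and> w' \<notin> J"
proof -
  define S where "S K = gspan (q ` (I \<inter> {..<K})) M" for K
  have mono: "x \<in> S K' " if "x \<in> S K" "K \<le> K'" for x K K'
    using that unfolding S_def by (auto intro: gspan_mono[rotated])
  have low: "\<exists>w'. w' \<in> M \<and> w' \<in> N \<and> w' \<notin> J" if "x \<in> S K" "x \<in> N" "x \<notin> J" for x K
    using that
  proof (induction K arbitrary: x)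
    case 0
    have "y \<in> M" if "y \<in> gspan {} M" for y
      using that by induction (auto intro: linsubD[OF M(1)])
    then show ?case using 0 by (auto simp: S_def)
  next
    case (Suc K)
    show ?case
    proof (cases "K \<in> I")
      case False
      then have "I \<inter> {..<Suc K} = I \<inter> {..<K}" by (auto simp: less_Suc_eq)
      then show ?thesis using Suc by (auto simp: S_def)
    next
      case True
      then have e: "q ` (I \<inter> {..<Suc K}) = insert (q K) (q ` (I \<inter> {..<K}))"
        by (auto simp: less_Suc_eq)
      have "\<exists>d. x \<in> poly_span (q K) (S K) d"
        unfolding S_def
        by (rule gspan_insert_poly_span[OF J M]) (use qq True Suc.prems(1) e in \<open>auto simp: S_def\<close>)
      then obtain d where d: "x \<in> poly_span (q K) (S K) d" ..
      have lS: "linsub (S K)" "J \<subseteq> S K"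
        using linsub_gspan[OF M(1)] M(2) by (auto simp: S_def intro: gspan.base)
      have kill: "p K * y \<in> J" if "y \<in> S K" for y
        using that unfolding S_def
      proof (rule gspan_kill[OF J, rotated 2])
        show "p K * x \<in> J" if "x \<in> M" for x using pM True that by blast
        fix r assume "r \<in> q ` (I \<inter> {..<K})"
        then obtain j where j: "r = q j" "j \<in> I" "j < K" by auto
        then show "\<exists>Z. comm_mod J (p K) r Z \<and> (\<forall>w\<in>gspan (q ` (I \<inter> {..<K})) M. Z * w \<in> J)"
          using tri[OF True j(2,3)] gspan_mono[of "q ` (I \<inter> {..<K})" "q ` I" _ M] by blast
      qed
      obtain w' where "w' \<in> S K" "w' \<in> N" "w' \<notin> J"
        using poly_span_lowering[OF J lS N kill pq(1)[OF True] pq(2)[OF True] d Suc.prems(2,3)] by blast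
      then show ?thesis by (rule Suc.IH)
    qed
  qed
  have "\<exists>K. x \<in> S K" if "x \<in> gspan (q ` I) M" for x
    using that
  proof induction
    case (base x)
    then show ?case by (auto simp: S_def intro: gspan.base)
  next
    case (add x y)
    then obtain K L where "x \<in> S K" "y \<in> S L" by auto
    then have "x \<in> S (max K L)" "y \<in> S (max K L)" using mono by auto
    then show ?case unfolding S_def by (blast intro: gspan.add)
  next
    case (scal x s)
    then show ?case unfolding S_def by (blast intro: gspan.scal)
  next
    case (op r x)
    then obtain j K where "r = q j" "j \<in> I" "x \<in> S K" by auto
    then have "r \<in> q ` (I \<inter> {..<max K (Suc j)})" "x \<in> S (max K (Suc j))" using mono by auto
    then show ?case unfolding S_def by (blast intro: gspan.op)
  qed
  then show ?thesis using low w by blast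
qed

lemma comm_mod_cong: "linsub J \<Longrightarrow> comm_mod J X Y Z \<Longrightarrow> (\<And>w. (Z - Z') * w \<in> J) \<Longrightarrow> comm_mod J X Y Z'"
  unfolding comm_mod_def
proof
  fix w assume J: "linsub J" and 1: "\<forall>w. (X * Y - Y * X - Z) * w \<in> J" and 2: "\<And>w. (Z - Z') * w \<in> J"
  have "(X * Y - Y * X - Z') * w = (X * Y - Y * X - Z) * w + (Z - Z') * w" by (simp add: algebra_simps)
  then show "(X * Y - Y * X - Z') * w \<in> J" using 1 2 linsubD(2)[OF J] by metis
qed

end

text \<open>\<open>C 0\<close> is central modulo \<open>J\<close>, so it acts on the whole quotient
  as - n and its assumption carries an arbitrary \<open>w\<close>; the assumptions
  \<open>vac\<close> concern the vacuum vector 1 alone. \<open>generated\<close> says that scalars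
  and modes generate the ring modulo \<open>J\<close>, in the form of an induction
  principle.\<close>

locale affine_system = scalars sc for sc :: "complex \<Rightarrow> 'r::ring_1" +
  fixes A B C D :: "int \<Rightarrow> 'r" and J :: "'r set" and n :: nat and \<delta> :: complex
  assumes J: "left_ideal J"
    and AA: "comm_mod J (A p) (A q) 0" and BB: "comm_mod J (B p) (B q) 0"
    and CC: "comm_mod J (C p) (C q) 0" and DD: "comm_mod J (D p) (D q) 0"
    and CA: "comm_mod J (C p) (A q) 0" and CB: "comm_mod J (C p) (B q) 0"
    and AB: "comm_mod J (A p) (B q) (C (p + q) + sc (if p + q = 0 then of_int p else 0))"
    and DA: "comm_mod J (D p) (A q) (A (p + q))" and DB: "comm_mod J (D p) (B q) (- B (p + q))"
    and CD: "comm_mod J (C p) (D q) (sc (if p + q = 0 then of_int p else 0))"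
    and C0: "(C 0 + sc (of_nat n)) * w \<in> J"
    and vac: "p \<ge> 0 \<Longrightarrow> A p \<in> J" "p \<ge> 1 \<Longrightarrow> B p \<in> J" "p \<ge> 1 \<Longrightarrow> C p \<in> J" "p \<ge> 1 \<Longrightarrow> D p \<in> J"
      "D 0 - sc \<delta> \<in> J"
    and generated: "\<lbrakk>linsub M; J \<subseteq> M; 1 \<in> M;
      \<And>p x. x \<in> M \<Longrightarrow> A p * x \<in> M \<and> B p * x \<in> M \<and> C p * x \<in> M \<and> D p * x \<in> M\<rbrakk> \<Longrightarrow> M = UNIV"
begin

lemma lJ: "linsub J"
  by (rule linsub_left_ideal[OF J])

lemma AC: "comm_mod J (A p) (C q) 0" using comm_mod_sym[OF lJ CA] by simp
lemma BC: "comm_mod J (B p) (C q) 0" using comm_mod_sym[OF lJ CB] by simp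
lemma BA: "comm_mod J (B p) (A q) (- (C (p + q) + sc (if p + q = 0 then of_int q else 0)))"
  using comm_mod_sym[OF lJ AB[of q p]] by (simp add: add.commute)
lemma AD: "comm_mod J (A p) (D q) (- A (p + q))"
  using comm_mod_sym[OF lJ DA[of q p]] by (simp add: add.commute)
lemma BD: "comm_mod J (B p) (D q) (B (p + q))"
  using comm_mod_sym[OF lJ DB[of q p]] by (simp add: add.commute)
lemma DC: "comm_mod J (D p) (C q) (sc (if p + q = 0 then of_int p else 0))"
  using comm_mod_sym[OF lJ CD[of q p]]
  by (simp add: add.commute sc_minus[symmetric] if_distrib eq_neg_iff_add_eq_0 del: of_int_minus cong: if_cong)
    (metis add.inverse_inverse add_eq_0_iff of_int_minus)

text \<open>A tower over the vacuum line \<open>V0\<close>, in which the outermost creators are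
  stripped first. \<open>B (- n)\<close> is left out of \<open>V3\<close>, whereas
  \<open>B 0\<close> counts as a creator when \<open>n\<close> is not 0, since the vacuum is killed
  only by \<open>B p\<close> with \<open>p \<ge> 1\<close>.\<close>

definition V0 where "V0 = {sc s + j | s j. j \<in> J}"
definition V1 where "V1 = gspan ((\<lambda>i. C (- int i)) ` {1..}) V0"
definition V2 where "V2 = gspan ((\<lambda>i. A (- int i)) ` {1..}) V1"
definition V3 where "V3 = gspan ((\<lambda>i. B (- int i)) ` (- {n})) V2"
definition V4 where "V4 = gspan ((\<lambda>i. D (- int i)) ` {1..}) V3"

lemma linsub_V: "linsub V0" "linsub V1" "linsub V2" "linsub V3" "linsub V4"
proof -
  show "linsub V0"
    unfolding linsub_def
  proof (intro conjI ballI allI)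
    show "0 \<in> V0" unfolding V0_def using left_idealD(1)[OF J] by (auto intro!: exI[of _ 0])
    show "x + y \<in> V0" if xy: "x \<in> V0" "y \<in> V0" for x y
    proof -
      obtain s i t j where "x = sc s + i" "y = sc t + j" "i \<in> J" "j \<in> J" using xy unfolding V0_def by auto
      then have "x + y = sc (s + t) + (i + j)" "i + j \<in> J" using left_idealD(2)[OF J] by (auto simp: sc_add)
      then show ?thesis unfolding V0_def by blast
    qed
    show "sc t * x \<in> V0" if "x \<in> V0" for t x
    proof -
      obtain s i where "x = sc s + i" "i \<in> J" using \<open>x \<in> V0\<close> unfolding V0_def by auto
      then have "sc t * x = sc (t * s) + sc t * i" "sc t * i \<in> J"
        using left_idealD(3)[OF J] by (auto simp: sc_mult distrib_left)
      then show ?thesis unfolding V0_def by blast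
    qed
  qed
  then show "linsub V1" unfolding V1_def by (rule linsub_gspan)
  then show "linsub V2" unfolding V2_def by (rule linsub_gspan)
  then show "linsub V3" unfolding V3_def by (rule linsub_gspan)
  then show "linsub V4" unfolding V4_def by (rule linsub_gspan)
qed

lemma V_subset: "J \<subseteq> V0" "V0 \<subseteq> V1" "V1 \<subseteq> V2" "V2 \<subseteq> V3" "V3 \<subseteq> V4"
proof -
  show "J \<subseteq> V0" unfolding V0_def using sc_0 by (smt (verit) add_0 mem_Collect_eq subsetI)
qed (auto simp: V1_def V2_def V3_def V4_def intro: gspan.base)

lemma J_subset: "J \<subseteq> V1" "J \<subseteq> V2" "J \<subseteq> V3" "J \<subseteq> V4"
  using V_subset by auto

lemma one_V0: "1 \<in> V0"
  unfolding V0_def using left_idealD(1)[OF J] by (intro CollectI exI[of _ 1] exI[of _ 0]) auto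

lemma V_op:
  "w \<in> V1 \<Longrightarrow> i \<ge> 1 \<Longrightarrow> C (- int i) * w \<in> V1"
  "w \<in> V2 \<Longrightarrow> i \<ge> 1 \<Longrightarrow> A (- int i) * w \<in> V2"
  "w \<in> V3 \<Longrightarrow> i \<noteq> n \<Longrightarrow> B (- int i) * w \<in> V3"
  "w \<in> V4 \<Longrightarrow> i \<ge> 1 \<Longrightarrow> D (- int i) * w \<in> V4"
  unfolding V1_def V2_def V3_def V4_def by (auto intro!: gspan.op)

text \<open>Scalars are central, so on the vacuum line an operator is controlled by its value
  \<open>X\<close> at the vector 1.\<close>

lemma V0_op:
  assumes "linsub G" "J \<subseteq> G" "X \<in> G" "w \<in> V0"
  shows "X * w \<in> G"
proof -
  obtain s j where "w = sc s + j" "j \<in> J" using assms(4) unfolding V0_def by auto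
  then have "X * w = sc s * X + X * j" "X * j \<in> J"
    using left_idealD(3)[OF J] by (auto simp: distrib_left sc_central)
  then show ?thesis using assms linsubD(2,3)[OF assms(1)] by auto
qed

lemmas V1_stable = gspan_stable1[OF J, of _ "{1..}" "\<lambda>i. C (- int i)" V0, folded V1_def]
lemmas V2_stable = gspan_stable1[OF J, of _ "{1..}" "\<lambda>i. A (- int i)" V1, folded V2_def]
lemmas V3_stable = gspan_stable1[OF J, of _ "- {n}" "\<lambda>i. B (- int i)" V2, folded V3_def]
lemmas V4_stable = gspan_stable1[OF J, of _ "{1..}" "\<lambda>i. D (- int i)" V3, folded V4_def]

lemma zero_J: "0 * w \<in> G" if "linsub G" using linsubD(1)[OF that] by simp

lemma commuting_stable:
  assumes "linsub G" "J \<subseteq> G"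
  shows "(\<And>i x. i \<ge> 1 \<Longrightarrow> x \<in> G \<Longrightarrow> C (- int i) * x \<in> G) \<Longrightarrow> X \<in> G \<Longrightarrow>
      (\<And>i. comm_mod J X (C i) 0) \<Longrightarrow> w \<in> V1 \<Longrightarrow> X * w \<in> G"
    "(\<And>i x. i \<ge> 1 \<Longrightarrow> x \<in> G \<Longrightarrow> A (- int i) * x \<in> G) \<Longrightarrow> (\<And>x. x \<in> V1 \<Longrightarrow> X * x \<in> G) \<Longrightarrow>
      (\<And>i. comm_mod J X (A i) 0) \<Longrightarrow> w \<in> V2 \<Longrightarrow> X * w \<in> G"
    "(\<And>i x. i \<noteq> n \<Longrightarrow> x \<in> G \<Longrightarrow> B (- int i) * x \<in> G) \<Longrightarrow> (\<And>x. x \<in> V2 \<Longrightarrow> X * x \<in> G) \<Longrightarrow>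
      (\<And>i. comm_mod J X (B i) 0) \<Longrightarrow> w \<in> V3 \<Longrightarrow> X * w \<in> G"
    "(\<And>i x. i \<ge> 1 \<Longrightarrow> x \<in> G \<Longrightarrow> D (- int i) * x \<in> G) \<Longrightarrow> (\<And>x. x \<in> V3 \<Longrightarrow> X * x \<in> G) \<Longrightarrow>
      (\<And>i. comm_mod J X (D i) 0) \<Longrightarrow> w \<in> V4 \<Longrightarrow> X * w \<in> G"
  subgoal by (rule V1_stable[where Z = "\<lambda>_. 0"]) (use assms zero_J[OF assms(1)] in \<open>auto intro: V0_op\<close>)
  subgoal by (rule V2_stable[where Z = "\<lambda>_. 0"]) (use assms zero_J[OF assms(1)] in \<open>auto\<close>)
  subgoal by (rule V3_stable[where Z = "\<lambda>_. 0"]) (use assms zero_J[OF assms(1)] in \<open>auto\<close>)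
  subgoal by (rule V4_stable[where Z = "\<lambda>_. 0"]) (use assms zero_J[OF assms(1)] in \<open>auto\<close>)
  done

lemma int_mode_cases [case_names pos nonpos]:
  fixes k :: int
  obtains "k \<ge> 1" | i where "k = - int i"
  by (metis int_cases2 int_one_le_iff_zero_less nat_int neg_0_equal_iff_equal of_nat_0 of_nat_0_less_iff zero_less_iff_neq_zero)

lemma C_kill_V2: "k \<ge> 1 \<Longrightarrow> w \<in> V2 \<Longrightarrow> C k * w \<in> J"
  by (rule commuting_stable(2)[OF lJ order_refl])
    (use commuting_stable(1)[OF lJ order_refl] left_idealD(3)[OF J] vac CC CA in auto)

lemma C_kill: "k \<ge> 1 \<Longrightarrow> w \<in> V3 \<Longrightarrow> C k * w \<in> J"
  by (rule commuting_stable(3)[OF lJ order_refl]) (use C_kill_V2 left_idealD(3)[OF J] CB in auto)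

lemma C0_stable: "linsub M \<Longrightarrow> J \<subseteq> M \<Longrightarrow> w \<in> M \<Longrightarrow> C 0 * w \<in> M"
proof -
  assume M: "linsub M" "J \<subseteq> M" "w \<in> M"
  have "C 0 * w = (C 0 + sc (of_nat n)) * w - sc (of_nat n) * w" by (simp add: algebra_simps)
  then show ?thesis using C0[of w] M linsubD(3,5)[OF M(1)] by auto
qed

lemma C_V3: "w \<in> V3 \<Longrightarrow> C k * w \<in> V3"
proof (cases k rule: int_mode_cases)
  case pos
  then show "w \<in> V3 \<Longrightarrow> C k * w \<in> V3" using C_kill J_subset by blast
next
  case (nonpos i)
  show "C k * w \<in> V3" if w: "w \<in> V3"
  proof (cases "i = 0")
    case True
    then show ?thesis using C0_stable linsub_V J_subset nonpos w by auto
  next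
    case False
    have 2: "C k * x \<in> V2" if "x \<in> V2" for x
      by (rule commuting_stable(2)[OF linsub_V(3) J_subset(2) _ _ _ that])
        (use V_op(1,2) V_subset CA False nonpos in auto)
    show ?thesis
      by (rule commuting_stable(3)[OF linsub_V(4) J_subset(3) _ _ _ w])
        (use V_op(3) V_subset CB 2 in auto)
  qed
qed

lemma A_kill: "p \<ge> 0 \<Longrightarrow> w \<in> V2 \<Longrightarrow> A p * w \<in> J"
  by (rule commuting_stable(2)[OF lJ order_refl])
    (use commuting_stable(1)[OF lJ order_refl] left_idealD(3)[OF J] vac AC AA in auto)

lemma C_sc_V3: "w \<in> V3 \<Longrightarrow> (C k + sc s) * w \<in> V3" "w \<in> V3 \<Longrightarrow> - (C k + sc s) * w \<in> V3"
proof -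
  assume "w \<in> V3"
  then have "C k * w + sc s * w \<in> V3" using C_V3 linsubD(2,3)[OF linsub_V(4)] by blast
  then show "(C k + sc s) * w \<in> V3" "- (C k + sc s) * w \<in> V3"
    using linsubD(4)[OF linsub_V(4)] by (auto simp: distrib_right simp del: minus_add_distrib minus_mult_left[symmetric])
      (metis (no_types, lifting) distrib_right minus_mult_left)
qed

text \<open>On \<open>V2\<close> the mode is either an annihilator or one of the creators; passing a
  \<open>B\<close> it leaves a mode of \<open>C\<close> and a scalar, both of which preserve
  \<open>V3\<close>.\<close>

lemma A_V3: "w \<in> V3 \<Longrightarrow> A p * w \<in> V3"
proof (rule V3_stable[OF linsub_V(4) J_subset(3) _ _ AB])
  show "A p * x \<in> V3" if "x \<in> V2" for x
    using that
    by (cases p rule: int_mode_cases; cases "p = 0")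
      (use A_kill V_op(2) V_subset(4) J_subset in \<open>auto simp: Suc_le_eq intro: gr0I\<close>)
qed (use V_op(3) C_sc_V3 in auto)

text \<open>The relation is assumed on the vacuum only. It propagates because \<open>B q\<close>
  commutes with the creators \<open>C\<close> and \<open>B\<close>, and passing an \<open>A\<close>
  it leaves a mode of \<open>C\<close> and a scalar.\<close>

lemma B_V3:
  assumes rel: "B (- int n) \<in> V3"
  shows "w \<in> V3 \<Longrightarrow> B q * w \<in> V3"
proof -
  have 0: "B q \<in> V3"
  proof (cases q rule: int_mode_cases)
    case (nonpos i)
    then show ?thesis using rel V_op(3)[of 1 i] one_V0 V_subset by (cases "i = n") auto
  qed (use vac J_subset in auto)
  have 1: "B q * w \<in> V3" if "w \<in> V1" for w
    by (rule commuting_stable(1)[OF linsub_V(4) J_subset(3) _ _ _ that]) (use C_V3 BC 0 in auto)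
  have 2: "B q * w \<in> V3" if "w \<in> V2" for w
    by (rule V2_stable[OF linsub_V(4) J_subset(3) _ _ BA _ that])
      (use A_V3 1 C_sc_V3(2) C_V3 linsubD(4)[OF linsub_V(4)] V_subset(4) in auto)
  show "B q * w \<in> V3" if "w \<in> V3"
    by (rule commuting_stable(3)[OF linsub_V(4) J_subset(3) _ _ _ that]) (use V_op 2 BB in auto)
qed

lemma D_V3:
  assumes rel: "B (- int n) \<in> V3" and k: "k \<ge> 0"
  shows "w \<in> V3 \<Longrightarrow> D k * w \<in> V3"
proof -
  note l = linsubD[OF linsub_V(4)]
  have 0: "D k \<in> V3"
  proof (cases "k = 0")
    case True
    have "D 0 = (D 0 - sc \<delta>) + sc \<delta> * 1" by simp
    then show ?thesis using True vac(5) l(2,3) J_subset(3) V_subset one_V0 by (metis subsetD)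
  qed (use k vac J_subset in auto)
  have 1: "D k * w \<in> V3" if "w \<in> V1" for w
    by (rule V1_stable[OF linsub_V(4) J_subset(3) _ _ DC _ that])
      (use C_V3 0 V_subset l V0_op[OF linsub_V(4) J_subset(3)] in auto)
  have 2: "D k * w \<in> V3" if "w \<in> V2" for w
    by (rule V2_stable[OF linsub_V(4) J_subset(3) _ _ DA _ that]) (use A_V3 1 V_subset in auto)
  show "D k * w \<in> V3" if "w \<in> V3"
    by (rule V3_stable[OF linsub_V(4) J_subset(3) _ _ DB _ that]) (use B_V3[OF rel] 2 l in auto)
qed

text \<open>The tower contains 1 and is stable under all modes. All \<open>A p\<close>, and likewise
  all \<open>B p\<close>, are treated at once, because the commutator with a \<open>D\<close> is a
  mode of the same kind with shifted index.\<close>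

lemma V4_UNIV:
  assumes rel: "B (- int n) \<in> V3"
  shows "V4 = UNIV"
proof (rule generated[OF linsub_V(5) J_subset(4)])
  show "1 \<in> V4" using one_V0 V_subset by blast
  fix p x assume x: "x \<in> V4"
  note l = linsubD[OF linsub_V(5)]
  have "X * x \<in> V4" if "X \<in> range A" for X
    using x that
  proof (rule gspan_stable[where Q = "(\<lambda>i. D (- int i)) ` {1..}" and M = V3, folded V4_def, OF J, rotated -2])
    fix X q assume "X \<in> range A" "q \<in> (\<lambda>i. D (- int i)) ` {1..}"
    then show "\<exists>Z. comm_mod J X q Z \<and> (\<forall>w\<in>V4. (\<forall>X'\<in>range A. X' * w \<in> V4) \<longrightarrow> Z * w \<in> V4)"
      using AD l(4) by (fastforce simp: minus_mult_left[symmetric])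
  qed (use linsub_V(5) J_subset(4) V_op(4) A_V3 V_subset in auto)
  moreover have "X * x \<in> V4" if "X \<in> range B" for X
    using x that
  proof (rule gspan_stable[where Q = "(\<lambda>i. D (- int i)) ` {1..}" and M = V3, folded V4_def, OF J, rotated -2])
    fix X q assume "X \<in> range B" "q \<in> (\<lambda>i. D (- int i)) ` {1..}"
    then show "\<exists>Z. comm_mod J X q Z \<and> (\<forall>w\<in>V4. (\<forall>X'\<in>range B. X' * w \<in> V4) \<longrightarrow> Z * w \<in> V4)"
      using BD by fastforce
  qed (use linsub_V(5) J_subset(4) V_op(4) B_V3[OF rel] V_subset in auto)
  moreover have "C p * x \<in> V4"
    by (rule V4_stable[OF linsub_V(5) J_subset(4) _ _ CD _ x])
      (use V_op(4) C_V3 V_subset l in auto)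
  moreover have "D p * x \<in> V4"
  proof (cases "p \<ge> 0")
    case True
    show ?thesis
      by (rule commuting_stable(4)[OF linsub_V(5) J_subset(4) _ _ DD x])
        (use V_op(4) D_V3[OF rel True] V_subset in auto)
  next
    case False
    then show ?thesis using V_op(4)[OF x, of "nat (- p)"] by auto
  qed
  ultimately show "A p * x \<in> V4 \<and> B p * x \<in> V4 \<and> C p * x \<in> V4 \<and> D p * x \<in> V4" by auto
qed

text \<open>By the relation \<open>rel\<close> the mode \<open>B (- n)\<close> is redundant; it is the only creator whose commutator with
  its would-be annihilator \<open>A n\<close> has vanishing scalar part \<open>n + C 0\<close>.\<close>

theorem maximal_left_ideal:
  assumes rel: "B (- int n) \<in> V3" and N: "left_ideal N" and JN: "J \<subset> N"
  shows "1 \<in> N"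
proof -
  have sc0: "sc 0 * w \<in> J" for w using left_idealD(1)[OF J] by simp
  obtain w4 where "w4 \<in> V4" "w4 \<in> N" "w4 \<notin> J" using JN V4_UNIV[OF rel] by auto
  then have "\<exists>w. w \<in> V3 \<and> w \<in> N \<and> w \<notin> J"
  proof (rule gspan_lowering[where q = "\<lambda>i. D (- int i)" and I = "{1..}" and M = V3, folded V4_def, OF J linsub_V(4) J_subset(3) N, rotated -3])
    fix i :: nat assume i: "i \<in> {1..}"
    show "comm_mod J (C (int i)) (D (- int i)) (sc (of_nat i))" using CD[of "int i" "- int i"] by simp
    show "\<exists>Z. comm_mod J (C (int i)) (D (- int j)) Z \<and> (\<forall>w\<in>V4. Z * w \<in> J)" if "j < i" for j
      using CD[of "int i" "- int j"] that sc0 by (intro exI[of _ 0]) auto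
  qed (use DD C_kill in auto)
  then obtain w3 where "w3 \<in> V3" "w3 \<in> N" "w3 \<notin> J" by auto
  then have "\<exists>w. w \<in> V2 \<and> w \<in> N \<and> w \<notin> J"
  proof (rule gspan_lowering[where q = "\<lambda>i. B (- int i)" and I = "- {n}" and M = V2, folded V3_def, OF J linsub_V(3) J_subset(2) N, rotated -3])
    fix i :: nat assume i: "i \<in> - {n}"
    show "comm_mod J (A (int i)) (B (- int i)) (sc (of_nat i - of_nat n))"
    proof (rule comm_mod_cong[OF lJ AB])
      fix w
      have "sc (of_nat i - of_nat n) = sc (of_nat i) - sc (of_nat n)"
        using sc_add[of "of_nat i" "- of_nat n"] by (simp add: sc_minus)
      then show "(C (int i + - int i) + sc (if int i + - int i = 0 then of_int (int i) else 0) -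
          sc (of_nat i - of_nat n)) * w \<in> J" using C0[of w] by simp
    qed
    show "(of_nat i - of_nat n :: complex) \<noteq> 0" using i by auto
    show "\<exists>Z. comm_mod J (A (int i)) (B (- int j)) Z \<and> (\<forall>w\<in>V3. Z * w \<in> J)" if "j < i" for j
      using AB[of "int i" "- int j"] that C_kill by (intro exI[of _ "C (int i - int j)"]) auto
  qed (use BB A_kill in auto)
  then obtain w2 where "w2 \<in> V2" "w2 \<in> N" "w2 \<notin> J" by auto
  then have "\<exists>w. w \<in> V1 \<and> w \<in> N \<and> w \<notin> J"
  proof (rule gspan_lowering[where q = "\<lambda>i. A (- int i)" and I = "{1..}" and M = V1, folded V2_def, OF J linsub_V(2) J_subset(1) N, rotated -3])
    fix i :: nat assume i: "i \<in> {1..}"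
    show "B (int i) * x \<in> J" if "x \<in> V1" for x
      by (rule commuting_stable(1)[OF lJ order_refl _ _ _ that]) (use i vac BC left_idealD(3)[OF J] in auto)
    show "comm_mod J (B (int i)) (A (- int i)) (sc (of_nat i + of_nat n))"
    proof (rule comm_mod_cong[OF lJ BA])
      fix w
      show "(- (C (int i + - int i) + sc (if int i + - int i = 0 then of_int (- int i) else 0)) -
          sc (of_nat i + of_nat n)) * w \<in> J"
        using left_idealD(4)[OF J C0[of w]] by (simp add: sc_minus sc_add algebra_simps)
    qed
    show "(of_nat i + of_nat n :: complex) \<noteq> 0" using i by (metis atLeast_iff add_is_0 not_one_le_zero of_nat_add of_nat_eq_0_iff)
    show "\<exists>Z. comm_mod J (B (int i)) (A (- int j)) Z \<and> (\<forall>w\<in>V2. Z * w \<in> J)" if "j < i" for j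
      using BA[of "int i" "- int j"] that C_kill_V2 left_idealD(4)[OF J]
      by (intro exI[of _ "- C (int i - int j)"]) (auto simp: minus_mult_left[symmetric])
  qed (use AA in auto)
  then obtain w1 where "w1 \<in> V1" "w1 \<in> N" "w1 \<notin> J" by auto
  then have "\<exists>w. w \<in> V0 \<and> w \<in> N \<and> w \<notin> J"
  proof (rule gspan_lowering[where q = "\<lambda>i. C (- int i)" and I = "{1..}" and M = V0, folded V1_def, OF J linsub_V(1) V_subset(1) N, rotated -3])
    fix i :: nat assume i: "i \<in> {1..}"
    show "D (int i) * x \<in> J" if "x \<in> V0" for x
      by (rule V0_op[OF lJ order_refl _ that]) (use i vac in auto)
    show "comm_mod J (D (int i)) (C (- int i)) (sc (of_nat i))" using DC[of "int i" "- int i"] by simp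
    show "\<exists>Z. comm_mod J (D (int i)) (C (- int j)) Z \<and> (\<forall>w\<in>V1. Z * w \<in> J)" if "j < i" for j
      using DC[of "int i" "- int j"] that sc0 by (intro exI[of _ 0]) auto
  qed (use CC in auto)
  then obtain s j where sj: "sc s + j \<in> N" "j \<in> J" "sc s + j \<notin> J" unfolding V0_def by auto
  then have "s \<noteq> 0" by auto
  have "sc s \<in> N" using left_idealD(5)[OF N sj(1), of j] sj JN by auto
  then have "sc (1 / s) * sc s \<in> N" by (rule left_idealD(3)[OF N])
  then show ?thesis using \<open>s \<noteq> 0\<close> by (simp flip: sc_mult)
qed

end

section \<open>A Fock space\<close>

datatype fvar = Gv nat | Av nat | Cv nat | Dv nat

type_synonym fock = "(fvar \<Rightarrow>\<^sub>0 nat) \<Rightarrow>\<^sub>0 complex"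

abbreviation cst :: "complex \<Rightarrow> fock" where "cst s \<equiv> Poly_Mapping.single 0 s"

definition var :: "fvar \<Rightarrow> fock" where "var x = Poly_Mapping.single (Poly_Mapping.single x 1) 1"

lemma cst_simps: "cst (s + t) = cst s + cst t" "cst (s * t) = cst s * cst t" "cst (- s) = - cst s"
    "cst (s - t) = cst s - cst t"
  by (simp_all add: single_add mult_single single_uminus single_diff)

lemma poly_mapping_single_induct [case_names zero add single]:
  assumes "P 0" "\<And>f g. P f \<Longrightarrow> P g \<Longrightarrow> P (f + g)" "\<And>k s. P (Poly_Mapping.single k s)"
  shows "P (f :: 'a \<Rightarrow>\<^sub>0 'b::comm_monoid_add)"
proof (induction f rule: update_induct)
  case (update f a b)
  have "Poly_Mapping.update a b f = Poly_Mapping.single a b + f"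
    using update(1) by (intro poly_mapping_eqI)
      (auto simp: lookup_update lookup_add lookup_single when_def in_keys_iff)
  then show ?case using assms(2)[OF assms(3) update(3)] by simp
qed (use assms in auto)

lemma fock_induct [case_names one add scale var]:
  assumes "P 1" "\<And>f g. P f \<Longrightarrow> P g \<Longrightarrow> P (f + g)" "\<And>s f. P f \<Longrightarrow> P (cst s * f)"
    "\<And>x f. P f \<Longrightarrow> P (var x * f)"
  shows "P f"
proof -
  have "\<forall>f. P f \<longrightarrow> P (Poly_Mapping.single k 1 * f)" for k :: "fvar \<Rightarrow>\<^sub>0 nat"
  proof (induction k rule: poly_mapping_single_induct)
    case (add k l)
    have "Poly_Mapping.single (k + l) 1 * f = Poly_Mapping.single k 1 * (Poly_Mapping.single l 1 * f)" for f :: fock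
      by (simp add: mult_single mult.assoc[symmetric])
    then show ?case using add by simp
  next
    case (single x j)
    show ?case
    proof (induction j)
      case (Suc j)
      have "Poly_Mapping.single (Poly_Mapping.single x (Suc j)) 1 * f =
          var x * (Poly_Mapping.single (Poly_Mapping.single x j) 1 * f)" for f :: fock
        by (simp add: var_def mult_single mult.assoc[symmetric] single_add[symmetric])
      then show ?case using Suc assms(4) by simp
    qed simp
  qed simp
  then have mon: "P (Poly_Mapping.single k 1)" for k using assms(1) by (metis mult.right_neutral)
  show ?thesis
  proof (induction f rule: poly_mapping_single_induct)
    case zero
    then show ?case using assms(3)[OF assms(1), of 0] by simp
  next
    case (single k s)
    then show ?case using assms(3)[OF mon, of s k] by (simp add: mult_single)
  qed (use assms in auto)
qed

definition linext :: "('k \<Rightarrow> fock) \<Rightarrow> ('k \<Rightarrow>\<^sub>0 complex) \<Rightarrow> fock"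
  where "linext h f = (\<Sum>k\<in>Poly_Mapping.keys f. cst (Poly_Mapping.lookup f k) * h k)"

lemma linext_add: "linext h (f + g) = linext h f + linext h g"
  unfolding linext_def
  by (rule setsum_keys_plus_distrib) (simp_all add: cst_simps algebra_simps)

lemma linext_single: "linext h (Poly_Mapping.single k s) = cst s * h k"
  by (cases "s = 0") (simp_all add: linext_def)

lemma linext_0 [simp]: "linext h 0 = 0"
  by (simp add: linext_def)

definition lin :: "(fock \<Rightarrow> fock) \<Rightarrow> bool"
  where "lin X \<longleftrightarrow> (\<forall>f g. X (f + g) = X f + X g) \<and> (\<forall>s f. X (cst s * f) = cst s * X f)"

lemma linD:
  assumes "lin X"
  shows "X (f + g) = X f + X g" "X (cst s * f) = cst s * X f" "X 0 = 0" "X (- f) = - X f"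
    "X (f - g) = X f - X g"
proof -
  show *: "X (f + g) = X f + X g" "X (cst s * f) = cst s * X f" for f g s using assms by (auto simp: lin_def)
  show **: "X 0 = 0" using *(2)[of 0 0] by simp
  show m: "X (- f) = - X f" for f
    using *(1)[of f "- f"] ** by (simp add: eq_neg_iff_add_eq_0 add.commute)
  show "X (f - g) = X f - X g" using *(1)[of f "- g"] m by simp
qed

lemma lin_mult: "lin (\<lambda>f. g * f)" "lin (\<lambda>f. f)"
  by (auto simp: lin_def algebra_simps)

lemma lin_comp: "lin X \<Longrightarrow> lin Y \<Longrightarrow> lin (\<lambda>f. X (Y f))"
  by (simp add: lin_def)

lemma lin_add: "lin X \<Longrightarrow> lin Y \<Longrightarrow> lin (\<lambda>f. X f + Y f)"
  by (simp add: lin_def algebra_simps)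

lemma lin_minus: "lin X \<Longrightarrow> lin (\<lambda>f. - X f)" "lin X \<Longrightarrow> lin Y \<Longrightarrow> lin (\<lambda>f. X f - Y f)"
  by (simp_all add: lin_def algebra_simps)

text \<open>The partial derivative in \<open>x\<close>. The exponents are subtracted with truncation
  at 0, but where truncation occurs the factor in front is 0.\<close>

definition pd :: "fvar \<Rightarrow> fock \<Rightarrow> fock"
  where "pd x = linext (\<lambda>k. cst (of_nat (Poly_Mapping.lookup k x)) *
    Poly_Mapping.single (k - Poly_Mapping.single x 1) 1)"

lemma lin_pd: "lin (pd x)"
proof -
  have "pd x (cst s * f) = cst s * pd x f" for s f
  proof (induction f rule: poly_mapping_single_induct)
    case (single k t)
    then show ?case by (simp add: pd_def linext_single mult_single mult.assoc del: single_of_nat)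
  qed (simp_all add: pd_def linext_add algebra_simps)
  then show ?thesis by (simp add: lin_def pd_def linext_add)
qed

lemma pd_one: "pd x 1 = 0"
  using linext_single[of _ "0 :: fvar \<Rightarrow>\<^sub>0 nat" 1] by (simp add: pd_def)

lemma pd_var_mult: "pd x (var y * f) = (if x = y then f else 0) + var y * pd x f"
proof (induction f rule: poly_mapping_single_induct)
  case zero
  then show ?case by (simp add: linD(3)[OF lin_pd])
next
  case (add f g)
  then show ?case by (simp add: linD(1)[OF lin_pd] algebra_simps)
next
  case (single k s)
  show ?case
  proof (cases "x = y")
    case True
    have "(k + Poly_Mapping.single y 1) - Poly_Mapping.single y 1 = k" by simp
    moreover have "Poly_Mapping.single y 1 + (k - Poly_Mapping.single y 1) = k"
      if "Poly_Mapping.lookup k y \<noteq> 0"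
      using that by (intro poly_mapping_eqI) (auto simp: lookup_add lookup_minus lookup_single when_def)
    ultimately show ?thesis using True
      by (cases "Poly_Mapping.lookup k y = 0")
        (simp_all add: var_def pd_def mult_single linext_single lookup_add add.commute single_add[symmetric] algebra_simps)
  next
    case False
    have "(Poly_Mapping.single y 1 + k) - Poly_Mapping.single x 1 =
        Poly_Mapping.single y 1 + (k - Poly_Mapping.single x 1)"
      using False by (intro poly_mapping_eqI) (auto simp: lookup_add lookup_minus lookup_single when_def)
    then show ?thesis using False
      by (simp add: var_def pd_def mult_single linext_single lookup_add lookup_single del: single_of_nat)
  qed
qed

lemma pd_commute: "pd x (pd y f) = pd y (pd x f)"
proof (induction f rule: fock_induct)
  case (var z f)
  then show ?case by (auto simp: pd_var_mult linD[OF lin_pd])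
qed (simp_all add: pd_one linD[OF lin_pd])

text \<open>The source of all local finiteness: almost all annihilators vanish on a given
  polynomial.\<close>

lemma finite_pd: "finite {x. pd x f \<noteq> 0}"
proof (induction f rule: fock_induct)
  case (add f g)
  show ?case by (rule finite_subset[OF _ finite_UnI[OF add]]) (auto simp: linD[OF lin_pd])
next
  case (scale s f)
  show ?case by (rule finite_subset[OF _ scale]) (auto simp: linD[OF lin_pd])
next
  case (var y f)
  show ?case
    by (rule finite_subset[OF _ finite.insertI[OF var, of y]]) (auto simp: pd_var_mult split: if_splits)
qed (simp add: pd_one)

text \<open>Reduces an operator identity to the vacuum: a linear operator that commutes with all
  variables is multiplication by its value at 1.\<close>

lemma lin_scalar_unique:
  assumes T: "lin T" "\<And>x f. T (var x * f) = var x * T f" "T 1 = 0"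
  shows "T f = 0"
  by (induction f rule: fock_induct) (simp_all add: linD[OF T(1)] T)

section \<open>Locally finite sums of operators\<close>

definition locally_finite :: "(int \<Rightarrow> fock \<Rightarrow> fock) \<Rightarrow> bool"
  where "locally_finite T \<longleftrightarrow> (\<forall>f. finite {i. T i f \<noteq> 0})"

text \<open>\<open>Sum_any\<close> is 0 when infinitely many terms are nonzero, hence the recurring
  condition \<open>locally_finite\<close>.\<close>

definition lsum :: "(int \<Rightarrow> fock \<Rightarrow> fock) \<Rightarrow> fock \<Rightarrow> fock"
  where "lsum T f = Sum_any (\<lambda>i. T i f)"

lemma lsum_eq_sum:
  assumes "finite S" "{i. T i f \<noteq> 0} \<subseteq> S"
  shows "lsum T f = (\<Sum>i\<in>S. T i f)"
  unfolding lsum_def using Sum_any.expand_superset[OF assms] .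

lemma lsum_add: "locally_finite T \<Longrightarrow> locally_finite Y \<Longrightarrow> lsum (\<lambda>i f. T i f + Y i f) f = lsum T f + lsum Y f"
  unfolding lsum_def locally_finite_def by (rule Sum_any.distrib) auto

lemma locally_finite_minus: "locally_finite T \<Longrightarrow> locally_finite (\<lambda>i f. - T i f)"
  by (simp add: locally_finite_def)

lemma lsum_minus: "locally_finite T \<Longrightarrow> lsum (\<lambda>i f. - T i f) f = - lsum T f"
  using lsum_add[of T "\<lambda>i f. - T i f" f] by (simp add: locally_finite_def lsum_def eq_neg_iff_add_eq_0 add.commute)

lemma lsum_delta: "lsum (\<lambda>i f. if i = j then Y f else 0) f = Y f"
  by (subst lsum_eq_sum[of "{j}"]) auto

lemma locally_finite_delta: "locally_finite (\<lambda>i f. if i = j then Y f else 0)"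
  unfolding locally_finite_def by (auto intro: finite_subset[of _ "{j}"])

lemma lsum_reindex: "lsum (\<lambda>i. T (i + j)) f = lsum T f"
  unfolding lsum_def
  by (rule Sum_any.reindex_cong[of "\<lambda>i. i + j", symmetric]) (auto intro: bijI injI surjI[of _ "\<lambda>i. i - j"])

lemma lin_lsum:
  assumes "\<And>i. lin (T i)" "locally_finite T"
  shows "lin (lsum T)"
proof -
  have "lsum T (f + g) = lsum T f + lsum T g" for f g
  proof -
    have "lsum T (f + g) = Sum_any (\<lambda>i. T i f + T i g)" by (simp add: lsum_def linD[OF assms(1)])
    then show ?thesis using assms(2) by (simp add: Sum_any.distrib locally_finite_def lsum_def)
  qed
  moreover have "lsum T (cst s * f) = cst s * lsum T f" for s f
    using assms(2) by (simp add: lsum_def linD[OF assms(1)] Sum_any_right_distrib locally_finite_def)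
  ultimately show ?thesis by (simp add: lin_def)
qed

text \<open>The termwise commutator \<open>Y i\<close> is X T - T X, so its local finiteness is
  inherited, and all the sums involved can be taken over one finite index set.\<close>

lemma lsum_commutator:
  assumes "\<And>i. lin (T i)" "locally_finite T" "lin X" "\<And>i f. X (T i f) = T i (X f) + Y i f"
  shows "X (lsum T f) = lsum T (X f) + lsum Y f" "locally_finite Y"
proof -
  let ?S = "{i. T i f \<noteq> 0} \<union> {i. T i (X f) \<noteq> 0}"
  have Y: "Y i f = X (T i f) - T i (X f)" for i f using assms(4) by simp
  have fin: "finite ({i. T i f \<noteq> 0} \<union> {i. T i (X f) \<noteq> 0})" for f
    using assms(2) by (auto simp: locally_finite_def)
  have sub: "{i. Y i f \<noteq> 0} \<subseteq> {i. T i f \<noteq> 0} \<union> {i. T i (X f) \<noteq> 0}" for f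
    by (auto simp: Y linD[OF assms(3)])
  then show "locally_finite Y" unfolding locally_finite_def using fin finite_subset by blast
  have "X (sum g S) = (\<Sum>i\<in>S. X (g i))" for g and S :: "int set"
    by (induction S rule: infinite_finite_induct) (simp_all add: linD[OF assms(3)])
  then have "X (lsum T f) = (\<Sum>i\<in>?S. X (T i f))"
    by (subst lsum_eq_sum[OF fin]) auto
  also have "\<dots> = lsum T (X f) + lsum Y f"
    by (subst (1 2) lsum_eq_sum[OF fin[of f]]) (use sub in \<open>auto simp: assms(4) sum.distrib\<close>)
  finally show "X (lsum T f) = lsum T (X f) + lsum Y f" .
qed

lemma lsum_commute:
  assumes "\<And>i. lin (T i)" "locally_finite T" "lin X" "\<And>i f. X (T i f) = T i (X f)"
  shows "X (lsum T f) = lsum T (X f)"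
  using lsum_commutator(1)[OF assms(1-3), of "\<lambda>_ _. 0" f] assms(4) by (simp add: lsum_def)

text \<open>The modes of the fields \<open>\<beta>, \<gamma>, C, \<delta>\<close> with \<open>[\<beta> p, \<gamma> q] = \<delta>\<^bsub>p+q,0\<^esub>\<close> and \<open>[C p, \<delta> q] = p \<delta>\<^bsub>p+q,0\<^esub>\<close>.
  The variable \<open>Gv k\<close> is the creator \<open>\<gamma> (- k)\<close>, but \<open>Av k\<close>, \<open>Cv k\<close>, \<open>Dv k\<close> are \<open>\<beta>\<close>, \<open>C\<close>, \<open>\<delta>\<close> of mode \<open>- k - 1\<close>.\<close>

definition fbe :: "int \<Rightarrow> fock \<Rightarrow> fock"
  where "fbe p f = (if p \<ge> 0 then pd (Gv (nat p)) f else var (Av (nat (- p - 1))) * f)"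

text \<open>The sign on the derivative makes [\<beta> p, \<gamma> q] equal to +1 at p + q = 0 also
  when \<beta> p is the creator of the pair.\<close>

definition fga :: "int \<Rightarrow> fock \<Rightarrow> fock"
  where "fga p f = (if p \<le> 0 then var (Gv (nat (- p))) * f else - pd (Av (nat (p - 1))) f)"

definition fC :: "complex \<Rightarrow> int \<Rightarrow> fock \<Rightarrow> fock"
  where "fC \<zeta> p f = (if p < 0 then var (Cv (nat (- p - 1))) * f else if p = 0 then cst \<zeta> * f
    else cst (of_int p) * pd (Dv (nat (p - 1))) f)"

definition fde :: "complex \<Rightarrow> int \<Rightarrow> fock \<Rightarrow> fock"
  where "fde \<mu> p f = (if p < 0 then var (Dv (nat (- p - 1))) * f else if p = 0 then cst \<mu> * f
    else cst (of_int p) * pd (Cv (nat (p - 1))) f)"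

lemmas mode_defs = fbe_def fga_def fC_def fde_def

lemma lin_modes: "lin (fbe p)" "lin (fga p)" "lin (fC \<zeta> p)" "lin (fde \<mu> p)"
  by (auto simp: lin_def mode_defs linD[OF lin_pd] distrib_left mult.left_commute simp del: single_of_int)

lemma nat_eq_neg:
  "p \<ge> 0 \<Longrightarrow> q \<le> 0 \<Longrightarrow> (nat p = nat (- q)) \<longleftrightarrow> p + q = 0"
  "p > 0 \<Longrightarrow> q < 0 \<Longrightarrow> (nat (p - 1) = nat (- q - 1)) \<longleftrightarrow> p + q = 0" for p q :: int
  by auto

lemma mode_commutators:
  "fbe p (fbe q f) = fbe q (fbe p f)"
  "fga p (fga q f) = fga q (fga p f)"
  "fbe p (fga q f) = fga q (fbe p f) + (if p + q = 0 then f else 0)"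
  "fC \<zeta> p (fbe q f) = fbe q (fC \<zeta> p f)"
  "fC \<zeta> p (fga q f) = fga q (fC \<zeta> p f)"
  "fC \<zeta> p (fC \<zeta> q f) = fC \<zeta> q (fC \<zeta> p f)"
  "fde \<mu> p (fbe q f) = fbe q (fde \<mu> p f)"
  "fde \<mu> p (fga q f) = fga q (fde \<mu> p f)"
  "fde \<mu> p (fde \<mu> q f) = fde \<mu> q (fde \<mu> p f)"
  by (auto simp: mode_defs pd_var_mult linD[OF lin_pd] nat_eq_neg pd_commute mult.left_commute distrib_left
    cst_simps simp del: single_of_int)

lemma fC_fde: "fC \<zeta> p (fde \<mu> q f) = fde \<mu> q (fC \<zeta> p f) + cst (if p + q = 0 then of_int p else 0) * f"
proof (cases "p + q = 0")
  case True
  then have "q = - p" by simp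
  then show ?thesis
    by (auto simp: mode_defs pd_var_mult linD[OF lin_pd] mult.left_commute distrib_left
        cst_simps simp del: single_of_int)
qed (auto simp: mode_defs pd_var_mult linD[OF lin_pd] nat_eq_neg pd_commute mult.left_commute distrib_left
    cst_simps simp del: single_of_int)

lemma mode_one:
  "p \<ge> 0 \<Longrightarrow> fbe p 1 = 0" "p \<ge> 1 \<Longrightarrow> fga p 1 = 0" "p \<ge> 1 \<Longrightarrow> fC \<zeta> p 1 = 0" "p \<ge> 1 \<Longrightarrow> fde \<mu> p 1 = 0"
  by (auto simp: mode_defs pd_one)

lemma finite_annihilators:
  "finite {p. p \<ge> 0 \<and> fbe p f \<noteq> 0}" "finite {p. p > 0 \<and> fga p f \<noteq> 0}"
  "finite {p. p > 0 \<and> fC \<zeta> p f \<noteq> 0}"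
proof -
  have *: "finite (i ` {x. pd x f \<noteq> 0})" for i :: "fvar \<Rightarrow> int" using finite_pd by blast
  show "finite {p. p \<ge> 0 \<and> fbe p f \<noteq> 0}"
    by (rule finite_subset[OF _ *[of "\<lambda>x. case x of Gv n \<Rightarrow> int n | _ \<Rightarrow> 0"]], rule subsetI)
      (rule_tac x = "Gv (nat x)" in rev_image_eqI, auto simp: fbe_def)
  show "finite {p. p > 0 \<and> fga p f \<noteq> 0}"
    by (rule finite_subset[OF _ *[of "\<lambda>x. case x of Av n \<Rightarrow> int n + 1 | _ \<Rightarrow> 0"]], rule subsetI)
      (rule_tac x = "Av (nat (x - 1))" in rev_image_eqI, auto simp: fga_def)
  show "finite {p. p > 0 \<and> fC \<zeta> p f \<noteq> 0}"
    by (rule finite_subset[OF _ *[of "\<lambda>x. case x of Dv n \<Rightarrow> int n + 1 | _ \<Rightarrow> 0"]], rule subsetI)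
      (rule_tac x = "Dv (nat (x - 1))" in rev_image_eqI, auto simp: fC_def)
qed

lemma finite_int_reflect: "finite {i::int. P (q - i)}" if "finite {j. P j}"
  using finite_imageI[OF that, of "\<lambda>j. q - j"] by (rule rev_finite_subset) (auto intro!: image_eqI[of _ _ "q - _"])

section \<open>The composite fields \<open>fB\<close>, \<open>fJ\<close> and
  \<open>fD\<close>\<close>

definition fgC :: "complex \<Rightarrow> int \<Rightarrow> int \<Rightarrow> fock \<Rightarrow> fock"
  where "fgC \<zeta> q i f = fga i (fC \<zeta> (q - i) f)"

text \<open>The sum over \<open>i\<close> is the mode \<open>q\<close> of the normally ordered product \<open>:\<gamma> \<beta>:\<close>.\<close>

definition fnt :: "int \<Rightarrow> int \<Rightarrow> fock \<Rightarrow> fock"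
  where "fnt q i f = (if i \<le> 0 then fga i (fbe (q - i) f) else fbe (q - i) (fga i f))"

lemma lin_fgC: "lin (fgC \<zeta> q i)" and lin_fnt: "lin (fnt q i)"
  using lin_comp[OF lin_modes(2) lin_modes(3)] lin_comp[OF lin_modes(2) lin_modes(1)]
    lin_comp[OF lin_modes(1) lin_modes(2)]
  by (auto simp: fgC_def[abs_def] fnt_def[abs_def] lin_def)

text \<open>Outside the interval from \<open>q\<close> to 0 one of the two factors is an
  annihilator. As \<gamma> and C commute, that factor can be applied first.\<close>

lemma locally_finite_fgC: "locally_finite (fgC \<zeta> q)"
  unfolding locally_finite_def
proof
  fix f
  have "{i. fgC \<zeta> q i f \<noteq> 0} \<subseteq> {i. i > 0 \<and> fga i f \<noteq> 0} \<union> {i. q - i > 0 \<and> fC \<zeta> (q - i) f \<noteq> 0} \<union> {q..0}"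
    using linD(3)[OF lin_modes(2)] linD(3)[OF lin_modes(3)]
    by (auto simp: fgC_def mode_commutators(5)[symmetric]) (metis mode_commutators(5))
  then show "finite {i. fgC \<zeta> q i f \<noteq> 0}"
    by (rule finite_subset)
      (use finite_annihilators finite_int_reflect[OF finite_annihilators(3)] in auto)
qed

text \<open>As for \<open>fgC\<close>, with normal ordering in place of commutativity.\<close>

lemma locally_finite_fnt: "locally_finite (fnt q)"
  unfolding locally_finite_def
proof
  fix f
  have "{i. fnt q i f \<noteq> 0} \<subseteq> {i. i > 0 \<and> fga i f \<noteq> 0} \<union> {i. q - i \<ge> 0 \<and> fbe (q - i) f \<noteq> 0} \<union> {q..0}"
    using linD(3)[OF lin_modes(1)] linD(3)[OF lin_modes(2)]
    by (auto simp: fnt_def split: if_splits)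
  then show "finite {i. fnt q i f \<noteq> 0}"
    by (rule finite_subset)
      (use finite_annihilators finite_int_reflect[OF finite_annihilators(1)] in auto)
qed

text \<open>The sum is the mode \<open>q\<close> of \<gamma> C; the other term is the mode
  \<open>q\<close> of the derivative of \<gamma>, namely - q times \<gamma> q.\<close>

definition fB :: "complex \<Rightarrow> int \<Rightarrow> fock \<Rightarrow> fock"
  where "fB \<zeta> q f = lsum (fgC \<zeta> q) f - cst (of_int q) * fga q f"

definition fJ :: "int \<Rightarrow> fock \<Rightarrow> fock"
  where "fJ q = lsum (fnt q)"

text \<open>The multiple of \<open>fC\<close> cancels the anomaly in the commutators of the \<open>fJ\<close>.\<close>

definition fD :: "complex \<Rightarrow> complex \<Rightarrow> int \<Rightarrow> fock \<Rightarrow> fock"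
  where "fD \<zeta> \<mu> q f = fde \<mu> q f + cst (1 / 2) * fC \<zeta> q f - fJ q f"

lemma lin_fJ: "lin (fJ q)"
  unfolding fJ_def by (rule lin_lsum[OF lin_fnt locally_finite_fnt])

lemma lin_fB: "lin (fB \<zeta> q)"
  unfolding fB_def[abs_def]
  by (intro lin_minus lin_lsum lin_fgC locally_finite_fgC lin_comp[OF lin_mult(1) lin_modes(2)])

lemma lin_fD: "lin (fD \<zeta> \<mu> q)"
  unfolding fD_def[abs_def]
  by (intro lin_minus lin_add lin_fJ lin_modes lin_comp[OF lin_mult(1) lin_modes(3)])

text \<open>\<open>fB\<close> is made of modes of \<gamma> and C alone. Applied twice, this also
  shows that the \<open>fB\<close> commute with each other.\<close>

lemma fB_commute:
  assumes X: "lin X" "\<And>i f. X (fga i f) = fga i (X f)" "\<And>i f. X (fC \<zeta> i f) = fC \<zeta> i (X f)"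
  shows "X (fB \<zeta> q f) = fB \<zeta> q (X f)"
proof -
  have "X (lsum (fgC \<zeta> q) f) = lsum (fgC \<zeta> q) (X f)"
    by (rule lsum_commute[OF lin_fgC locally_finite_fgC X(1)]) (simp add: fgC_def X)
  then show ?thesis by (simp add: fB_def linD[OF X(1)] X del: single_of_int)
qed

lemma fga_fB: "fga r (fB \<zeta> q f) = fB \<zeta> q (fga r f)"
  by (rule fB_commute[OF lin_modes(2)]) (simp_all add: mode_commutators)

lemma fC_fB: "fC \<zeta> r (fB \<zeta> q f) = fB \<zeta> q (fC \<zeta> r f)"
  by (rule fB_commute[OF lin_modes(3)]) (simp_all add: mode_commutators)

lemma fB_fB: "fB \<zeta> p (fB \<zeta> q f) = fB \<zeta> q (fB \<zeta> p f)"
  by (rule fB_commute[OF lin_fB]) (simp_all add: fga_fB fC_fB)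

text \<open>In the sum \<gamma> C only the index i = - p pairs with \<beta> p, which gives C (p +
  q). The derivative of \<gamma> contributes - q, and this is p when p + q = 0.\<close>

lemma fbe_fB: "fbe p (fB \<zeta> q f) = fB \<zeta> q (fbe p f) + fC \<zeta> (p + q) f + cst (if p + q = 0 then of_int p else 0) * f"
proof -
  have "fbe p (lsum (fgC \<zeta> q) f) = lsum (fgC \<zeta> q) (fbe p f) + lsum (\<lambda>i f. if i = - p then fC \<zeta> (p + q) f else 0) f"
    by (rule lsum_commutator(1)[OF lin_fgC locally_finite_fgC lin_modes(1)])
      (auto simp: fgC_def mode_commutators add.commute)
  then show ?thesis
    by (auto simp: fB_def linD[OF lin_modes(1)] mode_commutators(3) lsum_delta cst_simps distrib_left
        add_eq_0_iff simp del: single_of_int)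
qed

text \<open>A mode of \<beta> or \<gamma> fails to commute with just one term of the normally
  ordered sum, the one that contains the opposite mode; the modes of C and \<delta> commute with
  every term.\<close>

lemma fJ_commutators:
  "fJ q (fbe r f) = fbe r (fJ q f) - fbe (q + r) f"
  "fJ q (fga r f) = fga r (fJ q f) + fga (q + r) f"
  "fJ q (fC \<zeta> r f) = fC \<zeta> r (fJ q f)"
  "fJ q (fde \<mu> r f) = fde \<mu> r (fJ q f)"
proof -
  have "fbe r (fJ q f) = fJ q (fbe r f) + lsum (\<lambda>i f. if i = - r then fbe (q + r) f else 0) f"
    unfolding fJ_def
    by (rule lsum_commutator(1)[OF lin_fnt locally_finite_fnt lin_modes(1)])
      (auto simp: fnt_def mode_commutators(3) mode_commutators(1)[of r] linD[OF lin_modes(1)] add.commute)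
  then show "fJ q (fbe r f) = fbe r (fJ q f) - fbe (q + r) f" by (simp add: lsum_delta)
  have "fga r (fJ q f) = fJ q (fga r f) + lsum (\<lambda>i f. if i = q + r then - fga (q + r) f else 0) f"
    unfolding fJ_def
    by (rule lsum_commutator(1)[OF lin_fnt locally_finite_fnt lin_modes(2)])
      (auto simp: fnt_def mode_commutators(3) mode_commutators(2)[of r] linD[OF lin_modes(2)])
  then show "fJ q (fga r f) = fga r (fJ q f) + fga (q + r) f" by (simp add: lsum_delta)
  show "fJ q (fC \<zeta> r f) = fC \<zeta> r (fJ q f)"
    unfolding fJ_def
    by (rule lsum_commute[OF lin_fnt locally_finite_fnt lin_modes(3), symmetric])
      (auto simp: fnt_def mode_commutators(4,5))
  show "fJ q (fde \<mu> r f) = fde \<mu> r (fJ q f)"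
    unfolding fJ_def
    by (rule lsum_commute[OF lin_fnt locally_finite_fnt lin_modes(4), symmetric])
      (auto simp: fnt_def mode_commutators(7,8))
qed

lemma fde_fC: "fde \<mu> p (fC \<zeta> q f) = fC \<zeta> q (fde \<mu> p f) + cst (if p + q = 0 then of_int p else 0) * f"
  using fC_fde[of \<zeta> q \<mu> p f] by (auto simp: add.commute[of q p] add_eq_0_iff cst_simps simp del: single_of_int)

lemma fD_commutators:
  "fD \<zeta> \<mu> q (fbe r f) = fbe r (fD \<zeta> \<mu> q f) + fbe (q + r) f"
  "fD \<zeta> \<mu> q (fga r f) = fga r (fD \<zeta> \<mu> q f) - fga (q + r) f"
  "fD \<zeta> \<mu> q (fC \<zeta> r f) = fC \<zeta> r (fD \<zeta> \<mu> q f) + cst (if q + r = 0 then of_int q else 0) * f"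
  "fD \<zeta> \<mu> q (fde \<mu> r f) = fde \<mu> r (fD \<zeta> \<mu> q f) + cst (if q + r = 0 then of_int q / 2 else 0) * f"
proof -
  note l = fD_def fJ_commutators linD[OF lin_modes(1)] linD[OF lin_modes(2)] linD[OF lin_modes(3)]
    linD[OF lin_modes(4)]
  show "fD \<zeta> \<mu> q (fbe r f) = fbe r (fD \<zeta> \<mu> q f) + fbe (q + r) f"
    by (simp add: l mode_commutators(4,7))
  show "fD \<zeta> \<mu> q (fga r f) = fga r (fD \<zeta> \<mu> q f) - fga (q + r) f"
    by (simp add: l mode_commutators(5,8))
  show "fD \<zeta> \<mu> q (fC \<zeta> r f) = fC \<zeta> r (fD \<zeta> \<mu> q f) + cst (if q + r = 0 then of_int q else 0) * f"
    by (simp add: l mode_commutators(6)[of \<zeta> q r] fde_fC del: single_of_int)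
  show "fD \<zeta> \<mu> q (fde \<mu> r f) = fde \<mu> r (fD \<zeta> \<mu> q f) + cst (if q + r = 0 then of_int q / 2 else 0) * f"
    by (simp add: l mode_commutators(9)[of \<mu> q r] fC_fde distrib_left mult.assoc[symmetric] mult_single del: single_of_int)
qed

text \<open>The term \<gamma> i C (q - i) yields - \<gamma> (p + i) C (q - i), which is reindexed by
  p. The central part of [D, C] adds p \<gamma> (p + q) and the derivative of \<gamma> adds q
  \<gamma> (p + q); together these are the derivative term of - B (p + q).\<close>

lemma fD_fB: "fD \<zeta> \<mu> p (fB \<zeta> q f) = fB \<zeta> q (fD \<zeta> \<mu> p f) - fB \<zeta> (p + q) f"
proof -
  define Y where "Y i f = (if i = p + q then cst (of_int p) * fga (p + q) f else 0) + - fgC \<zeta> (p + q) (i + p) f" for i f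
  have 1: "fD \<zeta> \<mu> p (lsum (fgC \<zeta> q) f) = lsum (fgC \<zeta> q) (fD \<zeta> \<mu> p f) + lsum Y f"
    by (rule lsum_commutator(1)[OF lin_fgC locally_finite_fgC lin_fD])
      (auto simp: fgC_def Y_def fD_commutators linD[OF lin_modes(2)] add.commute[of _ p] simp del: single_of_int)
  have lf: "locally_finite (\<lambda>i. fgC \<zeta> (p + q) (i + p))"
    unfolding locally_finite_def
  proof
    fix f
    show "finite {i. fgC \<zeta> (p + q) (i + p) f \<noteq> 0}"
      using finite_vimageI[of "{i. fgC \<zeta> (p + q) i f \<noteq> 0}" "\<lambda>i. i + p"] locally_finite_fgC[of \<zeta> "p + q"]
      by (simp add: locally_finite_def vimage_def inj_def)
  qed
  have 2: "lsum Y f = cst (of_int p) * fga (p + q) f - lsum (fgC \<zeta> (p + q)) f"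
    unfolding Y_def[abs_def]
    using lsum_add[OF locally_finite_delta locally_finite_minus[OF lf], of "p + q" "\<lambda>f. cst (of_int p) * fga (p + q) f" f]
    by (simp add: lsum_delta lsum_minus[OF lf] lsum_reindex[of "fgC \<zeta> (p + q)" p f])
  show ?thesis
    by (simp add: fB_def linD[OF lin_fD] 1 2 fD_commutators(2) cst_simps distrib_right right_diff_distrib del: single_of_int)
qed

section \<open>Commutativity of the modes of \<open>fD\<close>\<close>

lemma var_eq_mode:
  "var (Gv k) * f = fga (- int k) f" "var (Av k) * f = fbe (- int k - 1) f"
  "var (Cv k) * f = fC \<zeta> (- int k - 1) f" "var (Dv k) * f = fde \<mu> (- int k - 1) f"
  by (simp_all add: mode_defs)

text \<open>For \<open>q < 0\<close> this is the part of \<open>fD\<close> of mode \<open>q\<close>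
  that consists of creators only. It is multiplication by a polynomial and agrees with
  \<open>fD\<close> on the vacuum.\<close>

definition fcr :: "complex \<Rightarrow> complex \<Rightarrow> int \<Rightarrow> fock \<Rightarrow> fock"
  where "fcr \<zeta> \<mu> q f = fde \<mu> q f + cst (1 / 2) * fC \<zeta> q f - (\<Sum>i\<in>{q<..0}. fga i (fbe (q - i) f))"

lemma fD_one:
  "q \<ge> 1 \<Longrightarrow> fD \<zeta> \<mu> q 1 = 0" "fD \<zeta> \<mu> 0 1 = cst (\<mu> + \<zeta> / 2)" "q < 0 \<Longrightarrow> fD \<zeta> \<mu> q 1 = fcr \<zeta> \<mu> q 1"
proof -
  have "fJ q 1 = (\<Sum>i\<in>{q<..0}. fga i (fbe (q - i) 1))" for q
  proof -
    have "{i. fnt q i 1 \<noteq> 0} \<subseteq> {q<..0}"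
      using mode_one(1,2) linD(3)[OF lin_modes(1)] linD(3)[OF lin_modes(2)]
      by (fastforce simp: fnt_def split: if_splits intro: ccontr)
    then have "fJ q 1 = (\<Sum>i\<in>{q<..0}. fnt q i 1)" unfolding fJ_def by (intro lsum_eq_sum) auto
    then show ?thesis by (simp add: fnt_def)
  qed
  then show "q \<ge> 1 \<Longrightarrow> fD \<zeta> \<mu> q 1 = 0" "fD \<zeta> \<mu> 0 1 = cst (\<mu> + \<zeta> / 2)" "q < 0 \<Longrightarrow> fD \<zeta> \<mu> q 1 = fcr \<zeta> \<mu> q 1"
    by (simp_all add: fD_def mode_one fcr_def) (simp add: fde_def fC_def mult_single single_add)
qed

lemma lin_sum: "lin X \<Longrightarrow> X (sum g S) = (\<Sum>i\<in>S. X (g i))"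
  by (induction S rule: infinite_finite_induct) (simp_all add: linD)

lemma fD_fcr:
  "fD \<zeta> \<mu> p (fcr \<zeta> \<mu> q f) = fcr \<zeta> \<mu> q (fD \<zeta> \<mu> p f) + cst (if p + q = 0 then of_int p else 0) * f
    + ((\<Sum>i\<in>{q<..0}. fga (p + i) (fbe (q - i) f)) - (\<Sum>i\<in>{q<..0}. fga i (fbe (p + q - i) f)))"
proof -
  have 1: "fD \<zeta> \<mu> p (fga i (fbe (q - i) f)) =
      fga i (fbe (q - i) (fD \<zeta> \<mu> p f)) + (fga i (fbe (p + q - i) f) - fga (p + i) (fbe (q - i) f))" for i
    by (simp add: fD_commutators linD[OF lin_modes(2)] algebra_simps)
  have 2: "cst (if p + q = 0 then of_int p / 2 else 0) * f + cst (1 / 2) * (cst (if p + q = 0 then of_int p else 0) * f) =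
      cst (if p + q = 0 then of_int p else 0) * f"
    by (simp add: mult.assoc[symmetric] mult_single distrib_right[symmetric] single_add[symmetric] del: single_of_int)
  show ?thesis
    unfolding fcr_def
    using 2 by (simp add: linD[OF lin_fD] lin_sum[OF lin_fD] fD_commutators(3,4) 1 sum.distrib sum_subtractf
        distrib_left del: single_of_int)
qed

text \<open>The terms of the sums for [D p, D q] on the vacuum, sorted by total mode
  \<open>s\<close> and mode \<open>r\<close> of \<gamma>. For s < r \<le> 0 this is a product of
  creators; outside that range it is 0, apart from the contraction - 1 at s = 0, r \<ge> 1.\<close>

definition fe :: "int \<Rightarrow> int \<Rightarrow> fock"
  where "fe s r = fga r (fbe (s - r) 1)"

lemma fe_eq_0: "r \<le> s \<Longrightarrow> fe s r = 0"
  by (simp add: fe_def mode_one linD[OF lin_modes(2)])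

lemma fe_pos: "r \<ge> 1 \<Longrightarrow> fe s r = (if s = 0 then - 1 else 0)"
  using mode_commutators(3)[of "s - r" r 1] by (auto simp: fe_def mode_one linD[OF lin_modes(1)] eq_neg_iff_add_eq_0)

lemma fD_fcr_one:
  "fD \<zeta> \<mu> p (fcr \<zeta> \<mu> q 1) = fcr \<zeta> \<mu> q (fD \<zeta> \<mu> p 1) + cst (if p + q = 0 then of_int p else 0)
    + (sum (fe (p + q)) {p + q<..p} - sum (fe (p + q)) {q<..0})"
proof -
  have "(\<Sum>i\<in>{q<..0}. fga (p + i) (fbe (q - i) 1)) = (\<Sum>i\<in>{q<..0}. fe (p + q) (p + i))"
    by (intro sum.cong) (auto simp: fe_def)
  also have "\<dots> = sum (fe (p + q)) {p + q<..p}"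
    by (rule sum.reindex_bij_witness[of _ "\<lambda>r. r - p" "\<lambda>i. p + i"]) auto
  finally show ?thesis by (simp add: fD_fcr fe_def del: single_of_int)
qed

text \<open>At p + q = 0 the central term p coming from \<delta> + C / 2 meets p contractions - 1
  coming from :\<gamma> \<beta>:. For p + q < 0 both sums have the same nonzero terms, and for p + q
  > 0 they have none.\<close>

lemma sum_fe_cancel:
  assumes "p \<ge> 0" "q < 0"
  shows "cst (if p + q = 0 then of_int p else 0) + (sum (fe (p + q)) {p + q<..p} - sum (fe (p + q)) {q<..0}) = 0"
proof -
  define s where "s = p + q"
  consider "s < 0" | "s = 0" | "s > 0" by linarith
  then show ?thesis unfolding s_def[symmetric]
  proof cases
    case 1
    have "sum (fe s) {s<..p} = sum (fe s) {s<..0}"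
      by (rule sum.mono_neutral_right) (use assms 1 in \<open>auto simp: fe_pos\<close>)
    moreover have "sum (fe s) {q<..0} = sum (fe s) {s<..0}"
      by (rule sum.mono_neutral_right) (use assms 1 in \<open>auto simp: fe_eq_0 s_def\<close>)
    ultimately show "cst (if s = 0 then of_int p else 0) + (sum (fe s) {s<..p} - sum (fe s) {q<..0}) = 0"
      using 1 by simp
  next
    case 2
    have "sum (fe s) {s<..p} = (\<Sum>i\<in>{0<..p}. - 1)" by (rule sum.cong) (use 2 in \<open>auto simp: fe_pos\<close>)
    moreover have "sum (fe s) {q<..0} = 0" by (rule sum.neutral) (use 2 in \<open>auto simp: fe_eq_0\<close>)
    ultimately show "cst (if s = 0 then of_int p else 0) + (sum (fe s) {s<..p} - sum (fe s) {q<..0}) = 0"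
      using 2 assms by simp
  next
    case 3
    have "sum (fe s) {s<..p} = 0" by (rule sum.neutral) (use 3 in \<open>auto simp: fe_pos\<close>)
    moreover have "sum (fe s) {q<..0} = 0" by (rule sum.neutral) (use 3 in \<open>auto simp: fe_eq_0\<close>)
    ultimately show "cst (if s = 0 then of_int p else 0) + (sum (fe s) {s<..p} - sum (fe s) {q<..0}) = 0"
      using 3 by simp
  qed
qed

lemma fcr_cst: "fcr \<zeta> \<mu> q (cst s * f) = cst s * fcr \<zeta> \<mu> q f"
  by (simp add: fcr_def linD[OF lin_modes(1)] linD[OF lin_modes(2)] linD[OF lin_modes(3)] linD[OF lin_modes(4)]
      sum_distrib_left distrib_left right_diff_distrib mult.left_commute)

lemma fD_one_cst: "p \<ge> 0 \<Longrightarrow> fD \<zeta> \<mu> p 1 = cst (if p = 0 then \<mu> + \<zeta> / 2 else 0) * 1"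
  by (simp add: fD_one)

lemma fD_fD_one_mixed: "p \<ge> 0 \<Longrightarrow> q < 0 \<Longrightarrow> fD \<zeta> \<mu> p (fD \<zeta> \<mu> q 1) = fD \<zeta> \<mu> q (fD \<zeta> \<mu> p 1)"
  using sum_fe_cancel[of p q] unfolding fD_one_cst linD(2)[OF lin_fD] fD_one(3) fD_fcr_one fcr_cst
  by (simp add: add.assoc del: single_of_int)

lemma fcr_eq_mult: "q < 0 \<Longrightarrow> fcr \<zeta> \<mu> q f = fcr \<zeta> \<mu> q 1 * f"
proof -
  assume q: "q < 0"
  have "fga i (fbe (q - i) f) = fga i (fbe (q - i) 1) * f" if "i \<in> {q<..0}" for i
    using that by (simp add: fga_def fbe_def)
  then have "(\<Sum>i\<in>{q<..0}. fga i (fbe (q - i) f)) = (\<Sum>i\<in>{q<..0}. fga i (fbe (q - i) 1)) * f"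
    by (simp add: sum_distrib_right)
  then show ?thesis using q by (simp add: fcr_def algebra_simps) (simp add: fde_def fC_def algebra_simps)
qed

text \<open>Two nonnegative modes act on the vacuum by scalars. Two negative ones act through
  commuting multiplications, and the remaining sums become symmetric when the interval from p + q to
  0 is split at p or at q. The mixed case is the cancellation of
  \<open>sum_fe_cancel\<close>.\<close>

lemma fD_fD_one: "fD \<zeta> \<mu> p (fD \<zeta> \<mu> q 1) = fD \<zeta> \<mu> q (fD \<zeta> \<mu> p 1)"
proof -
  consider "p \<ge> 0" "q \<ge> 0" | "p \<ge> 0" "q < 0" | "p < 0" "q \<ge> 0" | "p < 0" "q < 0" by linarith
  then show ?thesis
  proof cases
    case 1
    then show ?thesis by (simp only: fD_one_cst linD[OF lin_fD]) (simp add: mult.commute)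
  next
    case 4
    have split: "sum g {p + q<..r} + sum g {r<..0} = sum g {p + q<..0}" if "p + q \<le> r" "r \<le> 0" for r and g :: "int \<Rightarrow> fock"
      using that by (subst sum.union_disjoint[symmetric]) (auto intro: arg_cong[where f = "sum g"])
    have "sum (fe (p + q)) {p + q<..p} - sum (fe (p + q)) {q<..0} =
        sum (fe (p + q)) {p + q<..q} - sum (fe (p + q)) {p<..0}"
      using split[of p "fe (p + q)"] split[of q "fe (p + q)"] 4 by (simp add: algebra_simps)
    moreover have "fcr \<zeta> \<mu> q (fcr \<zeta> \<mu> p 1) = fcr \<zeta> \<mu> p (fcr \<zeta> \<mu> q 1)"
      using fcr_eq_mult[of q \<zeta> \<mu> "fcr \<zeta> \<mu> p 1"] fcr_eq_mult[of p \<zeta> \<mu> "fcr \<zeta> \<mu> q 1"] 4 by (simp add: mult.commute)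
    ultimately show ?thesis using 4 by (simp add: fD_one fD_fcr_one add.commute[of q p] del: single_of_int)
  next
    case 2
    then show ?thesis by (rule fD_fD_one_mixed)
  next
    case 3
    then show ?thesis by (intro fD_fD_one_mixed[symmetric])
  qed
qed

text \<open>Commuted past a mode of \<beta>, \<gamma>, C or \<delta>, the two orders of
  \<open>fD\<close> leave the same extra terms. So their commutator commutes with all variables and
  is determined by its value on the vacuum.\<close>

lemma fD_fD: "fD \<zeta> \<mu> p (fD \<zeta> \<mu> q f) = fD \<zeta> \<mu> q (fD \<zeta> \<mu> p f)"
proof -
  define T where "T f = fD \<zeta> \<mu> p (fD \<zeta> \<mu> q f) - fD \<zeta> \<mu> q (fD \<zeta> \<mu> p f)" for f
  have "T f = 0"
  proof (rule lin_scalar_unique[of T])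
    show "lin T" unfolding T_def[abs_def] by (rule lin_minus(2)[OF lin_comp[OF lin_fD lin_fD] lin_comp[OF lin_fD lin_fD]])
    note c = fD_commutators linD(1,2,5)[OF lin_fD]
    have pqr: "p + (q + r) = q + (p + r)" for r by simp
    have g: "T (fga r f) = fga r (T f)" for r f
      unfolding T_def c linD(5)[OF lin_modes(2)] pqr[of r] by simp
    have b: "T (fbe r f) = fbe r (T f)" for r f
      unfolding T_def c linD(5)[OF lin_modes(1)] pqr[of r] by simp
    have C: "T (fC \<zeta> r f) = fC \<zeta> r (T f)" for r f
      unfolding T_def c linD(5)[OF lin_modes(3)] by (simp del: single_of_int)
    have d: "T (fde \<mu> r f) = fde \<mu> r (T f)" for r f
      unfolding T_def c linD(5)[OF lin_modes(4)] by (simp del: single_of_int)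
    show "T (var x * f) = var x * T f" for x f
      using g b C d by (cases x) (auto simp: var_eq_mode(1,2) var_eq_mode(3)[of _ _ \<zeta>] var_eq_mode(4)[of _ _ \<mu>])
    show "T 1 = 0" unfolding T_def using fD_fD_one[of \<zeta> \<mu> p q] by (rule right_minus_eq[THEN iffD2])
  qed
  then show ?thesis by (simp add: T_def)
qed

lemma fC_fD: "fC \<zeta> p (fD \<zeta> \<mu> q f) = fD \<zeta> \<mu> q (fC \<zeta> p f) + cst (if p + q = 0 then of_int p else 0) * f"
  unfolding fD_commutators(3)
  by (auto simp: add.commute[of q p] add_eq_0_iff cst_simps simp del: single_of_int)

section \<open>The singular vector on the Fock vacuum\<close>

lemma fB_one: "fB \<zeta> (- int p) 1 = cst (of_nat p + \<zeta>) * var (Gv p) + (\<Sum>i<p. var (Gv i) * var (Cv (p - i - 1)))"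
proof -
  have "{i. fgC \<zeta> (- int p) i 1 \<noteq> 0} \<subseteq> (\<lambda>j. - int j) ` {..p}"
  proof
    fix i assume "i \<in> {i. fgC \<zeta> (- int p) i 1 \<noteq> 0}"
    then have nz: "fgC \<zeta> (- int p) i 1 \<noteq> 0" by simp
    have "i \<le> 0"
      using nz mode_commutators(5)[of \<zeta> "- int p - i" i 1] linD(3)[OF lin_modes(3)] mode_one(2)[of i]
      by (auto simp: fgC_def not_le intro: ccontr)
    moreover have "- int p \<le> i"
      using nz linD(3)[OF lin_modes(2)] mode_one(3)[of "- int p - i" \<zeta>] by (fastforce simp: fgC_def)
    ultimately show "i \<in> (\<lambda>j. - int j) ` {..p}" by (intro image_eqI[of _ _ "nat (- i)"]) auto
  qed
  then have "lsum (fgC \<zeta> (- int p)) 1 = (\<Sum>i\<in>(\<lambda>j. - int j) ` {..p}. fgC \<zeta> (- int p) i 1)"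
    by (intro lsum_eq_sum) auto
  also have "\<dots> = (\<Sum>j\<le>p. fgC \<zeta> (- int p) (- int j) 1)"
    by (subst sum.reindex) (auto simp: inj_on_def)
  also have "\<dots> = cst \<zeta> * var (Gv p) + (\<Sum>j<p. fgC \<zeta> (- int p) (- int j) 1)"
    by (subst lessThan_Suc_atMost[symmetric]) (simp add: fgC_def fga_def fC_def)
  also have "(\<Sum>j<p. fgC \<zeta> (- int p) (- int j) 1) = (\<Sum>i<p. var (Gv i) * var (Cv (p - i - 1)))"
  proof (rule sum.cong)
    fix j assume j: "j \<in> {..<p}"
    then have "nat (int p - int j - 1) = p - j - 1" by auto
    then show "fgC \<zeta> (- int p) (- int j) 1 = var (Gv j) * var (Cv (p - j - 1))"
      using j by (simp add: fgC_def fga_def fC_def)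
  qed simp
  finally show ?thesis
    by (simp add: fB_def fga_def cst_simps distrib_right del: single_of_int single_of_nat)
qed

lemma fB_one_pos: "q \<ge> 1 \<Longrightarrow> fB \<zeta> q 1 = 0"
proof -
  assume q: "q \<ge> 1"
  have "fgC \<zeta> q i 1 = 0" for i
  proof (cases "i \<ge> 1")
    case True
    then show ?thesis using mode_commutators(5)[of \<zeta> "q - i" i 1] linD(3)[OF lin_modes(3)] mode_one(2)[of i]
      by (simp add: fgC_def)
  qed (use q linD(3)[OF lin_modes(2)] mode_one(3)[of "q - i" \<zeta>] in \<open>simp add: fgC_def\<close>)
  then show ?thesis using q by (simp add: fB_def lsum_def mode_one)
qed

text \<open>\<open>\<beta> \<rho> p\<close> is the coefficient of \<open>C (- \<rho>) B (- p)\<close>; unlike in \<^const>\<open>pair_partitions\<close>, \<open>p = 0\<close> is allowed.\<close>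

definition index_pairs :: "nat \<Rightarrow> (nat multiset \<times> nat) set"
  where "index_pairs n = {(\<rho>, p). 0 \<notin># \<rho> \<and> sum_mset \<rho> + p = n}"

text \<open>The left side is the coefficient of \<open>Cmon \<rho> * var (Gv p)\<close> in the
  singular vector on the Fock space: p - n is the linear coefficient of B (- p) on the vacuum when C
  0 = - n, and the sum collects the terms \<gamma> C, whose C adds a part to the multiset.\<close>

definition recursion :: "nat \<Rightarrow> (nat multiset \<Rightarrow> nat \<Rightarrow> complex) \<Rightarrow> bool"
  where "recursion n \<beta> \<longleftrightarrow> (\<forall>(\<rho>, p)\<in>index_pairs n.
    \<beta> \<rho> p * (of_nat p - of_nat n) + (\<Sum>x\<in>set_mset \<rho>. \<beta> (\<rho> - {#x#}) (p + x)) = 0)"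

lemma finite_index_pairs: "finite (index_pairs n)"
proof -
  have "size \<rho> \<le> sum_mset \<rho>" if "0 \<notin># \<rho>" for \<rho> :: "nat multiset"
    using that by (induction \<rho>) auto
  then have sz: "size \<rho> \<le> n" if "(\<rho>, p) \<in> index_pairs n" for \<rho> p
    using that by (fastforce simp: index_pairs_def)
  have mem: "x \<le> n" if "(\<rho>, p) \<in> index_pairs n" "x \<in># \<rho>" for \<rho> p x
  proof -
    have "x \<le> sum_mset \<rho>" using that(2) by (induction \<rho>) auto
    then show ?thesis using that(1) by (auto simp: index_pairs_def)
  qed
  have "index_pairs n \<subseteq> mset ` {xs. set xs \<subseteq> {..n} \<and> length xs \<le> n} \<times> {..n}"
  proof
    fix z assume "z \<in> index_pairs n"
    then obtain \<rho> p where z: "z = (\<rho>, p)" "(\<rho>, p) \<in> index_pairs n" by (cases z) auto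
    obtain xs where xs: "mset xs = \<rho>" using ex_mset by blast
    then have "set xs \<subseteq> {..n}" "length xs \<le> n" using mem[OF z(2)] sz[OF z(2)] by auto
    moreover have "p \<le> n" using z by (auto simp: index_pairs_def)
    ultimately show "z \<in> mset ` {xs. set xs \<subseteq> {..n} \<and> length xs \<le> n} \<times> {..n}" using z xs by auto
  qed
  then show ?thesis by (rule finite_subset) (auto intro!: finite_lists_length_le)
qed

definition Cmon :: "nat multiset \<Rightarrow> fock"
  where "Cmon \<rho> = (\<Prod>k\<in>#\<rho>. var (Cv (k - 1)))"

text \<open>Moving the part p - i out of the mode of \<open>B\<close> into \<rho> is a bijection
  onto the multisets with one marked distinct part; this is why the sum over parts carries no
  multiplicities.\<close>

lemma sum_index_pairs_merge:
  fixes g :: "nat multiset \<Rightarrow> nat \<Rightarrow> nat \<Rightarrow> 'a::comm_monoid_add"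
  shows "(\<Sum>(\<rho>, p)\<in>index_pairs n. \<Sum>i<p. g \<rho> i (p - i)) =
    (\<Sum>(\<rho>, i)\<in>index_pairs n. \<Sum>x\<in>set_mset \<rho>. g (\<rho> - {#x#}) i x)"
proof -
  have "(\<Sum>(\<rho>, p)\<in>index_pairs n. \<Sum>i<p. g \<rho> i (p - i)) =
      (\<Sum>((\<rho>, p), i)\<in>Sigma (index_pairs n) (\<lambda>(\<rho>, p). {..<p}). g \<rho> i (p - i))"
    by (subst sum.Sigma[symmetric]) (auto simp: finite_index_pairs split_def)
  also have "\<dots> = (\<Sum>((\<rho>, i), x)\<in>Sigma (index_pairs n) (\<lambda>(\<rho>, p). set_mset \<rho>). g (\<rho> - {#x#}) i x)"
    by (rule sum.reindex_bij_witness[of _ "\<lambda>((\<rho>, i), x). ((\<rho> - {#x#}, i + x), i)"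
          "\<lambda>((\<rho>, p), i). ((add_mset (p - i) \<rho>, i), p - i)"])
      (auto simp: index_pairs_def sum_mset.remove dest: in_diffD intro: gr0I)
  also have "\<dots> = (\<Sum>(\<rho>, i)\<in>index_pairs n. \<Sum>x\<in>set_mset \<rho>. g (\<rho> - {#x#}) i x)"
    by (subst sum.Sigma[symmetric]) (auto simp: finite_index_pairs split_def)
  finally show ?thesis .
qed

lemma singular_vector_vanishes:
  assumes "recursion n \<beta>"
  shows "(\<Sum>(\<rho>, p)\<in>index_pairs n. cst (\<beta> \<rho> p) * (Cmon \<rho> * fB (- of_nat n) (- int p) 1)) = 0"
proof -
  have "(\<Sum>(\<rho>, p)\<in>index_pairs n. cst (\<beta> \<rho> p) * (Cmon \<rho> * fB (- of_nat n) (- int p) 1)) =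
      (\<Sum>(\<rho>, p)\<in>index_pairs n. cst (\<beta> \<rho> p * (of_nat p - of_nat n)) * (Cmon \<rho> * var (Gv p))) +
      (\<Sum>(\<rho>, p)\<in>index_pairs n. \<Sum>i<p. cst (\<beta> \<rho> (i + (p - i))) * (Cmon (add_mset (p - i) \<rho>) * var (Gv i)))"
    unfolding sum.distrib[symmetric]
    by (intro sum.cong refl)
      (auto simp: fB_one cst_simps(2) distrib_left sum_distrib_left Cmon_def ac_simps simp del: single_of_nat)
  also have "(\<Sum>(\<rho>, p)\<in>index_pairs n. \<Sum>i<p. cst (\<beta> \<rho> (i + (p - i))) * (Cmon (add_mset (p - i) \<rho>) * var (Gv i))) =
      (\<Sum>(\<rho>, i)\<in>index_pairs n. \<Sum>x\<in>set_mset \<rho>.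
        cst (\<beta> (\<rho> - {#x#}) (i + x)) * (Cmon (add_mset x (\<rho> - {#x#})) * var (Gv i)))"
    by (rule sum_index_pairs_merge)
  also have "\<dots> = (\<Sum>(\<rho>, i)\<in>index_pairs n. cst (\<Sum>x\<in>set_mset \<rho>. \<beta> (\<rho> - {#x#}) (i + x)) * (Cmon \<rho> * var (Gv i)))"
  proof -
    have "(\<Sum>x\<in>S. cst (h x)) = cst (sum h S)" for h :: "nat \<Rightarrow> complex" and S
      by (induction S rule: infinite_finite_induct) (simp_all add: cst_simps)
    then show ?thesis by (intro sum.cong refl) (auto simp: sum_distrib_right[symmetric])
  qed
  also have "(\<Sum>(\<rho>, p)\<in>index_pairs n. cst (\<beta> \<rho> p * (of_nat p - of_nat n)) * (Cmon \<rho> * var (Gv p))) +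
      (\<Sum>(\<rho>, i)\<in>index_pairs n. cst (\<Sum>x\<in>set_mset \<rho>. \<beta> (\<rho> - {#x#}) (i + x)) * (Cmon \<rho> * var (Gv i))) = 0"
    unfolding sum.distrib[symmetric] using assms
    by (intro sum.neutral) (auto simp: recursion_def distrib_right[symmetric] cst_simps(1)[symmetric])
  finally show ?thesis .
qed

section \<open>Coefficients of the singular vectors\<close>

text \<open>All coefficients are determined by the one at \<open>({#}, n)\<close>, by induction on
  the number of parts: the factor p - n vanishes only for empty \<rho>.\<close>

lemma recursion_nonzero:
  assumes rec: "recursion n \<beta>" and nz: "(\<rho>, p) \<in> index_pairs n" "\<beta> \<rho> p \<noteq> 0"
  shows "\<beta> {#} n \<noteq> 0"
proof
  assume zero: "\<beta> {#} n = 0"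
  have "\<beta> \<rho> p = 0" if "(\<rho>, p) \<in> index_pairs n" for \<rho> p
    using that
  proof (induction "size \<rho>" arbitrary: \<rho> p)
    case 0
    then show ?case using zero by (auto simp: index_pairs_def)
  next
    case (Suc k)
    have "\<beta> (\<rho> - {#x#}) (p + x) = 0" if x: "x \<in># \<rho>" for x
    proof (rule Suc.hyps(1))
      show "k = size (\<rho> - {#x#})" using Suc.hyps(2) x by (simp add: size_Diff_singleton)
      show "(\<rho> - {#x#}, p + x) \<in> index_pairs n"
        using Suc.prems x sum_mset.remove[of x \<rho>] by (auto simp: index_pairs_def dest: in_diffD)
    qed
    then have "\<beta> \<rho> p * (of_nat p - of_nat n) = 0"
      using rec Suc.prems unfolding recursion_def by fastforce
    moreover have "p \<noteq> n"
    proof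
      assume "p = n"
      then have "sum_mset \<rho> = 0" "0 \<notin># \<rho>" using Suc.prems by (auto simp: index_pairs_def)
      then have "\<rho> = {#}" by (cases \<rho>) auto
      then show False using Suc.hyps(2) by simp
    qed
    ultimately show ?case by simp
  qed
  then show False using nz by blast
qed

lemma finite_partitions: "finite (partitions n)"
proof -
  have "partitions n \<subseteq> fst ` index_pairs n"
  proof
    fix \<mu> assume "\<mu> \<in> partitions n"
    then have "(\<mu>, 0) \<in> index_pairs n" by (auto simp: partitions_def index_pairs_def)
    then show "\<mu> \<in> fst ` index_pairs n" by force
  qed
  then show ?thesis using finite_index_pairs finite_subset by blast
qed

text \<open>A partition with a marked distinct part is the same thing as a pair (\<rho>, p).\<close>

lemma sum_partitions_remove:
  fixes g :: "nat multiset \<Rightarrow> nat \<Rightarrow> 'a::comm_monoid_add"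
  shows "(\<Sum>\<mu>\<in>partitions n. \<Sum>x\<in>set_mset \<mu>. g (\<mu> - {#x#}) x) = (\<Sum>(\<rho>, p)\<in>pair_partitions n. g \<rho> p)"
proof -
  have "(\<Sum>\<mu>\<in>partitions n. \<Sum>x\<in>set_mset \<mu>. g (\<mu> - {#x#}) x) =
      (\<Sum>(\<mu>, x)\<in>Sigma (partitions n) set_mset. g (\<mu> - {#x#}) x)"
    by (subst sum.Sigma) (auto simp: finite_partitions)
  also have "\<dots> = (\<Sum>(\<rho>, p)\<in>pair_partitions n. g \<rho> p)"
    by (rule sum.reindex_bij_witness[of _ "\<lambda>(\<rho>, p). (add_mset p \<rho>, p)" "\<lambda>(\<mu>, x). (\<mu> - {#x#}, x)"])
      (auto simp: partitions_def pair_partitions_def sum_mset.remove Suc_le_eq dest: in_diffD intro!: gr0I)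
  finally show ?thesis .
qed

text \<open>The coefficients \<open>a\<close> become the case p = 0 of the coefficients
  \<open>b\<close>, so that one index set serves both.\<close>

lemma vec1_eq:
  "vec1 m n a b = (\<Sum>(\<rho>, p)\<in>index_pairs n.
    scal (if p = 0 then a \<rho> else b \<rho> p) * c_part \<rho> * gen (nw_elt hB (- int p + m)))"
proof -
  let ?g = "\<lambda>\<rho> p. scal (if p = 0 then a \<rho> else b \<rho> p) * c_part \<rho> * gen (nw_elt hB (- int p + m))"
  have split: "index_pairs n = (\<lambda>\<mu>. (\<mu>, 0)) ` partitions n \<union> pair_partitions n"
    by (auto simp: index_pairs_def partitions_def pair_partitions_def Suc_le_eq)
  have fin: "finite (pair_partitions n)" using finite_index_pairs[of n] unfolding split by (rule finite_subset[rotated]) (rule Un_upper2)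
  have "(\<Sum>(\<rho>, p)\<in>index_pairs n. ?g \<rho> p) =
      (\<Sum>(\<rho>, p)\<in>(\<lambda>\<mu>. (\<mu>, 0)) ` partitions n. ?g \<rho> p) + (\<Sum>(\<rho>, p)\<in>pair_partitions n. ?g \<rho> p)"
    unfolding split using fin by (intro sum.union_disjoint) (auto simp: finite_partitions, auto simp: pair_partitions_def)
  also have "(\<Sum>(\<rho>, p)\<in>(\<lambda>\<mu>. (\<mu>, 0)) ` partitions n. ?g \<rho> p) = (\<Sum>\<mu>\<in>partitions n. ?g \<mu> 0)"
    by (subst sum.reindex) (auto simp: inj_on_def)
  also have "(\<Sum>(\<rho>, p)\<in>pair_partitions n. ?g \<rho> p) =
      (\<Sum>\<mu>\<in>partitions n. \<Sum>x\<in>set_mset \<mu>. ?g (\<mu> - {#x#}) x)"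
    by (rule sum_partitions_remove[symmetric])
  also have "(\<Sum>\<mu>\<in>partitions n. ?g \<mu> 0) + \<dots> = vec1 m n a b"
    unfolding vec1_def sum.distrib[symmetric]
  proof (intro sum.cong refl arg_cong2[where f = "(+)"])
    fix \<mu> x assume "\<mu> \<in> partitions n" "x \<in> set_mset \<mu>"
    then have "x \<noteq> 0" unfolding partitions_def by (metis (mono_tags, lifting) mem_Collect_eq)
    then show "?g (\<mu> - {#x#}) x =
        scal (b (\<mu> - {#x#}) x) * c_part (\<mu> - {#x#}) * gen (nw_elt hB (- int x + m))" by simp
  qed simp
  finally show ?thesis ..
qed

lemma sum_pair_partitions_Suc:
  "(\<Sum>(\<rho>, p)\<in>pair_partitions (Suc n). g \<rho> p) = (\<Sum>(\<rho>, p)\<in>index_pairs n. g \<rho> (Suc p))"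
  by (rule sum.reindex_bij_witness[of _ "\<lambda>(\<rho>, p). (\<rho>, Suc p)" "\<lambda>(\<rho>, p). (\<rho>, p - 1)"])
    (auto simp: pair_partitions_def index_pairs_def)

text \<open>The creators a have modes - x - m with x \<ge> 1, whereas the \<open>B (- p)\<close>
  they turn into start at p = 0. Hence p = x - 1, and the degree drops from \<open>Suc n\<close> to
  \<open>n\<close>.\<close>

lemma vec2_eq:
  "vec2 m (Suc n) c = (\<Sum>(\<rho>, p)\<in>index_pairs n.
    scal (c \<rho> (Suc p)) * c_part \<rho> * gen (nw_elt hA (- int (Suc p) - m)))"
  unfolding vec2_def
  using sum_partitions_remove[of "\<lambda>\<rho> p. scal (c \<rho> p) * c_part \<rho> * gen (nw_elt hA (- int p - m))" "Suc n"]
    sum_pair_partitions_Suc[of "\<lambda>\<rho> p. scal (c \<rho> p) * c_part \<rho> * gen (nw_elt hA (- int p - m))" n]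
  by simp

text \<open>The default 0 of \<open>merge_coeff\<close> drops y = x precisely when \<open>x\<close>
  is not a part of \<rho>, so the distinct parts of \<rho> remain.\<close>

lemma sum_merge_coeff:
  "(\<Sum>y\<in>set_mset (add_mset x \<rho>). merge_coeff b (add_mset x \<rho>) x y) = (\<Sum>y\<in>set_mset \<rho>. b (\<rho> - {#y#}) (x + y))"
  unfolding merge_coeff_def
  by (rule sum.mono_neutral_cong_right) auto

lemma sum_count_eq_sum_mset: "(\<Sum>x\<in>set_mset \<mu>. of_nat (count \<mu> x) * of_nat x :: complex) = of_nat (sum_mset \<mu>)"
proof -
  have "(\<Sum>x\<in>A. count \<mu> x * x) = sum_mset \<mu>" if "finite A" "set_mset \<mu> \<subseteq> A" for A
    using that(2)
  proof (induction \<mu>)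
    case (add x \<mu>)
    have "(\<Sum>y\<in>A. count (add_mset x \<mu>) y * y) = (\<Sum>y\<in>A. (if y = x then x else 0) + count \<mu> y * y)"
      by (intro sum.cong) auto
    then show ?case using add that(1) by (simp add: sum.distrib)
  qed simp
  from this[of "set_mset \<mu>"] show ?thesis by (simp flip: of_nat_mult of_nat_sum)
qed

text \<open>For p \<ge> 1 the recursion is the second relation at the partition
  \<open>add_mset p \<rho>\<close>. For p = 0 it is the first relation summed over the distinct
  parts, as parts times multiplicities add up to n.\<close>

lemma coeffs1_recursion:
  assumes "coeffs1 n a b" and n: "n \<ge> 1"
  defines "\<beta> \<equiv> \<lambda>\<rho> p. if p = 0 then a \<rho> else b \<rho> p"
  shows "recursion n \<beta>" "\<beta> {#} n \<noteq> 0"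
proof -
  have eq1: "a \<mu> * of_nat (count \<mu> x) * of_nat x = b (\<mu> - {#x#}) x"
    and eq2: "b (\<mu> - {#x#}) x * (- of_nat n + of_nat x) + (\<Sum>y\<in>set_mset \<mu>. merge_coeff b \<mu> x y) = 0"
    if "\<mu> \<in> partitions n" "x \<in># \<mu>" for \<mu> x
    using assms(1) that by (auto simp: coeffs1_def)
  show rec: "recursion n \<beta>"
    unfolding recursion_def
  proof safe
    fix \<rho> p assume \<rho>: "(\<rho>, p) \<in> index_pairs n"
    show "\<beta> \<rho> p * (of_nat p - of_nat n) + (\<Sum>x\<in>set_mset \<rho>. \<beta> (\<rho> - {#x#}) (p + x)) = 0"
    proof (cases "p = 0")
      case True
      then have mu: "\<rho> \<in> partitions n" using \<rho> by (auto simp: index_pairs_def partitions_def)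
      then have pos: "x \<in># \<rho> \<Longrightarrow> x \<noteq> 0" for x by (metis (mono_tags, lifting) mem_Collect_eq partitions_def)
      have "(\<Sum>x\<in>set_mset \<rho>. \<beta> (\<rho> - {#x#}) (p + x)) = (\<Sum>x\<in>set_mset \<rho>. a \<rho> * (of_nat (count \<rho> x) * of_nat x))"
        using eq1[OF mu] pos True by (intro sum.cong refl) (fastforce simp: \<beta>_def mult.assoc)
      also have "\<dots> = a \<rho> * of_nat n"
        unfolding sum_distrib_left[symmetric] sum_count_eq_sum_mset using mu by (simp add: partitions_def)
      finally show ?thesis using True by (simp add: \<beta>_def)
    next
      case False
      then have mu: "add_mset p \<rho> \<in> partitions n" using \<rho> by (auto simp: index_pairs_def partitions_def)
      have "p \<in># add_mset p \<rho>" by simp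
      then show ?thesis using eq2[OF mu, of p] False by (simp add: sum_merge_coeff \<beta>_def algebra_simps del: set_mset_add_mset_insert)
    qed
  qed
  have "\<exists>\<rho> p. (\<rho>, p) \<in> index_pairs n \<and> \<beta> \<rho> p \<noteq> 0"
  proof -
    consider \<mu> where "\<mu> \<in> partitions n" "a \<mu> \<noteq> 0" | \<rho> p where "(\<rho>, p) \<in> pair_partitions n" "b \<rho> p \<noteq> 0"
      using assms(1) by (auto simp: coeffs1_def)
    then show ?thesis
    proof cases
      case 1
      then show ?thesis by (intro exI[of _ \<mu>] exI[of _ 0]) (auto simp: \<beta>_def index_pairs_def partitions_def)
    next
      case 2
      then show ?thesis by (intro exI[of _ \<rho>] exI[of _ p]) (auto simp: \<beta>_def index_pairs_def pair_partitions_def)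
    qed
  qed
  then show "\<beta> {#} n \<noteq> 0" using recursion_nonzero[OF rec] by blast
qed

text \<open>The sign belongs to the automorphism that negates c: each factor of c(-\<rho>)
  contributes - 1.\<close>

lemma coeffs2_recursion:
  assumes "coeffs2 (Suc n) c"
  defines "\<beta> \<equiv> \<lambda>\<rho> p. (- 1) ^ size \<rho> * c \<rho> (Suc p)"
  shows "recursion n \<beta>" "\<beta> {#} n \<noteq> 0"
proof -
  have eq2: "c (\<mu> - {#x#}) x * (- of_nat (Suc n) + of_nat x) - (\<Sum>y\<in>set_mset \<mu>. merge_coeff c \<mu> x y) = 0"
    if "\<mu> \<in> partitions (Suc n)" "x \<in># \<mu>" for \<mu> x
    using assms(1) that unfolding coeffs2_def by blast
  show rec: "recursion n \<beta>"
    unfolding recursion_def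
  proof safe
    fix \<rho> p assume \<rho>: "(\<rho>, p) \<in> index_pairs n"
    then have mu: "add_mset (Suc p) \<rho> \<in> partitions (Suc n)" by (auto simp: index_pairs_def partitions_def)
    have "\<beta> (\<rho> - {#x#}) (p + x) = - ((- 1) ^ size \<rho> * c (\<rho> - {#x#}) (Suc p + x))" if x: "x \<in># \<rho>" for x
    proof -
      obtain \<rho>' where "\<rho> = add_mset x \<rho>'" using multi_member_split[OF x] by blast
      then show ?thesis by (simp add: \<beta>_def)
    qed
    then have s: "(\<Sum>x\<in>set_mset \<rho>. \<beta> (\<rho> - {#x#}) (p + x)) =
        - ((- 1) ^ size \<rho> * (\<Sum>y\<in>set_mset \<rho>. c (\<rho> - {#y#}) (Suc p + y)))"
      by (simp add: sum_distrib_left sum_negf)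
    have t: "(\<Sum>y\<in>set_mset \<rho>. c (\<rho> - {#y#}) (Suc p + y)) = c \<rho> (Suc p) * (- of_nat (Suc n) + of_nat (Suc p))"
      using eq2[OF mu, of "Suc p"] unfolding sum_merge_coeff by simp
    show "\<beta> \<rho> p * (of_nat p - of_nat n) + (\<Sum>x\<in>set_mset \<rho>. \<beta> (\<rho> - {#x#}) (p + x)) = 0"
      unfolding s t by (simp add: \<beta>_def algebra_simps)
  qed
  obtain \<rho> p where "(\<rho>, p) \<in> pair_partitions (Suc n)" "c \<rho> p \<noteq> 0"
    using assms(1) by (auto simp: coeffs2_def)
  then have "(\<rho>, p - 1) \<in> index_pairs n" "\<beta> \<rho> (p - 1) \<noteq> 0"
    by (auto simp: pair_partitions_def index_pairs_def \<beta>_def split: nat.splits)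
  then show "\<beta> {#} n \<noteq> 0" using recursion_nonzero[OF rec] by blast
qed

text \<open>\<open>1 / zee \<rho>\<close> is the coefficient of \<open>c(-\<rho>)\<close> in \<open>exp (\<Sum>k. c(-k) t\<^sup>k / k)\<close>.\<close>

definition zee :: "nat multiset \<Rightarrow> complex"
  where "zee \<rho> = (\<Prod>x\<in>set_mset \<rho>. of_nat x ^ count \<rho> x * fact (count \<rho> x))"

lemma zee_nonzero: "0 \<notin># \<rho> \<Longrightarrow> zee \<rho> \<noteq> 0"
  by (auto simp: zee_def) 

lemma zee_remove:
  assumes "x \<in># \<mu>"
  shows "zee \<mu> = of_nat (count \<mu> x) * of_nat x * zee (\<mu> - {#x#})"
proof -
  let ?f = "\<lambda>\<rho> y. of_nat y ^ count \<rho> y * fact (count \<rho> y) :: complex"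
  have "zee (\<mu> - {#x#}) = (\<Prod>y\<in>set_mset \<mu>. ?f (\<mu> - {#x#}) y)"
    unfolding zee_def by (rule prod.mono_neutral_left) (auto dest: in_diffD simp: not_in_iff)
  also have "\<dots> = ?f (\<mu> - {#x#}) x * (\<Prod>y\<in>set_mset \<mu> - {x}. ?f \<mu> y)"
    using assms by (subst prod.remove[of _ x]) (auto intro!: prod.cong)
  finally have 1: "zee (\<mu> - {#x#}) = ?f (\<mu> - {#x#}) x * (\<Prod>y\<in>set_mset \<mu> - {x}. ?f \<mu> y)" .
  have 2: "zee \<mu> = ?f \<mu> x * (\<Prod>y\<in>set_mset \<mu> - {x}. ?f \<mu> y)"
    unfolding zee_def using assms by (subst prod.remove[of _ x]) auto
  obtain k where "count \<mu> x = Suc k" using assms by (metis count_greater_zero_iff gr0_implies_Suc)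
  then show ?thesis unfolding 1 2 by simp
qed

lemma zee_inverse_remove: "x \<in># \<mu> \<Longrightarrow> 0 \<notin># \<mu> \<Longrightarrow> 1 / zee (\<mu> - {#x#}) = of_nat (count \<mu> x) * of_nat x * (1 / zee \<mu>)"
  using zee_remove[of x \<mu>] zee_nonzero[of \<mu>] by (auto simp: field_simps)

text \<open>Each summand is a part times its multiplicity over \<open>zee \<rho>\<close>. In terms
  of symmetric functions this is the Newton identity for the complete functions h, n h(n) = sum of
  p(k) h(n - k), read off at one product of power sums.\<close>

lemma sum_zee_inverse:
  assumes "0 \<notin># \<rho>"
  shows "(\<Sum>y\<in>set_mset \<rho>. 1 / zee (\<rho> - {#y#})) = of_nat (sum_mset \<rho>) * (1 / zee \<rho>)"
  unfolding sum_count_eq_sum_mset[symmetric] sum_distrib_right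
  by (rule sum.cong) (use zee_inverse_remove assms in auto)

lemma partition_cases:
  assumes "\<mu> \<in> partitions n" "x \<in># \<mu>"
  obtains \<rho> where "\<mu> = add_mset x \<rho>" "0 \<notin># \<rho>" "x \<noteq> 0" "n = x + sum_mset \<rho>" "\<mu> - {#x#} = \<rho>"
  using assms by (auto simp: partitions_def dest!: multi_member_split)

text \<open>With \<open>b\<close> depending on \<rho> alone, the first relation is the removal rule
  for \<open>zee\<close>, and the second is \<open>sum_zee_inverse\<close>, because n - x is the sum
  of the parts of \<rho>.\<close>

lemma coeffs1_exists: "\<exists>a b. coeffs1 n a b" if "n \<ge> 1"
proof (intro exI)
  show "coeffs1 n (\<lambda>\<mu>. 1 / zee \<mu>) (\<lambda>\<rho> p. 1 / zee \<rho>)"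
    unfolding coeffs1_def
  proof (intro conjI disjI2 ballI)
    show "\<exists>(\<rho>, p)\<in>pair_partitions n. 1 / zee \<rho> \<noteq> 0"
      using that by (intro bexI[of _ "({#}, n)"]) (auto simp: pair_partitions_def zee_def)
    fix \<mu> x assume mu: "\<mu> \<in> partitions n" "x \<in> set_mset \<mu>"
    then have 0: "0 \<notin># \<mu>" by (simp add: partitions_def)
    show "1 / zee \<mu> * of_nat (count \<mu> x) * of_nat x - 1 / zee (\<mu> - {#x#}) = 0"
      unfolding zee_inverse_remove[OF mu(2) 0] by simp
    obtain \<rho> where \<rho>: "\<mu> = add_mset x \<rho>" "0 \<notin># \<rho>" "n = x + sum_mset \<rho>" "\<mu> - {#x#} = \<rho>"
      using mu by (rule partition_cases)
    show "1 / zee (\<mu> - {#x#}) * (- of_nat n + of_nat x) + (\<Sum>y\<in>set_mset \<mu>. merge_coeff (\<lambda>\<rho> p. 1 / zee \<rho>) \<mu> x y) = 0"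
      unfolding \<rho>(4) unfolding \<rho>(1) sum_merge_coeff sum_zee_inverse[OF \<rho>(2)] \<rho>(3) by (simp add: algebra_simps)
  qed
qed

text \<open>The same solution, with one sign for each factor c(-k).\<close>

lemma coeffs2_exists: "\<exists>c. coeffs2 n c" if "n \<ge> 1"
proof
  let ?c = "\<lambda>\<rho> (p::nat). (- 1) ^ size \<rho> * (1 / zee \<rho>)"
  show "coeffs2 n ?c"
    unfolding coeffs2_def
  proof (intro conjI ballI impI)
    show "\<exists>(\<rho>, p)\<in>pair_partitions n. ?c \<rho> p \<noteq> 0"
      using that by (intro bexI[of _ "({#}, n)"]) (auto simp: pair_partitions_def zee_def)
    fix \<mu> x assume mu: "\<mu> \<in> partitions n" "x \<in> set_mset \<mu>"
    obtain \<rho> where \<rho>: "\<mu> = add_mset x \<rho>" "0 \<notin># \<rho>" "n = x + sum_mset \<rho>" "\<mu> - {#x#} = \<rho>"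
      using mu by (rule partition_cases)
    have sz: "(- 1) ^ size (\<rho> - {#y#}) * s = - ((- 1) ^ size \<rho> * s)" if "y \<in># \<rho>" for y and s :: complex and \<rho> :: "nat multiset"
      using that by (auto dest!: multi_member_split)
    have "(\<Sum>y\<in>set_mset \<rho>. ?c (\<rho> - {#y#}) (x + y)) = - ((- 1) ^ size \<rho> * (\<Sum>y\<in>set_mset \<rho>. 1 / zee (\<rho> - {#y#})))"
      unfolding sum_distrib_left sum_negf[symmetric] by (intro sum.cong refl sz) simp
    then show "?c (\<mu> - {#x#}) x * (- of_nat n + of_nat x) - (\<Sum>y\<in>set_mset \<mu>. merge_coeff ?c \<mu> x y) = 0"
      unfolding \<rho>(4) unfolding \<rho>(1) sum_merge_coeff sum_zee_inverse[OF \<rho>(2)] \<rho>(3) by (simp add: algebra_simps)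
    fix y assume y: "y \<in> set_mset \<mu>" "x \<noteq> y"
    then have y': "y \<in># \<rho>" using \<rho>(1) by auto
    have x': "x \<in># \<mu> - {#y#}" using \<rho>(1) y by auto
    have 0: "0 \<notin># \<mu> - {#y#}" using mu by (auto simp: partitions_def dest: in_diffD)
    have comm: "\<rho> - {#y#} = \<mu> - {#y#} - {#x#}" using \<rho>(4) by (metis diff_right_commute)
    have z: "1 / zee (\<rho> - {#y#}) = of_nat (count \<mu> x) * of_nat x * (1 / zee (\<mu> - {#y#}))"
      unfolding comm zee_inverse_remove[OF x' 0] using y by simp
    have s: "(- 1 :: complex) ^ size (\<mu> - {#y#}) * s = - ((- 1) ^ size (\<rho> - {#y#}) * s)" for s
      unfolding comm using sz[OF x', of s] by simp
    have "merge_coeff ?c \<mu> x y = (- 1) ^ size (\<rho> - {#y#}) * (1 / zee (\<rho> - {#y#}))"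
      using y' by (simp add: merge_coeff_def \<rho>(4))
    then show "of_nat (count \<mu> x) * of_nat x * ?c (\<mu> - {#y#}) y + merge_coeff ?c \<mu> x y = 0"
      unfolding s z by simp
  qed
qed

section \<open>Modules presented by a free algebra\<close>

locale presented_ring = ring R for R (structure) +
  fixes cls :: "'f::ring_1 \<Rightarrow> 'r"
  assumes carrier_cls: "carrier R = range cls"
    and add_cls: "cls f \<oplus> cls g = cls (f + g)"
    and mult_cls: "cls f \<otimes> cls g = cls (f * g)"
    and one_cls: "\<one> = cls 1"
begin

text \<open>\<open>M\<close> is written as the ring of representatives modulo the left ideal where
  \<open>\<Psi>\<close> vanishes, with generator \<open>\<Psi> 1\<close>. Statements about cosets of
  cosets thereby turn into statements about left ideals.\<close>

definition presents :: "('f \<Rightarrow> 'm) \<Rightarrow> ('r, 'm, 't) module_scheme \<Rightarrow> bool"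
  where "presents \<Psi> M \<longleftrightarrow> carrier M = range \<Psi> \<and> \<zero>\<^bsub>M\<^esub> = \<Psi> 0 \<and>
    (\<forall>f g. \<Psi> f \<oplus>\<^bsub>M\<^esub> \<Psi> g = \<Psi> (f + g)) \<and> (\<forall>f g. cls f \<odot>\<^bsub>M\<^esub> \<Psi> g = \<Psi> (f * g))"

lemma presents_left_module:
  assumes "presents \<Psi> M"
  shows "left_module R M"
proof -
  note p = assms[unfolded presents_def] carrier_cls
  have "abelian_group M"
  proof (rule abelian_groupI)
    fix x assume "x \<in> carrier M"
    then obtain f where "x = \<Psi> f" using p by auto
    then show "\<exists>y\<in>carrier M. y \<oplus>\<^bsub>M\<^esub> x = \<zero>\<^bsub>M\<^esub>" using p by (intro bexI[of _ "\<Psi> (- f)"]) auto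
  qed (use p in \<open>auto simp: algebra_simps\<close>)
  then show ?thesis
    by (intro left_module.intro left_module_axioms.intro ring_axioms)
      (use p in \<open>auto simp: add_cls mult_cls one_cls algebra_simps\<close>)
qed

text \<open>The preimage of a submodule under \<open>\<Psi>\<close> is a left ideal that contains
  the kernel, so maximality of the kernel is enough.\<close>

lemma presents_irreducible:
  assumes p: "presents \<Psi> M" and one: "\<Psi> 1 \<noteq> \<zero>\<^bsub>M\<^esub>"
    and max: "\<And>N. left_ideal N \<Longrightarrow> {f. \<Psi> f = \<zero>\<^bsub>M\<^esub>} \<subset> N \<Longrightarrow> 1 \<in> N"
  shows "irreducible_module R M"
  unfolding irreducible_module_def
proof (intro conjI allI impI)
  note p' = p[unfolded presents_def] carrier_cls
  show "left_module R M" by (rule presents_left_module[OF p])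
  show "carrier M \<noteq> {\<zero>\<^bsub>M\<^esub>}" using one p' by auto
  fix H assume H: "submodule H R M"
  interpret H: submodule H R M by (rule H)
  have sub: "H \<subseteq> range \<Psi>" using H.subset p' by auto
  have zero: "\<zero>\<^bsub>M\<^esub> \<in> H" using H.one_closed by simp
  define N where "N = {f. \<Psi> f \<in> H}"
  have N: "left_ideal N"
    unfolding left_ideal_def
  proof (intro conjI ballI allI)
    show "0 \<in> N" using zero p' by (simp add: N_def)
    show "x + y \<in> N" if "x \<in> N" "y \<in> N" for x y
      using H.m_closed[of "\<Psi> x" "\<Psi> y"] that p' by (simp add: N_def)
    show "r * x \<in> N" if "x \<in> N" for r x
      using H.smult_closed[of "cls r" "\<Psi> x"] that p' by (simp add: N_def)
  qed
  have ker: "{f. \<Psi> f = \<zero>\<^bsub>M\<^esub>} \<subseteq> N" using zero by (auto simp: N_def)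
  show "H = {\<zero>\<^bsub>M\<^esub>} \<or> H = carrier M"
  proof (cases "{f. \<Psi> f = \<zero>\<^bsub>M\<^esub>} = N")
    case True
    then have "H \<subseteq> {\<zero>\<^bsub>M\<^esub>}" using sub unfolding N_def by auto
    then show ?thesis using zero by auto
  next
    case False
    then have "1 \<in> N" using max[OF N] ker by auto
    then have "f \<in> N" for f using left_idealD(3)[OF N, of 1 f] by simp
    then have "range \<Psi> \<subseteq> H" by (auto simp: N_def)
    then show ?thesis using sub p' by auto
  qed
qed

lemma presents_quot:
  assumes p: "presents \<Psi> M" and N: "left_ideal N" and ker: "\<And>f. \<Psi> f = \<zero>\<^bsub>M\<^esub> \<Longrightarrow> f \<in> N"
  shows "presents (\<lambda>f. \<Psi> ` N +>\<^bsub>M\<^esub> \<Psi> f) (quot_module M (\<Psi> ` N))"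
    and "\<Psi> ` N +>\<^bsub>M\<^esub> \<Psi> f = \<zero>\<^bsub>quot_module M (\<Psi> ` N)\<^esub> \<longleftrightarrow> f \<in> N"
proof -
  note p' = p[unfolded presents_def] carrier_cls
  let ?H = "\<Psi> ` N"
  have diff: "\<Psi> f = \<Psi> g \<Longrightarrow> f - g \<in> N" for f g
  proof -
    assume "\<Psi> f = \<Psi> g"
    then have "\<Psi> (f - g) = \<Psi> 0" using p'(1) by (metis add_uminus_conv_diff right_minus)
    then show ?thesis using ker p' by simp
  qed
  have mem: "x \<in> ?H +>\<^bsub>M\<^esub> \<Psi> f \<longleftrightarrow> (\<exists>g. x = \<Psi> g \<and> g - f \<in> N)" for x f
  proof
    assume "x \<in> ?H +>\<^bsub>M\<^esub> \<Psi> f"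
    then obtain n where "n \<in> N" "x = \<Psi> n \<oplus>\<^bsub>M\<^esub> \<Psi> f" by (auto simp: a_r_coset_def')
    then show "\<exists>g. x = \<Psi> g \<and> g - f \<in> N" using p' by (intro exI[of _ "n + f"]) auto
  next
    assume "\<exists>g. x = \<Psi> g \<and> g - f \<in> N"
    then obtain g where g: "x = \<Psi> g" "g - f \<in> N" by auto
    then have "x = \<Psi> (g - f) \<oplus>\<^bsub>M\<^esub> \<Psi> f" using p' by auto
    then show "x \<in> ?H +>\<^bsub>M\<^esub> \<Psi> f" using g by (auto simp: a_r_coset_def')
  qed
  have mem': "\<Psi> g \<in> ?H +>\<^bsub>M\<^esub> \<Psi> f \<longleftrightarrow> g - f \<in> N" for f g
    unfolding mem using diff left_idealD(2)[OF N] by (metis add.commute diff_add_cancel diff_add_eq)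
  have eq: "?H +>\<^bsub>M\<^esub> \<Psi> f = ?H +>\<^bsub>M\<^esub> \<Psi> g \<longleftrightarrow> f - g \<in> N" for f g
  proof
    assume "?H +>\<^bsub>M\<^esub> \<Psi> f = ?H +>\<^bsub>M\<^esub> \<Psi> g"
    then show "f - g \<in> N" using mem'[of f f] mem'[of f g] left_idealD(1)[OF N] by simp
  next
    assume fg: "f - g \<in> N"
    have "h - f \<in> N \<longleftrightarrow> h - g \<in> N" for h
      using left_idealD(2)[OF N _ fg, of "h - f"] left_idealD(5)[OF N _ fg, of "h - g"] by auto
    then show "?H +>\<^bsub>M\<^esub> \<Psi> f = ?H +>\<^bsub>M\<^esub> \<Psi> g" by (auto simp: mem)
  qed
  have zero: "?H +>\<^bsub>M\<^esub> \<Psi> 0 = ?H"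
    using p' by (auto simp: mem) 
  then show "?H +>\<^bsub>M\<^esub> \<Psi> f = \<zero>\<^bsub>quot_module M ?H\<^esub> \<longleftrightarrow> f \<in> N" for f
    using eq[of f 0] by (simp add: quot_module_def)
  have carr: "a_rcosets\<^bsub>M\<^esub> ?H = range (\<lambda>f. ?H +>\<^bsub>M\<^esub> \<Psi> f)"
    using p' by (auto simp: A_RCOSETS_def')
  have add: "set_add M (?H +>\<^bsub>M\<^esub> \<Psi> f) (?H +>\<^bsub>M\<^esub> \<Psi> g) = ?H +>\<^bsub>M\<^esub> \<Psi> (f + g)" for f g
  proof (intro equalityI subsetI)
    fix x assume "x \<in> set_add M (?H +>\<^bsub>M\<^esub> \<Psi> f) (?H +>\<^bsub>M\<^esub> \<Psi> g)"
    then obtain a b where ab: "x = \<Psi> a \<oplus>\<^bsub>M\<^esub> \<Psi> b" "a - f \<in> N" "b - g \<in> N"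
      by (auto simp: set_add_def' mem)
    then have "x = \<Psi> (a + b)" "(a + b) - (f + g) \<in> N"
      using p' left_idealD(2)[OF N ab(2,3)] by (auto simp: algebra_simps)
    then show "x \<in> ?H +>\<^bsub>M\<^esub> \<Psi> (f + g)" by (auto simp: mem)
  next
    fix x assume "x \<in> ?H +>\<^bsub>M\<^esub> \<Psi> (f + g)"
    then obtain h where h: "x = \<Psi> h" "h - (f + g) \<in> N" by (auto simp: mem)
    then have "x = \<Psi> (h - g) \<oplus>\<^bsub>M\<^esub> \<Psi> g" "(h - g) - f \<in> N" using p' by (auto simp: algebra_simps)
    then show "x \<in> set_add M (?H +>\<^bsub>M\<^esub> \<Psi> f) (?H +>\<^bsub>M\<^esub> \<Psi> g)"
      using left_idealD(1)[OF N] by (auto simp: set_add_def' mem' intro!: bexI)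
  qed
  have smult: "(\<Union>x\<in>?H +>\<^bsub>M\<^esub> \<Psi> f. ?H +>\<^bsub>M\<^esub> (cls r \<odot>\<^bsub>M\<^esub> x)) = ?H +>\<^bsub>M\<^esub> \<Psi> (r * f)" for r f
  proof -
    have "?H +>\<^bsub>M\<^esub> (cls r \<odot>\<^bsub>M\<^esub> x) = ?H +>\<^bsub>M\<^esub> \<Psi> (r * f)" if x: "x \<in> ?H +>\<^bsub>M\<^esub> \<Psi> f" for x
    proof -
      obtain g where g: "x = \<Psi> g" "g - f \<in> N" using x mem by auto
      then have "r * g - r * f \<in> N" using left_idealD(3)[OF N g(2), of r] by (simp add: algebra_simps)
      then show ?thesis using g p' eq by auto
    qed
    moreover have "\<Psi> f \<in> ?H +>\<^bsub>M\<^esub> \<Psi> f" using mem' left_idealD(1)[OF N] by simp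
    ultimately show ?thesis by blast
  qed
  show "presents (\<lambda>f. ?H +>\<^bsub>M\<^esub> \<Psi> f) (quot_module M ?H)"
    unfolding presents_def using carr zero add smult by (simp add: quot_module_def)
qed

end

section \<open>Free algebras, enveloping algebras and their ideals\<close>

lemma free_alg_simps [simp]:
  "f \<otimes>\<^bsub>free_alg L\<^esub> g = f * g" "f \<oplus>\<^bsub>free_alg L\<^esub> g = f + g" "\<one>\<^bsub>free_alg L\<^esub> = 1" "\<zero>\<^bsub>free_alg L\<^esub> = 0"
  by (simp_all add: free_alg_def)

lemma carrier_free_alg: "f \<in> carrier (free_alg L) \<longleftrightarrow> (\<forall>w\<in>Poly_Mapping.keys f. set (letters w) \<subseteq> L)"
  by (simp add: free_alg_def)

lemma letters_simps [simp]: "letters 0 = []" "letters (v + w) = letters v @ letters w"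
  by (simp_all add: zero_mon_def plus_mon_def)

lemma carrier_free_alg_UNIV [simp]: "carrier (free_alg UNIV) = UNIV"
  by (auto simp: carrier_free_alg)

lemma free_alg_closed:
  "f \<in> carrier (free_alg L) \<Longrightarrow> g \<in> carrier (free_alg L) \<Longrightarrow> f + g \<in> carrier (free_alg L)"
  "f \<in> carrier (free_alg L) \<Longrightarrow> g \<in> carrier (free_alg L) \<Longrightarrow> f * g \<in> carrier (free_alg L)"
  "f \<in> carrier (free_alg L) \<Longrightarrow> - f \<in> carrier (free_alg L)"
  "f \<in> carrier (free_alg L) \<Longrightarrow> g \<in> carrier (free_alg L) \<Longrightarrow> f - g \<in> carrier (free_alg L)"
  "0 \<in> carrier (free_alg L)" "1 \<in> carrier (free_alg L)" "scal s \<in> carrier (free_alg L)"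
  "x \<in> L \<Longrightarrow> gen x \<in> carrier (free_alg L)"
proof -
  show add: "f \<in> carrier (free_alg L) \<Longrightarrow> g \<in> carrier (free_alg L) \<Longrightarrow> f + g \<in> carrier (free_alg L)" for f g
    using keys_add[of f g] by (auto simp: carrier_free_alg)
  show "f \<in> carrier (free_alg L) \<Longrightarrow> g \<in> carrier (free_alg L) \<Longrightarrow> f * g \<in> carrier (free_alg L)"
    using keys_mult[of f g] by (fastforce simp: carrier_free_alg)
  show minus: "f \<in> carrier (free_alg L) \<Longrightarrow> - f \<in> carrier (free_alg L)" for f
    by (simp add: carrier_free_alg Poly_Mapping.keys_minus in_keys_iff)
  show "f \<in> carrier (free_alg L) \<Longrightarrow> g \<in> carrier (free_alg L) \<Longrightarrow> f - g \<in> carrier (free_alg L)"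
    using add[of f "- g"] minus[of g] by simp
qed (auto simp: carrier_free_alg scal_def gen_def)

lemma ring_free_alg: "ring (free_alg L)"
proof (rule ringI)
  show "abelian_group (free_alg L)"
    by (rule abelian_groupI) (auto simp: algebra_simps free_alg_closed intro!: bexI[of _ "- _"])
  show "monoid (free_alg L)" by (rule monoidI) (auto simp: algebra_simps free_alg_closed)
qed (auto simp: algebra_simps)

lemma ideal_free_algI:
  assumes "I \<subseteq> carrier (free_alg L)" "0 \<in> I" "\<And>f g. f \<in> I \<Longrightarrow> g \<in> I \<Longrightarrow> f + g \<in> I"
    "\<And>f r. f \<in> I \<Longrightarrow> r \<in> carrier (free_alg L) \<Longrightarrow> r * f \<in> I"
    "\<And>f r. f \<in> I \<Longrightarrow> r \<in> carrier (free_alg L) \<Longrightarrow> f * r \<in> I"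
  shows "ideal I (free_alg L)"
proof (rule idealI[OF ring_free_alg])
  interpret ring "free_alg L" by (rule ring_free_alg)
  have "\<ominus>\<^bsub>free_alg L\<^esub> f = - 1 * f" if "f \<in> I" for f
    by (rule minus_equality) (use assms(1) that free_alg_closed(3)[OF subsetD[OF assms(1) that]] in auto)
  then have "\<ominus>\<^bsub>free_alg L\<^esub> f \<in> I" if "f \<in> I" for f
    using that assms(4)[OF that free_alg_closed(3)[OF free_alg_closed(6)]] by simp
  then show "subgroup I (add_monoid (free_alg L))"
    by (intro subgroup.intro) (use assms in \<open>auto simp: a_inv_def\<close>)
qed (use assms in auto)

lemma env_ideal_subset:
  assumes "ideal K (free_alg L)" "env_relators L sc br \<subseteq> K"
  shows "env_ideal L sc br \<subseteq> K"
  unfolding env_ideal_def by (rule ring.genideal_minimal[OF ring_free_alg assms])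

lemma ideal_env_ideal:
  assumes "env_relators L sc br \<subseteq> carrier (free_alg L)"
  shows "ideal (env_ideal L sc br) (free_alg L)" "env_relators L sc br \<subseteq> env_ideal L sc br"
  unfolding env_ideal_def
  using ring.genideal_ideal[OF ring_free_alg assms] ring.genideal_self[OF ring_free_alg assms] by auto

lemma env_class_eq: "env_class L sc br f = {i + f | i. i \<in> env_ideal L sc br}"
  by (auto simp: env_class_def a_r_coset_def')

lemma presented_ring_env_alg: "presented_ring (env_alg UNIV sc br) (env_class UNIV sc br)"
proof -
  interpret I: ideal "env_ideal UNIV sc br" "free_alg UNIV" by (rule ideal_env_ideal) auto
  have hom: "env_class UNIV sc br \<in> ring_hom (free_alg UNIV) (env_alg UNIV sc br)"
    using I.rcos_ring_hom by (simp add: env_class_def[abs_def] env_alg_def)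
  show ?thesis
  proof (intro presented_ring.intro presented_ring_axioms.intro)
    show "Ring.ring (env_alg UNIV sc br)" unfolding env_alg_def by (rule I.quotient_is_ring)
    show "carrier (env_alg UNIV sc br) = range (env_class UNIV sc br)"
      by (auto simp: env_alg_def FactRing_def A_RCOSETS_def' env_class_def)
  qed (use ring_hom_add[OF hom] ring_hom_mult[OF hom] ring_hom_one[OF hom] in auto)
qed

lemma env_ideal_UNIV:
  "left_ideal (env_ideal UNIV sc br)" "env_relators UNIV sc br \<subseteq> env_ideal UNIV sc br"
  "f \<in> env_ideal UNIV sc br \<Longrightarrow> f * r \<in> env_ideal UNIV sc br"
proof -
  interpret I: ideal "env_ideal UNIV sc br" "free_alg UNIV" by (rule ideal_env_ideal) auto
  show "left_ideal (env_ideal UNIV sc br)"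
    unfolding left_ideal_def
    using additive_subgroup.a_closed[OF I.is_additive_subgroup] additive_subgroup.zero_closed[OF I.is_additive_subgroup]
      I.I_l_closed by auto
  show "f \<in> env_ideal UNIV sc br \<Longrightarrow> f * r \<in> env_ideal UNIV sc br" using I.I_r_closed by auto
  show "env_relators UNIV sc br \<subseteq> env_ideal UNIV sc br" by (rule ideal_env_ideal) auto
qed

lemma env_class_eq_iff: "env_class UNIV sc br f = env_class UNIV sc br g \<longleftrightarrow> f - g \<in> env_ideal UNIV sc br"
proof -
  note I = left_idealD[OF env_ideal_UNIV(1)[of sc br]]
  show ?thesis
  proof
    assume "env_class UNIV sc br f = env_class UNIV sc br g"
    then have "0 + f \<in> env_class UNIV sc br g" unfolding env_class_eq using I(1) by blast
    then show "f - g \<in> env_ideal UNIV sc br" by (auto simp: env_class_eq)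
  next
    assume fg: "f - g \<in> env_ideal UNIV sc br"
    have "i + f = (i + (f - g)) + g" "i + g = (i - (f - g)) + f" for i by simp_all
    then show "env_class UNIV sc br f = env_class UNIV sc br g"
      unfolding env_class_eq using I(2,5) fg by blast
  qed
qed

section \<open>Characters of a subalgebra and their induced modules\<close>

lemma char_eval_add: "char_eval \<xi> (f + g) = char_eval \<xi> f + char_eval \<xi> g"
  unfolding char_eval_def by (rule setsum_keys_plus_distrib) (simp_all add: algebra_simps)

lemma char_eval_single: "char_eval \<xi> (Poly_Mapping.single w s) = s * prod_list (map \<xi> (letters w))"
  by (simp add: char_eval_def)

lemma char_eval_0: "char_eval \<xi> 0 = 0"
  by (simp add: char_eval_def)

lemma char_eval_mult: "char_eval \<xi> (f * g) = char_eval \<xi> f * char_eval \<xi> g"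
proof (induction f rule: poly_mapping_single_induct)
  case (single v s)
  show ?case
  proof (induction g rule: poly_mapping_single_induct)
    case (single w t)
    then show ?case by (simp add: mult_single char_eval_single)
  qed (simp_all add: char_eval_0 char_eval_add algebra_simps)
qed (simp_all add: char_eval_0 char_eval_add algebra_simps)

lemma char_eval_diff: "char_eval \<xi> (f - g) = char_eval \<xi> f - char_eval \<xi> g"
  using char_eval_add[of \<xi> "f - g" g] by simp

lemma char_eval_gen: "char_eval \<xi> (gen x) = \<xi> x" "char_eval \<xi> (scal s) = s" "char_eval \<xi> 1 = 1"
  using char_eval_single[of \<xi> 0 1] by (simp_all add: gen_def scal_def char_eval_single)

locale character =
  fixes sc :: "complex \<Rightarrow> 'g::ab_group_add \<Rightarrow> 'g" and br :: "'g \<Rightarrow> 'g \<Rightarrow> 'g"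
    and P :: "'g set" and \<xi> :: "'g \<Rightarrow> complex"
  assumes P_add: "x \<in> P \<Longrightarrow> y \<in> P \<Longrightarrow> x + y \<in> P"
    and P_scale: "x \<in> P \<Longrightarrow> sc s x \<in> P"
    and P_bracket: "x \<in> P \<Longrightarrow> y \<in> P \<Longrightarrow> br x y \<in> P"
    and \<xi>_add: "x \<in> P \<Longrightarrow> y \<in> P \<Longrightarrow> \<xi> (x + y) = \<xi> x + \<xi> y"
    and \<xi>_scale: "x \<in> P \<Longrightarrow> \<xi> (sc s x) = s * \<xi> x"
    and \<xi>_bracket: "x \<in> P \<Longrightarrow> y \<in> P \<Longrightarrow> \<xi> (br x y) = 0"
begin

abbreviation "R \<equiv> env_alg UNIV sc br"
abbreviation "S \<equiv> env_alg P sc br"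
abbreviation "cls \<equiv> env_class UNIV sc br"
abbreviation "I \<equiv> env_ideal UNIV sc br"
abbreviation "V \<equiv> tensor_module R S (env_incl UNIV sc br) (char_module \<xi>)"
abbreviation "T \<equiv> tensor_kernel R S (env_incl UNIV sc br) (char_module \<xi>)"
abbreviation "F \<equiv> free_Abelian_group (carrier R \<times> (UNIV :: complex set))"

sublocale presented_ring R cls
  by (rule presented_ring_env_alg)

lemma relators_P: "env_relators P sc br \<subseteq> carrier (free_alg P)"
  by (auto simp: env_relators_def P_add P_scale P_bracket intro!: free_alg_closed)

text \<open>These inclusions make the scalar chosen by \<open>THE\<close> in
  \<open>char_module\<close>, and the union in \<open>env_incl\<close>, independent of the
  representative.\<close>

lemma env_ideal_P:
  "env_ideal P sc br \<subseteq> {f \<in> carrier (free_alg P). char_eval \<xi> f = 0}"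
  "env_ideal P sc br \<subseteq> I" "0 \<in> env_ideal P sc br"
proof -
  show "env_ideal P sc br \<subseteq> {f \<in> carrier (free_alg P). char_eval \<xi> f = 0}"
  proof (rule env_ideal_subset[OF ideal_free_algI])
    have "char_eval \<xi> f = 0" if "f \<in> env_relators P sc br" for f
      using that by (auto simp: env_relators_def char_eval_diff char_eval_mult char_eval_gen
          \<xi>_add \<xi>_scale \<xi>_bracket)
    then show "env_relators P sc br \<subseteq> {f \<in> carrier (free_alg P). char_eval \<xi> f = 0}"
      using relators_P by blast
  qed (auto simp: free_alg_closed char_eval_add char_eval_mult char_eval_0)
  interpret I: ideal "env_ideal P sc br" "free_alg P" by (rule ideal_env_ideal[OF relators_P])
  show "0 \<in> env_ideal P sc br" using additive_subgroup.zero_closed[OF I.is_additive_subgroup] by simp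
  have "env_ideal P sc br \<subseteq> I \<inter> carrier (free_alg P)"
  proof (rule env_ideal_subset[OF ideal_free_algI])
    have "env_relators P sc br \<subseteq> env_relators UNIV sc br" by (auto simp: env_relators_def)
    then show "env_relators P sc br \<subseteq> I \<inter> carrier (free_alg P)"
      using relators_P env_ideal_UNIV(2)[of sc br] by blast
  qed (use left_idealD[OF env_ideal_UNIV(1)[of sc br]] env_ideal_UNIV(3) in \<open>auto simp: free_alg_closed\<close>)
  then show "env_ideal P sc br \<subseteq> I" by auto
qed

lemma carrier_S: "carrier S = env_class P sc br ` carrier (free_alg P)"
  by (auto simp: env_alg_def FactRing_def A_RCOSETS_def' env_class_def)

lemma env_incl_class: "env_incl UNIV sc br (env_class P sc br f) = cls f"
proof -
  have "cls g = cls f" if g: "g \<in> env_class P sc br f" for g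
  proof -
    obtain i where "i \<in> env_ideal P sc br" "g = i + f" using g unfolding env_class_eq by auto
    then show ?thesis using env_ideal_P(2) by (auto simp: env_class_eq_iff)
  qed
  moreover have "f \<in> env_class P sc br f" using env_ideal_P(3) by (force simp: env_class_eq)
  ultimately show ?thesis unfolding env_incl_def by blast
qed

lemma char_module_smult: "env_class P sc br f \<odot>\<^bsub>char_module \<xi>\<^esub> z = char_eval \<xi> f * z"
proof -
  have "(THE s. \<forall>g\<in>env_class P sc br f. char_eval \<xi> g = s) = char_eval \<xi> f"
  proof (rule the_equality)
    show "\<forall>g\<in>env_class P sc br f. char_eval \<xi> g = char_eval \<xi> f"
      using env_ideal_P(1) by (auto simp: env_class_eq char_eval_add)
    have "f \<in> env_class P sc br f" using env_ideal_P(3) by (force simp: env_class_eq)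
    then show "s = char_eval \<xi> f" if "\<forall>g\<in>env_class P sc br f. char_eval \<xi> g = s" for s using that by auto
  qed
  then show ?thesis by (simp add: char_module_def)
qed

lemma char_module_simps: "carrier (char_module \<xi>) = UNIV" "x \<oplus>\<^bsub>char_module \<xi>\<^esub> y = x + y"
  by (simp_all add: char_module_def)

lemma relators_eq: "tensor_relators R S (env_incl UNIV sc br) (char_module \<xi>) =
    {frag_of (cls (f + g), v) - frag_of (cls f, v) - frag_of (cls g, v) | f g v. True} \<union>
    {frag_of (cls f, v + v') - frag_of (cls f, v) - frag_of (cls f, v') | f v v'. True} \<union>
    {frag_of (cls (f * s), v) - frag_of (cls f, char_eval \<xi> s * v) | f s v. s \<in> carrier (free_alg P)}"
proof -
  have 1: "{frag_of (r \<oplus>\<^bsub>R\<^esub> r', v) - frag_of (r, v) - frag_of (r', v) | r r' v.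
        r \<in> carrier R \<and> r' \<in> carrier R \<and> v \<in> carrier (char_module \<xi>)} =
      {frag_of (cls f \<oplus>\<^bsub>R\<^esub> cls g, v) - frag_of (cls f, v) - frag_of (cls g, v) | f g v. True}"
    unfolding carrier_cls char_module_simps by blast
  have 2: "{frag_of (r, v \<oplus>\<^bsub>char_module \<xi>\<^esub> v') - frag_of (r, v) - frag_of (r, v') | r v v'.
        r \<in> carrier R \<and> v \<in> carrier (char_module \<xi>) \<and> v' \<in> carrier (char_module \<xi>)} =
      {frag_of (cls f, v + v') - frag_of (cls f, v) - frag_of (cls f, v') | f v v'. True}"
    unfolding carrier_cls char_module_simps by blast
  have 3: "{frag_of (r \<otimes>\<^bsub>R\<^esub> env_incl UNIV sc br s, v) - frag_of (r, s \<odot>\<^bsub>char_module \<xi>\<^esub> v) | r s v.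
        r \<in> carrier R \<and> s \<in> carrier S \<and> v \<in> carrier (char_module \<xi>)} =
      {frag_of (cls f \<otimes>\<^bsub>R\<^esub> env_incl UNIV sc br (env_class P sc br s), v) -
        frag_of (cls f, env_class P sc br s \<odot>\<^bsub>char_module \<xi>\<^esub> v) | f s v. s \<in> carrier (free_alg P)}"
    unfolding carrier_cls carrier_S char_module_simps by blast
  show ?thesis
    unfolding tensor_relators_def 1 2 3 by (simp only: env_incl_class add_cls mult_cls char_module_smult)
qed

end

context character
begin

lemma relators_carrier: "tensor_relators R S (env_incl UNIV sc br) (char_module \<xi>) \<subseteq> carrier F"
proof -
  have "frag_of (cls f, v) \<in> carrier F" for f v by (simp add: carrier_cls)
  moreover have "x - y \<in> carrier F" if "x \<in> carrier F" "y \<in> carrier F" for x y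
    using that keys_diff[of x y] by auto
  ultimately show ?thesis unfolding relators_eq by blast
qed

lemma T_eq: "T = generate F (tensor_relators R S (env_incl UNIV sc br) (char_module \<xi>))"
  by (simp add: tensor_kernel_def char_module_simps)

lemma subgroup_T: "subgroup T F"
  unfolding T_eq by (rule group.generate_is_subgroup[OF group_free_Abelian_group relators_carrier])

lemma T_closed:
  "0 \<in> T" "x \<in> T \<Longrightarrow> y \<in> T \<Longrightarrow> x + y \<in> T" "x \<in> T \<Longrightarrow> - x \<in> T" "x \<in> T \<Longrightarrow> y \<in> T \<Longrightarrow> x - y \<in> T"
  "x \<in> T \<Longrightarrow> x \<in> carrier F"
proof -
  interpret subgroup T F by (rule subgroup_T)
  show "0 \<in> T" using one_closed by simp
  show add: "x \<in> T \<Longrightarrow> y \<in> T \<Longrightarrow> x + y \<in> T" for x y using m_closed by simp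
  show carr: "x \<in> T \<Longrightarrow> x \<in> carrier F" for x by (rule mem_carrier)
  show minus: "- x \<in> T" if x: "x \<in> T" for x
  proof -
    have "inv\<^bsub>F\<^esub> x = - x" using carr[OF x] by (intro inv_free_Abelian_group) simp
    then show ?thesis using m_inv_closed[OF x] by simp
  qed
  show "x \<in> T \<Longrightarrow> y \<in> T \<Longrightarrow> x - y \<in> T" using add[of x "- y"] minus[of y] by simp
qed

lemma T_induct [consumes 1, case_names diff left right balanced]:
  assumes "x \<in> T" "\<And>x y. Q x \<Longrightarrow> Q y \<Longrightarrow> Q (x - y)"
    "\<And>f g v. Q (frag_of (cls (f + g), v) - frag_of (cls f, v) - frag_of (cls g, v))"
    "\<And>f v v'. Q (frag_of (cls f, v + v') - frag_of (cls f, v) - frag_of (cls f, v'))"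
    "\<And>f s v. s \<in> carrier (free_alg P) \<Longrightarrow> Q (frag_of (cls (f * s), v) - frag_of (cls f, char_eval \<xi> s * v))"
  shows "Q x"
proof -
  have rel: "Q r" if "r \<in> tensor_relators R S (env_incl UNIV sc br) (char_module \<xi>)" for r
    using that assms(3-5) unfolding relators_eq by blast
  have zero: "Q 0" using assms(2)[OF assms(3,3)[of 0 0 0]] by simp
  have minus: "Q y \<Longrightarrow> Q (- y)" for y using assms(2)[OF zero, of y] by simp
  show ?thesis using assms(1) unfolding T_eq
  proof (induction rule: generate.induct)
    case (inv h)
    then have "h \<in> carrier F" using relators_carrier by blast
    then have "inv\<^bsub>F\<^esub> h = - h" by (intro inv_free_Abelian_group) simp
    then show ?case using minus rel inv by simp
  next
    case (eng x y)
    then show ?case using assms(2)[of x "- y"] minus[of y] by simp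
  qed (use zero rel in auto)
qed

lemma r_coset_T: "T #>\<^bsub>F\<^esub> x = {t + x | t. t \<in> T}"
  by (auto simp: r_coset_def)

lemma r_coset_T_eq_iff: "T #>\<^bsub>F\<^esub> x = T #>\<^bsub>F\<^esub> y \<longleftrightarrow> x - y \<in> T"
proof
  assume "T #>\<^bsub>F\<^esub> x = T #>\<^bsub>F\<^esub> y"
  then have "0 + x \<in> T #>\<^bsub>F\<^esub> y" unfolding r_coset_T using T_closed(1) by blast
  then show "x - y \<in> T" by (auto simp: r_coset_T)
next
  assume xy: "x - y \<in> T"
  have "t + x = (t + (x - y)) + y" "t + y = (t - (x - y)) + x" for t by simp_all
  then show "T #>\<^bsub>F\<^esub> x = T #>\<^bsub>F\<^esub> y"
    unfolding r_coset_T using T_closed(2,4) xy by blast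
qed

definition \<Psi> :: "'g falg \<Rightarrow> ('g falg set \<times> complex \<Rightarrow>\<^sub>0 int) set"
  where "\<Psi> f = T #>\<^bsub>F\<^esub> frag_of (cls f, 1)"

lemma relators_T:
  "frag_of (cls (f + g), v) - frag_of (cls f, v) - frag_of (cls g, v) \<in> T"
  "frag_of (cls f, v + v') - frag_of (cls f, v) - frag_of (cls f, v') \<in> T"
  "s \<in> carrier (free_alg P) \<Longrightarrow> frag_of (cls (f * s), v) - frag_of (cls f, char_eval \<xi> s * v) \<in> T"
  unfolding T_eq relators_eq by (rule generate.incl, blast)+

text \<open>Scalars lie in the enveloping algebra of \<open>P\<close>, so balancing carries the
  second tensor factor over to the first. Every tensor thus has the form f \<otimes> 1.\<close>

lemma frag_of_scal_T: "frag_of (cls f, z) - frag_of (cls (f * scal z), 1) \<in> T"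
  using T_closed(3)[OF relators_T(3)[OF free_alg_closed(7), of f z 1]] by (simp add: char_eval_gen)

lemma tensor_representative:
  assumes "x \<in> carrier F"
  shows "\<exists>f. x - frag_of (cls f, 1) \<in> T"
proof -
  have "Poly_Mapping.keys x \<subseteq> carrier R \<times> (UNIV :: complex set)" using assms by simp
  then show ?thesis
  proof (rule free_Abelian_group_induct)
    show "\<exists>f. 0 - frag_of (cls f, 1) \<in> T"
      using relators_T(1)[of 0 0 1] by (intro exI[of _ 0]) simp
    show "\<exists>f. frag_of a - frag_of (cls f, 1) \<in> T" if a: "a \<in> carrier R \<times> (UNIV :: complex set)" for a
    proof -
      obtain f z where "a = (cls f, z)" using a carrier_cls by auto
      then show ?thesis using frag_of_scal_T by blast
    qed
    fix x y assume "\<exists>f. x - frag_of (cls f, 1) \<in> T" "\<exists>f. y - frag_of (cls f, 1) \<in> T"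
    then obtain f g where fg: "x - frag_of (cls f, 1) \<in> T" "y - frag_of (cls g, 1) \<in> T" by auto
    have "x - y - frag_of (cls (f - g), 1) = ((x - frag_of (cls f, 1)) - (y - frag_of (cls g, 1))) +
        (frag_of (cls (f - g + g), 1) - frag_of (cls (f - g), 1) - frag_of (cls g, 1))" by simp
    then show "\<exists>f. x - y - frag_of (cls f, 1) \<in> T" using T_closed(2,4) fg relators_T(1) by (metis (no_types, lifting))
  qed
qed

lemma V_simps: "carrier V = rcosets\<^bsub>F\<^esub> T" "\<zero>\<^bsub>V\<^esub> = T" "X \<oplus>\<^bsub>V\<^esub> Y = set_mult F X Y"
  "r \<odot>\<^bsub>V\<^esub> X = (\<Union>x\<in>X. T #>\<^bsub>F\<^esub> frag_extend (\<lambda>(r', v). frag_of (r \<otimes>\<^bsub>R\<^esub> r', v)) x)"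
  by (simp_all add: tensor_module_def Let_def char_module_simps)

text \<open>Left multiplication turns each relator into a relator of the same kind; this is the
  well-definedness of the action on the tensor product.\<close>

lemma frag_extend_T: "frag_extend (\<lambda>(r', v). frag_of (cls r \<otimes>\<^bsub>R\<^esub> r', v)) t \<in> T" if "t \<in> T"
  using that
proof (induction rule: T_induct)
  case (diff x y)
  then show ?case by (simp add: frag_extend_diff T_closed)
next
  case (left f g v)
  then show ?case using relators_T(1)[of "r * f" "r * g" v] by (simp add: frag_extend_diff mult_cls distrib_left)
next
  case (right f v v')
  then show ?case using relators_T(2) by (simp add: frag_extend_diff mult_cls)
next
  case (balanced f s v)
  then show ?case using relators_T(3)[of s "r * f" v] by (simp add: frag_extend_diff mult_cls mult.assoc)
qed

lemma presents_V: "presents \<Psi> V"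
  unfolding presents_def
proof (intro conjI allI)
  show "carrier V = range \<Psi>"
  proof
    show "carrier V \<subseteq> range \<Psi>"
    proof
      fix X assume "X \<in> carrier V"
      then obtain x where x: "x \<in> carrier F" "X = T #>\<^bsub>F\<^esub> x" by (auto simp: V_simps RCOSETS_def)
      then obtain f where "x - frag_of (cls f, 1) \<in> T" using tensor_representative by blast
      then show "X \<in> range \<Psi>" using x r_coset_T_eq_iff by (auto simp: \<Psi>_def)
    qed
    show "range \<Psi> \<subseteq> carrier V"
    proof -
      have "frag_of (cls f, 1) \<in> carrier F" for f by (simp add: carrier_cls)
      then show ?thesis unfolding V_simps RCOSETS_def \<Psi>_def by blast
    qed
  qed
  have "T #>\<^bsub>F\<^esub> 0 = T" by (auto simp: r_coset_T)
  moreover have "T #>\<^bsub>F\<^esub> 0 = \<Psi> 0"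
    unfolding \<Psi>_def r_coset_T_eq_iff using relators_T(1)[of 0 0 1] by simp
  ultimately show "\<zero>\<^bsub>V\<^esub> = \<Psi> 0" by (simp add: V_simps)
  fix f g
  have "T \<lhd> F" by (rule comm_group.subgroup_imp_normal[OF abelian_free_Abelian_group subgroup_T])
  moreover have "frag_of (cls f, 1) \<in> carrier F" "frag_of (cls g, 1) \<in> carrier F" by (simp_all add: carrier_cls)
  ultimately have "\<Psi> f \<oplus>\<^bsub>V\<^esub> \<Psi> g = T #>\<^bsub>F\<^esub> (frag_of (cls f, 1) + frag_of (cls g, 1))"
    unfolding V_simps \<Psi>_def using normal.rcos_sum[of T F] by (simp only: mult_free_Abelian_group)
  also have "\<dots> = \<Psi> (f + g)"
    unfolding \<Psi>_def r_coset_T_eq_iff using T_closed(3)[OF relators_T(1)[of f g 1]] by (simp add: algebra_simps)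
  finally show "\<Psi> f \<oplus>\<^bsub>V\<^esub> \<Psi> g = \<Psi> (f + g)" .
  have "T #>\<^bsub>F\<^esub> frag_extend (\<lambda>(r', v). frag_of (cls f \<otimes>\<^bsub>R\<^esub> r', v)) x = \<Psi> (f * g)" if x: "x \<in> \<Psi> g" for x
  proof -
    obtain t where t: "t \<in> T" "x = t + frag_of (cls g, 1)" using x by (auto simp: \<Psi>_def r_coset_T)
    then show ?thesis unfolding \<Psi>_def r_coset_T_eq_iff
      using frag_extend_T[OF t(1), of f] by (simp add: frag_extend_add mult_cls)
  qed
  moreover have "frag_of (cls g, 1) \<in> \<Psi> g" using T_closed(1) by (force simp: \<Psi>_def r_coset_T)
  ultimately show "cls f \<odot>\<^bsub>V\<^esub> \<Psi> g = \<Psi> (f * g)" unfolding V_simps by blast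
qed

lemma \<Psi>_eq_0_iff: "\<Psi> f = \<zero>\<^bsub>V\<^esub> \<longleftrightarrow> frag_of (cls f, 1) \<in> T"
proof -
  have "T #>\<^bsub>F\<^esub> 0 = T" by (auto simp: r_coset_T)
  then show ?thesis using r_coset_T_eq_iff[of "frag_of (cls f, 1)" 0] by (simp add: \<Psi>_def V_simps)
qed

lemma vac_eq: "tensor R S (env_incl UNIV sc br) (char_module \<xi>) \<one>\<^bsub>R\<^esub> 1 = \<Psi> 1"
  by (simp add: tensor_def \<Psi>_def char_module_simps one_cls)

lemma left_ideal_kernel: "left_ideal {f. \<Psi> f = \<zero>\<^bsub>V\<^esub>}"
proof -
  have zero: "\<zero>\<^bsub>V\<^esub> = \<Psi> 0" and add: "\<Psi> f \<oplus>\<^bsub>V\<^esub> \<Psi> g = \<Psi> (f + g)"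
    and smult: "cls f \<odot>\<^bsub>V\<^esub> \<Psi> g = \<Psi> (f * g)" for f g
    using presents_V unfolding presents_def by blast+
  show ?thesis
    unfolding left_ideal_def zero
  proof (intro conjI ballI allI CollectI)
    show "\<Psi> (x + y) = \<Psi> 0" if "x \<in> {f. \<Psi> f = \<Psi> 0}" "y \<in> {f. \<Psi> f = \<Psi> 0}" for x y
      using that add[of x y] add[of 0 0] by simp
    show "\<Psi> (r * x) = \<Psi> 0" if "x \<in> {f. \<Psi> f = \<Psi> 0}" for r x
      using that smult[of r x] smult[of r 0] by simp
  qed simp
qed

lemma cyclic_eq:
  fixes u :: "'g falg"
  defines "N \<equiv> {j + r * u | j r. j \<in> {f. \<Psi> f = \<zero>\<^bsub>V\<^esub>}}"
  shows "cyclic_submodule R V (cls u \<odot>\<^bsub>V\<^esub> \<Psi> 1) = \<Psi> ` N"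
proof -
  have zero: "\<zero>\<^bsub>V\<^esub> = \<Psi> 0" and add: "\<Psi> f \<oplus>\<^bsub>V\<^esub> \<Psi> g = \<Psi> (f + g)"
    and smult: "cls f \<odot>\<^bsub>V\<^esub> \<Psi> g = \<Psi> (f * g)" for f g
    using presents_V unfolding presents_def by blast+
  have add0: "\<Psi> (j + f) = \<Psi> f" if "\<Psi> j = \<Psi> 0" for j f
    using add[of j f] add[of 0 f] that by simp
  have "cyclic_submodule R V (cls u \<odot>\<^bsub>V\<^esub> \<Psi> 1) = range (\<lambda>r. \<Psi> (r * u))"
    unfolding cyclic_submodule_def carrier_cls image_image smult by simp
  also have "\<dots> = \<Psi> ` N"
  proof
    show "\<Psi> ` N \<subseteq> range (\<lambda>r. \<Psi> (r * u))" by (auto simp: N_def zero add0)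
    have "0 + r * u \<in> N" for r unfolding N_def zero by blast
    then show "range (\<lambda>r. \<Psi> (r * u)) \<subseteq> \<Psi> ` N" by force
  qed
  finally show ?thesis .
qed

lemma \<Psi>_relations:
  "f \<in> I \<Longrightarrow> \<Psi> f = \<zero>\<^bsub>V\<^esub>" "x \<in> P \<Longrightarrow> \<Psi> (gen x - scal (\<xi> x)) = \<zero>\<^bsub>V\<^esub>"
proof -
  note p = presents_V[unfolded presents_def]
  show "f \<in> I \<Longrightarrow> \<Psi> f = \<zero>\<^bsub>V\<^esub>"
    using env_class_eq_iff[of sc br f 0] p by (simp add: \<Psi>_def)
  assume x: "x \<in> P"
  have "frag_of (cls (gen x), 1) - frag_of (cls (scal (\<xi> x)), 1) =
      (frag_of (cls (1 * gen x), 1) - frag_of (cls 1, char_eval \<xi> (gen x) * 1)) +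
      (frag_of (cls 1, \<xi> x) - frag_of (cls (1 * scal (\<xi> x)), 1))" by (simp add: char_eval_gen)
  also have "\<dots> \<in> T"
    by (intro T_closed(2) relators_T(3) frag_of_scal_T free_alg_closed(8) x)
  finally have "\<Psi> (gen x) = \<Psi> (scal (\<xi> x))" by (simp add: \<Psi>_def r_coset_T_eq_iff)
  then have "\<Psi> (gen x + - scal (\<xi> x)) = \<Psi> (scal (\<xi> x) + - scal (\<xi> x))" using p by metis
  then show "\<Psi> (gen x - scal (\<xi> x)) = \<zero>\<^bsub>V\<^esub>" using p by simp
qed

end

section \<open>Representations on the Fock space\<close>

locale fock_character = character sc br P \<xi>
  for sc :: "complex \<Rightarrow> 'g::ab_group_add \<Rightarrow> 'g" and br P \<xi> +
  fixes act :: "'g \<Rightarrow> fock \<Rightarrow> fock"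
  assumes lin_act: "lin (act x)"
    and act_add: "act (x + y) f = act x f + act y f"
    and act_scale: "act (sc s x) f = cst s * act x f"
    and act_bracket: "act (br x y) f = act x (act y f) - act y (act x f)"
    and act_vac: "x \<in> P \<Longrightarrow> act x 1 = cst (\<xi> x)"
begin

definition rho :: "'g falg \<Rightarrow> fock \<Rightarrow> fock"
  where "rho f y = linext (\<lambda>w. foldr act (letters w) y) f"

lemma rho_add: "rho (f + g) y = rho f y + rho g y"
  by (simp add: rho_def linext_add)

lemma rho_0: "rho 0 y = 0"
  by (simp add: rho_def)

lemma rho_diff: "rho (f - g) y = rho f y - rho g y"
  using rho_add[of "f - g" g y] by simp

lemma rho_single: "rho (Poly_Mapping.single w s) y = cst s * foldr act (letters w) y"
  by (simp add: rho_def linext_single)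

lemma lin_foldr_act: "lin (foldr act ws)"
  by (induction ws) (use lin_act in \<open>simp_all add: lin_def\<close>)

lemma lin_rho: "lin (rho f)"
proof (induction f rule: poly_mapping_single_induct)
  case (single w s)
  then show ?case
    by (simp add: lin_def rho_single linD[OF lin_foldr_act] distrib_left mult.left_commute)
qed (simp_all add: lin_def rho_add rho_0 algebra_simps)

lemma rho_mult: "rho (f * g) y = rho f (rho g y)"
proof (induction f rule: poly_mapping_single_induct)
  case (single v s)
  show ?case
  proof (induction g rule: poly_mapping_single_induct)
    case (single w t)
    then show ?case
      by (simp add: mult_single[of v s w t] rho_single linD(2)[OF lin_foldr_act] cst_simps(2) mult.assoc)
  qed (simp_all add: rho_0 rho_add linD(1,3)[OF lin_rho] distrib_left)
qed (simp_all add: rho_0 rho_add distrib_right)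

lemma rho_gen: "rho (gen x) y = act x y" "rho (scal s) y = cst s * y" "rho 1 y = y"
  using rho_single[of 0 1 y] by (simp_all add: gen_def scal_def rho_single)

lemma rho_ideal: "f \<in> I \<Longrightarrow> rho f y = 0"
proof -
  have "I \<subseteq> {f. \<forall>y. rho f y = 0}"
  proof (rule env_ideal_subset[OF ideal_free_algI])
    show "env_relators UNIV sc br \<subseteq> {f. \<forall>y. rho f y = 0}"
      by (auto simp: env_relators_def rho_diff rho_mult rho_gen act_add act_scale act_bracket)
  qed (auto simp: rho_0 rho_add rho_mult linD[OF lin_rho])
  then show "f \<in> I \<Longrightarrow> rho f y = 0" by auto
qed

lemma rho_vac:
  assumes "g \<in> carrier (free_alg P)"
  shows "rho g 1 = cst (char_eval \<xi> g)"
proof -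
  have *: "foldr act ws 1 = cst (prod_list (map \<xi> ws))" if "set ws \<subseteq> P" for ws
    using that
  proof (induction ws)
    case (Cons x ws)
    then have "foldr act (x # ws) 1 = act x (cst (prod_list (map \<xi> ws)) * 1)" by simp
    then show ?case using Cons act_vac[of x]
      by (simp only: linD(2)[OF lin_act]) (simp add: mult_single mult.commute)
  qed simp
  have sum: "(\<Sum>x\<in>A. cst (h x)) = cst (sum h A)" for h :: "'g mon \<Rightarrow> complex" and A
    by (induction A rule: infinite_finite_induct) (simp_all add: cst_simps)
  show ?thesis
    using assms unfolding rho_def linext_def char_eval_def sum[symmetric] carrier_free_alg
    by (intro sum.cong refl) (simp add: * cst_simps(2))
qed

text \<open>The map sending f \<otimes> z to z times f acting on the Fock vacuum. The choice of
  \<open>f\<close> is immaterial, since \<open>rho\<close> vanishes on the ideal of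
  relations.\<close>

definition phi :: "'g falg set \<times> complex \<Rightarrow> fock"
  where "phi = (\<lambda>(X, z). cst z * rho (SOME f. cls f = X) 1)"

lemma phi_cls: "phi (cls f, z) = cst z * rho f 1"
proof -
  have "cls (SOME g. cls g = cls f) = cls f" by (rule someI[of _ f]) simp
  then have "rho ((SOME g. cls g = cls f) - f) 1 = 0" by (simp add: env_class_eq_iff rho_ideal)
  then show ?thesis by (simp add: phi_def rho_diff)
qed

definition Phi :: "('g falg set \<times> complex \<Rightarrow>\<^sub>0 int) \<Rightarrow> fock"
  where "Phi x = (\<Sum>i\<in>Poly_Mapping.keys x. of_int (Poly_Mapping.lookup x i) * phi i)"

lemma Phi_add: "Phi (x + y) = Phi x + Phi y"
  unfolding Phi_def by (rule setsum_keys_plus_distrib) (simp_all add: algebra_simps)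

lemma Phi_diff: "Phi (x - y) = Phi x - Phi y"
  using Phi_add[of "x - y" y] by simp

lemma Phi_frag_of: "Phi (frag_of i) = phi i"
  by (simp add: Phi_def)

text \<open>The universal property of the induced module: the balancing relators vanish because
  \<open>P\<close> acts on the Fock vacuum through \<xi>.\<close>

lemma Phi_T: "x \<in> T \<Longrightarrow> Phi x = 0"
proof (induction rule: T_induct)
  case (diff x y)
  then show ?case by (simp add: Phi_diff)
next
  case (left f g v)
  show ?case unfolding Phi_diff Phi_frag_of phi_cls rho_add by (simp add: distrib_left)
next
  case (right f v v')
  show ?case unfolding Phi_diff Phi_frag_of phi_cls cst_simps(1) by (simp add: distrib_right)
next
  case (balanced f s v)
  have "rho (f * s) 1 = cst (char_eval \<xi> s) * rho f 1"
    using linD(2)[OF lin_rho, of f "char_eval \<xi> s" 1] by (simp add: rho_mult rho_vac[OF balanced])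
  then show ?case unfolding Phi_diff Phi_frag_of phi_cls cst_simps(2) by (simp add: ac_simps)
qed

lemma rho_kernel: "\<Psi> f = \<zero>\<^bsub>V\<^esub> \<Longrightarrow> rho f 1 = 0"
  using Phi_T[of "frag_of (cls f, 1)"] by (simp add: \<Psi>_eq_0_iff Phi_frag_of phi_cls)

text \<open>The left ideal \<open>J\<close> of the proof is the preimage of the submodule generated
  by \<open>u\<close>. Its elements all kill the Fock vacuum and 1 does not, so the quotient is not
  zero.\<close>

theorem irreducible_quotient:
  assumes u: "rho u 1 = 0"
    and max: "\<And>J N. \<lbrakk>left_ideal J; I \<subseteq> J; \<And>x. x \<in> P \<Longrightarrow> gen x - scal (\<xi> x) \<in> J; u \<in> J;
      left_ideal N; J \<subset> N\<rbrakk> \<Longrightarrow> 1 \<in> N"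
  shows "irreducible_module R (quot_module V (cyclic_submodule R V (cls u \<odot>\<^bsub>V\<^esub>
    tensor R S (env_incl UNIV sc br) (char_module \<xi>) \<one>\<^bsub>R\<^esub> 1)))"
proof -
  define J where "J = {j + r * u | j r. j \<in> {f. \<Psi> f = \<zero>\<^bsub>V\<^esub>}}"
  note J = left_ideal_adjoin[OF left_ideal_kernel, of u, folded J_def]
  have "1 \<notin> J"
  proof
    assume "1 \<in> J"
    then obtain j r where "1 = j + r * u" "\<Psi> j = \<zero>\<^bsub>V\<^esub>" unfolding J_def by blast
    then have "rho 1 1 = rho (j + r * u) 1" by (intro arg_cong[where f = "\<lambda>f. rho f 1"])
    then show False using \<open>\<Psi> j = \<zero>\<^bsub>V\<^esub>\<close> u by (simp add: rho_gen rho_add rho_mult rho_kernel linD(3)[OF lin_rho])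
  qed
  have ker: "f \<in> J" if "\<Psi> f = \<zero>\<^bsub>V\<^esub>" for f using J(2) that by (rule subsetD[OF _ CollectI])
  have q1: "presents (\<lambda>f. \<Psi> ` J +>\<^bsub>V\<^esub> \<Psi> f) (quot_module V (\<Psi> ` J))"
    by (rule presents_quot(1)[OF presents_V J(1) ker])
  have q2: "\<Psi> ` J +>\<^bsub>V\<^esub> \<Psi> f = \<zero>\<^bsub>quot_module V (\<Psi> ` J)\<^esub> \<longleftrightarrow> f \<in> J" for f
    by (rule presents_quot(2)[OF presents_V J(1) ker])
  have "irreducible_module R (quot_module V (\<Psi> ` J))"
  proof (rule presents_irreducible[OF q1])
    show "\<Psi> ` J +>\<^bsub>V\<^esub> \<Psi> 1 \<noteq> \<zero>\<^bsub>quot_module V (\<Psi> ` J)\<^esub>" by (rule contrapos_nn[OF \<open>1 \<notin> J\<close> iffD1[OF q2]])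
    fix N :: "'g falg set"
    assume N: "left_ideal N" "{f. \<Psi> ` J +>\<^bsub>V\<^esub> \<Psi> f = \<zero>\<^bsub>quot_module V (\<Psi> ` J)\<^esub>} \<subset> N"
    have "J \<subset> N" using N(2) by (simp only: q2 Collect_mem_eq)
    show "1 \<in> N"
    proof (rule max[OF J(1) _ _ J(3) N(1) \<open>J \<subset> N\<close>])
      show "I \<subseteq> J" by (rule subsetI) (rule ker[OF \<Psi>_relations(1)])
      show "gen x - scal (\<xi> x) \<in> J" if "x \<in> P" for x by (rule ker[OF \<Psi>_relations(2)[OF that]])
    qed
  qed
  then show ?thesis unfolding vac_eq cyclic_eq J_def .
qed

end

section \<open>The affine Nappi-Witten algebra\<close>

lemma h4_bracket_components:
  "h4_bracket x y $ IA = x $ ID * y $ IA - x $ IA * y $ ID"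
  "h4_bracket x y $ IB = x $ IB * y $ ID - x $ ID * y $ IB"
  "h4_bracket x y $ IC = x $ IA * y $ IB - x $ IB * y $ IA"
  "h4_bracket x y $ ID = 0"
  by (simp_all add: h4_bracket_def UNIV_h4_ix axis_def)

lemma h4_form_eq: "h4_form x y = x $ IA * y $ IB + x $ IB * y $ IA + x $ IC * y $ ID + x $ ID * y $ IC"
  by (simp add: h4_form_def UNIV_h4_ix)

lemma h4_eq_iff: "(x :: h4) = y \<longleftrightarrow> x $ IA = y $ IA \<and> x $ IB = y $ IB \<and> x $ IC = y $ IC \<and> x $ ID = y $ ID"
  by (metis (full_types) h4_ix.exhaust vec_eq_iff)

lemma h4_basis [simp]:
  "axis i (1::complex) $ j = (if i = j then 1 else 0)" for i j :: h4_ix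
  by (simp add: axis_def)

lemma fst_nw_bracket: "fst (nw_bracket X Y) = (\<Sum>p\<in>Poly_Mapping.keys (fst X). \<Sum>q\<in>Poly_Mapping.keys (fst Y).
    Poly_Mapping.single (p + q) (h4_bracket (Poly_Mapping.lookup (fst X) p) (Poly_Mapping.lookup (fst Y) q)))"
  by (simp add: nw_bracket_def fst_sum Let_def)

lemma snd_nw_bracket: "snd (nw_bracket X Y) = (\<Sum>p\<in>Poly_Mapping.keys (fst X). \<Sum>q\<in>Poly_Mapping.keys (fst Y).
    if p + q = 0 then of_int p * h4_form (Poly_Mapping.lookup (fst X) p) (Poly_Mapping.lookup (fst Y) q) else 0)"
  by (simp add: nw_bracket_def snd_sum Let_def)

lemma lookup_nw_bracket: "Poly_Mapping.lookup (fst (nw_bracket X Y)) r =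
    (\<Sum>p\<in>Poly_Mapping.keys (fst X). \<Sum>q\<in>Poly_Mapping.keys (fst Y).
      if p + q = r then h4_bracket (Poly_Mapping.lookup (fst X) p) (Poly_Mapping.lookup (fst Y) q) else 0)"
  by (simp add: fst_nw_bracket lookup_sum lookup_single when_def)

lemma lookup_nw_bracket_nonzero:
  assumes "Poly_Mapping.lookup (fst (nw_bracket X Y)) r $ i \<noteq> 0"
  obtains p q where "p + q = r"
    "h4_bracket (Poly_Mapping.lookup (fst X) p) (Poly_Mapping.lookup (fst Y) q) $ i \<noteq> 0"
proof -
  have "(\<Sum>p\<in>Poly_Mapping.keys (fst X). \<Sum>q\<in>Poly_Mapping.keys (fst Y).
      (if p + q = r then h4_bracket (Poly_Mapping.lookup (fst X) p) (Poly_Mapping.lookup (fst Y) q) else 0) $ i) \<noteq> 0"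
    using assms unfolding lookup_nw_bracket by (simp add: sum_component)
  then obtain p where "(\<Sum>q\<in>Poly_Mapping.keys (fst Y).
      (if p + q = r then h4_bracket (Poly_Mapping.lookup (fst X) p) (Poly_Mapping.lookup (fst Y) q) else 0) $ i) \<noteq> 0"
    by (meson sum.not_neutral_contains_not_neutral)
  then obtain q where "(if p + q = r then h4_bracket (Poly_Mapping.lookup (fst X) p) (Poly_Mapping.lookup (fst Y) q) else 0) $ i \<noteq> 0"
    by (meson sum.not_neutral_contains_not_neutral)
  then show thesis using that by (auto split: if_splits)
qed

lemma lookup_nw_scale: "Poly_Mapping.lookup (fst (nw_scale s X)) p = s *s Poly_Mapping.lookup (fst X) p"
  by (simp add: nw_scale_def Poly_Mapping.map.rep_eq when_def)

lemma nw_sub_iff: "X \<in> nw_sub m \<longleftrightarrow> (\<forall>p.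
    (Poly_Mapping.lookup (fst X) p $ IA \<noteq> 0 \<longrightarrow> p \<ge> - m) \<and>
    (Poly_Mapping.lookup (fst X) p $ IB \<noteq> 0 \<longrightarrow> p \<ge> m + 1) \<and>
    (Poly_Mapping.lookup (fst X) p $ IC \<noteq> 0 \<longrightarrow> p \<ge> 0) \<and>
    (Poly_Mapping.lookup (fst X) p $ ID \<noteq> 0 \<longrightarrow> p \<ge> 0))"
  by (simp add: nw_sub_def)

text \<open>Modes of a start at - m and those of b at m + 1, so their brackets reach c(r) only for r
  \<ge> 1 and have no central term. The modes of c and d pair only at p = q = 0, where the factor p
  is 0.\<close>

lemma nw_bracket_sub:
  assumes X: "X \<in> nw_sub m" and Y: "Y \<in> nw_sub m"
  shows "nw_bracket X Y \<in> nw_sub m"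
    and "Poly_Mapping.lookup (fst (nw_bracket X Y)) r $ IC \<noteq> 0 \<Longrightarrow> r \<ge> 1"
    and "Poly_Mapping.lookup (fst (nw_bracket X Y)) r $ ID = 0"
    and "snd (nw_bracket X Y) = 0"
proof -
  let ?x = "Poly_Mapping.lookup (fst X)" and ?y = "Poly_Mapping.lookup (fst Y)"
  have x: "?x p $ IA \<noteq> 0 \<Longrightarrow> p \<ge> - m" "?x p $ IB \<noteq> 0 \<Longrightarrow> p \<ge> m + 1" "?x p $ IC \<noteq> 0 \<Longrightarrow> p \<ge> 0" "?x p $ ID \<noteq> 0 \<Longrightarrow> p \<ge> 0"
    and y: "?y p $ IA \<noteq> 0 \<Longrightarrow> p \<ge> - m" "?y p $ IB \<noteq> 0 \<Longrightarrow> p \<ge> m + 1" "?y p $ IC \<noteq> 0 \<Longrightarrow> p \<ge> 0" "?y p $ ID \<noteq> 0 \<Longrightarrow> p \<ge> 0"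
    for p using X Y unfolding nw_sub_iff by blast+
  have A: "r \<ge> - m" if nz: "Poly_Mapping.lookup (fst (nw_bracket X Y)) r $ IA \<noteq> 0" for r
  proof -
    obtain p q where pq: "p + q = r" "h4_bracket (?x p) (?y q) $ IA \<noteq> 0" using nz by (rule lookup_nw_bracket_nonzero)
    then have "?x p $ ID \<noteq> 0 \<and> ?y q $ IA \<noteq> 0 \<or> ?x p $ IA \<noteq> 0 \<and> ?y q $ ID \<noteq> 0" by (auto simp: h4_bracket_components)
    then show ?thesis using x(1,4)[of p] y(1,4)[of q] pq(1) by auto
  qed
  have B: "r \<ge> m + 1" if nz: "Poly_Mapping.lookup (fst (nw_bracket X Y)) r $ IB \<noteq> 0" for r
  proof -
    obtain p q where pq: "p + q = r" "h4_bracket (?x p) (?y q) $ IB \<noteq> 0" using nz by (rule lookup_nw_bracket_nonzero)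
    then have "?x p $ ID \<noteq> 0 \<and> ?y q $ IB \<noteq> 0 \<or> ?x p $ IB \<noteq> 0 \<and> ?y q $ ID \<noteq> 0" by (auto simp: h4_bracket_components)
    then show ?thesis using x(2,4)[of p] y(2,4)[of q] pq(1) by auto
  qed
  show C: "r \<ge> 1" if nz: "Poly_Mapping.lookup (fst (nw_bracket X Y)) r $ IC \<noteq> 0" for r
  proof -
    obtain p q where pq: "p + q = r" "h4_bracket (?x p) (?y q) $ IC \<noteq> 0" using nz by (rule lookup_nw_bracket_nonzero)
    then have "?x p $ IA \<noteq> 0 \<and> ?y q $ IB \<noteq> 0 \<or> ?x p $ IB \<noteq> 0 \<and> ?y q $ IA \<noteq> 0" by (auto simp: h4_bracket_components)
    then show ?thesis using x(1,2)[of p] y(1,2)[of q] pq(1) by auto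
  qed
  show D: "Poly_Mapping.lookup (fst (nw_bracket X Y)) r $ ID = 0" for r
    by (rule ccontr) (auto elim: lookup_nw_bracket_nonzero simp: h4_bracket_components)
  show "nw_bracket X Y \<in> nw_sub m"
    unfolding nw_sub_iff using A B D by (fastforce dest: C)
  show "snd (nw_bracket X Y) = 0"
    unfolding snd_nw_bracket
  proof (intro sum.neutral ballI)
    fix p q
    have "of_int p * h4_form (?x p) (?y q) = 0" if pq: "p + q = 0"
    proof -
      have "?x p $ IA * ?y q $ IB = 0" "?x p $ IB * ?y q $ IA = 0"
        using x(1,2)[of p] y(1,2)[of q] pq by (rule_tac [!] ccontr) auto
      moreover have "of_int p * (?x p $ IC * ?y q $ ID) = 0" "of_int p * (?x p $ ID * ?y q $ IC) = 0"
        using x(3,4)[of p] y(3,4)[of q] pq by (cases "p = 0"; auto)+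
      ultimately show ?thesis by (auto simp: h4_form_eq distrib_left)
    qed
    then show "(if p + q = 0 then of_int p * h4_form (?x p) (?y q) else 0) = 0" by simp
  qed
qed

lemma character_nw:
  assumes "\<alpha> = dd *s hC + cc *s hD"
  shows "character nw_scale nw_bracket (nw_sub m) (nw_char \<alpha>)"
proof
  have \<alpha>: "\<alpha> $ IA = 0" "\<alpha> $ IB = 0" by (simp_all add: assms)
  fix x y s assume x: "x \<in> nw_sub m"
  show "nw_scale s x \<in> nw_sub m" using x by (simp add: nw_sub_iff lookup_nw_scale)
  show "nw_char \<alpha> (nw_scale s x) = s * nw_char \<alpha> x"
    by (simp add: nw_char_def h4_form_eq lookup_nw_scale) (simp add: nw_scale_def algebra_simps)
  assume y: "y \<in> nw_sub m"
  show "x + y \<in> nw_sub m" 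
    using x y unfolding nw_sub_iff by (simp add: lookup_add) (metis add_0)
  show "nw_char \<alpha> (x + y) = nw_char \<alpha> x + nw_char \<alpha> y"
    by (simp add: nw_char_def h4_form_eq lookup_add algebra_simps)
  show "nw_bracket x y \<in> nw_sub m" by (rule nw_bracket_sub[OF x y])
  show "nw_char \<alpha> (nw_bracket x y) = 0"
    using nw_bracket_sub(2,3)[OF x y, of 0] nw_bracket_sub(4)[OF x y] by (auto simp: nw_char_def h4_form_eq \<alpha>)
qed

section \<open>Level one representations on the Fock space\<close>

locale fock_h4 =
  fixes a b c d :: "int \<Rightarrow> fock \<Rightarrow> fock"
  assumes lin_ops: "lin (a p)" "lin (b p)" "lin (c p)" "lin (d p)"
    and commute: "a p (a q f) = a q (a p f)" "b p (b q f) = b q (b p f)" "c p (c q f) = c q (c p f)"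
      "d p (d q f) = d q (d p f)" "c p (a q f) = a q (c p f)" "c p (b q f) = b q (c p f)"
    and ab: "a p (b q f) = b q (a p f) + c (p + q) f + cst (if p + q = 0 then of_int p else 0) * f"
    and da: "d p (a q f) = a q (d p f) + a (p + q) f"
    and db: "d p (b q f) = b q (d p f) - b (p + q) f"
    and cd: "c p (d q f) = d q (c p f) + cst (if p + q = 0 then of_int p else 0) * f"
begin

definition mode :: "h4 \<Rightarrow> int \<Rightarrow> fock \<Rightarrow> fock"
  where "mode x p f = cst (x $ IA) * a p f + cst (x $ IB) * b p f + cst (x $ IC) * c p f + cst (x $ ID) * d p f"

definition act :: "nw \<Rightarrow> fock \<Rightarrow> fock"
  where "act X f = (\<Sum>p\<in>Poly_Mapping.keys (fst X). mode (Poly_Mapping.lookup (fst X) p) p f) + cst (snd X) * f"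

lemma mode_add: "mode (x + y) p f = mode x p f + mode y p f" "mode 0 p f = 0"
  by (simp_all add: mode_def cst_simps algebra_simps)

lemma mode_scale: "mode (s *s x) p f = cst s * mode x p f"
  by (simp add: mode_def cst_simps(2) distrib_left mult.assoc)

lemma lin_mode: "lin (mode x p)"
  by (simp add: lin_def mode_def linD[OF lin_ops(1)] linD[OF lin_ops(2)] linD[OF lin_ops(3)] linD[OF lin_ops(4)]
      distrib_left mult.left_commute add.assoc add.left_commute)

lemma lin_act: "lin (act X)"
  by (simp add: lin_def act_def linD[OF lin_mode] sum.distrib sum_distrib_left distrib_left mult.left_commute
      add.assoc add.left_commute)

lemma act_add: "act (X + Y) f = act X f + act Y f"
proof -
  have "(\<Sum>p\<in>Poly_Mapping.keys (fst X + fst Y). mode (Poly_Mapping.lookup (fst X + fst Y) p) p f) =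
      (\<Sum>p\<in>Poly_Mapping.keys (fst X). mode (Poly_Mapping.lookup (fst X) p) p f) +
      (\<Sum>p\<in>Poly_Mapping.keys (fst Y). mode (Poly_Mapping.lookup (fst Y) p) p f)"
    by (rule setsum_keys_plus_distrib[of "\<lambda>p x. mode x p f"]) (simp_all add: mode_add)
  then show ?thesis by (simp add: act_def cst_simps algebra_simps)
qed

lemma act_0: "act 0 f = 0" by (simp add: act_def)

lemma act_superset: "finite S \<Longrightarrow> Poly_Mapping.keys (fst X) \<subseteq> S \<Longrightarrow>
    act X f = (\<Sum>p\<in>S. mode (Poly_Mapping.lookup (fst X) p) p f) + cst (snd X) * f"
  unfolding act_def by (subst sum.mono_neutral_left[of S]) (auto simp: in_keys_iff mode_add)

lemma act_scale: "act (nw_scale s X) f = cst s * act X f"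
proof -
  have "Poly_Mapping.keys (fst (nw_scale s X)) \<subseteq> Poly_Mapping.keys (fst X)"
    by (auto simp: in_keys_iff lookup_nw_scale)
  then have "act (nw_scale s X) f = (\<Sum>p\<in>Poly_Mapping.keys (fst X). mode (s *s Poly_Mapping.lookup (fst X) p) p f) + cst (s * snd X) * f"
    by (subst act_superset[of "Poly_Mapping.keys (fst X)"]) (auto simp: lookup_nw_scale, simp add: nw_scale_def)
  then show ?thesis by (simp add: act_def mode_scale sum_distrib_left distrib_left cst_simps(2) mult.assoc)
qed

lemma act_single: "act (Poly_Mapping.single p x, \<kappa>) f = mode x p f + cst \<kappa> * f"
  by (cases "x = 0") (simp_all add: act_def mode_add)

lemma act_sum: "act (sum g A) f = (\<Sum>i\<in>A. act (g i) f)"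
  by (induction A rule: infinite_finite_induct) (simp_all add: act_0 act_add)

lemma mode_commutator: "mode x p (mode y q f) - mode y q (mode x p f) =
    mode (h4_bracket x y) (p + q) f + cst (if p + q = 0 then of_int p * h4_form x y else 0) * f"
proof -
  note l = linD(1,2)[OF lin_ops(1)] linD(1,2)[OF lin_ops(2)] linD(1,2)[OF lin_ops(3)] linD(1,2)[OF lin_ops(4)]
  note r = commute(1)[of p q] commute(2)[of p q] commute(3)[of p q] commute(4)[of p q] commute(5,6) ab da db cd
  show ?thesis
  proof (cases "p + q = 0")
    case True
    then have q: "q = - p" by simp
    show ?thesis
      unfolding q mode_def l r[unfolded q]
      by (simp add: h4_bracket_components h4_form_eq cst_simps distrib_left distrib_right right_diff_distrib
          left_diff_distrib ac_simps del: single_of_int)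
  next
    case False
    then have "q + p \<noteq> 0" by simp
    with False show ?thesis
      unfolding mode_def l r
      by (simp add: h4_bracket_components cst_simps distrib_left distrib_right right_diff_distrib
          left_diff_distrib ac_simps)
  qed
qed

lemma act_bracket: "act (nw_bracket X Y) f = act X (act Y f) - act Y (act X f)"
proof -
  let ?x = "Poly_Mapping.lookup (fst X)" and ?y = "Poly_Mapping.lookup (fst Y)"
  let ?K = "Poly_Mapping.keys (fst X)" and ?L = "Poly_Mapping.keys (fst Y)"
  have "act (nw_bracket X Y) f = (\<Sum>p\<in>?K. \<Sum>q\<in>?L. mode (?x p) p (mode (?y q) q f) - mode (?y q) q (mode (?x p) p f))"
    by (simp add: nw_bracket_def act_sum Let_def act_single mode_commutator)
  also have "\<dots> = (\<Sum>p\<in>?K. mode (?x p) p (\<Sum>q\<in>?L. mode (?y q) q f)) - (\<Sum>q\<in>?L. mode (?y q) q (\<Sum>p\<in>?K. mode (?x p) p f))"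
    by (simp add: sum_subtractf lin_sum[OF lin_mode] sum.swap[of _ ?K ?L])
  finally show ?thesis
    by (simp add: act_def linD(1,2)[OF lin_mode] sum.distrib sum_distrib_left distrib_left mult.left_commute)
qed

lemma fock_character:
  assumes \<alpha>: "\<alpha> = dd *s hC + cc *s hD"
    and vac: "\<And>p. p \<ge> - m \<Longrightarrow> a p 1 = 0" "\<And>p. p \<ge> m + 1 \<Longrightarrow> b p 1 = 0"
      "\<And>p. p \<ge> 1 \<Longrightarrow> c p 1 = 0" "\<And>p. p \<ge> 1 \<Longrightarrow> d p 1 = 0" "c 0 1 = cst cc" "d 0 1 = cst dd"
  shows "fock_character nw_scale nw_bracket (nw_sub m) (nw_char \<alpha>) act"
proof (intro fock_character.intro fock_character_axioms.intro character_nw[OF \<alpha>])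
  fix X assume X: "X \<in> nw_sub m"
  let ?x = "Poly_Mapping.lookup (fst X)"
  have mode: "mode (?x p) p 1 = (if p = 0 then cst (h4_form \<alpha> (?x 0)) else 0)" for p
  proof -
    have x: "?x p $ IA \<noteq> 0 \<Longrightarrow> p \<ge> - m" "?x p $ IB \<noteq> 0 \<Longrightarrow> p \<ge> m + 1" "?x p $ IC \<noteq> 0 \<Longrightarrow> p \<ge> 0" "?x p $ ID \<noteq> 0 \<Longrightarrow> p \<ge> 0"
      using X unfolding nw_sub_iff by blast+
    have A: "cst (?x p $ IA) * a p 1 = 0" using x(1) vac(1)[of p] by (cases "?x p $ IA = 0") auto
    have B: "cst (?x p $ IB) * b p 1 = 0" using x(2) vac(2)[of p] by (cases "?x p $ IB = 0") auto
    have C: "cst (?x p $ IC) * c p 1 = (if p = 0 then cst (?x 0 $ IC * cc) else 0)"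
      using x(3) vac(3)[of p] vac(5) by (cases "?x p $ IC = 0"; cases "p = 0") (auto simp: mult_single)
    have D: "cst (?x p $ ID) * d p 1 = (if p = 0 then cst (?x 0 $ ID * dd) else 0)"
      using x(4) vac(4)[of p] vac(6) by (cases "?x p $ ID = 0"; cases "p = 0") (auto simp: mult_single)
    show ?thesis
      unfolding mode_def A B C D by (simp add: h4_form_eq \<alpha> single_add[symmetric] algebra_simps)
  qed
  \<comment> \<open>The index 0 is adjoined because \<open>nw_char\<close> reads off the coefficient
    at mode 0, be it a key or not.\<close>
  have "act X 1 = (\<Sum>p\<in>insert 0 (Poly_Mapping.keys (fst X)). mode (?x p) p 1) + cst (snd X) * 1"
    by (rule act_superset) auto
  then show "act X 1 = cst (nw_char \<alpha> X)" by (simp add: mode nw_char_def single_add)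
qed (simp_all add: lin_act act_add act_scale act_bracket)

end

section \<open>Left ideals containing the vacuum relations\<close>

lemma (in scalars) linsub_sum: "linsub M \<Longrightarrow> (\<And>i. i \<in> A \<Longrightarrow> g i \<in> M) \<Longrightarrow> sum g A \<in> M"
  by (induction A rule: infinite_finite_induct) (auto intro: linsubD)

text \<open>Only the index \<open>({#}, n)\<close> has p = n, so the singular relation can be solved
  for \<open>B (- n)\<close>. The other terms are a creator of \<open>V3\<close> on the vacuum,
  followed by \<open>X \<rho>\<close>, which stands for c(-\<rho>).\<close>

lemma (in affine_system) redundant_mode:
  assumes sum: "(\<Sum>(\<rho>, p)\<in>index_pairs n. sc (\<beta> \<rho> p) * (X \<rho> * B (- int p))) \<in> J"
    and X: "X {#} = 1" "\<And>\<rho> w. w \<in> V3 \<Longrightarrow> X \<rho> * w \<in> V3" and \<beta>: "\<beta> {#} n \<noteq> 0"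
  shows "B (- int n) \<in> V3"
proof -
  let ?g = "\<lambda>(\<rho>, p). sc (\<beta> \<rho> p) * (X \<rho> * B (- int p))"
  note l = linsubD[OF linsub_V(4)]
  have "?g z \<in> V3" if z: "z \<in> index_pairs n - {({#}, n)}" for z
  proof -
    obtain \<rho> p where \<rho>: "z = (\<rho>, p)" "0 \<notin># \<rho>" "sum_mset \<rho> + p = n" "(\<rho>, p) \<noteq> ({#}, n)"
      using z by (auto simp: index_pairs_def)
    have "p \<noteq> n"
    proof
      assume "p = n"
      then have "sum_mset \<rho> = 0" using \<rho>(3) by simp
      then have "\<rho> = {#}" using \<rho>(2) by (cases \<rho>) auto
      then show False using \<rho>(4) \<open>p = n\<close> by simp
    qed
    then have "B (- int p) * 1 \<in> V3" using V_op(3) one_V0 V_subset by blast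
    then show ?thesis using X(2) l(3) \<rho>(1) by simp
  qed
  then have rest: "sum ?g (index_pairs n - {({#}, n)}) \<in> V3" by (rule linsub_sum[OF linsub_V(4)])
  have "({#}, n) \<in> index_pairs n" by (simp add: index_pairs_def)
  then have "sum ?g (index_pairs n) = sc (\<beta> {#} n) * B (- int n) + sum ?g (index_pairs n - {({#}, n)})"
    using finite_index_pairs X(1) by (simp add: sum.remove)
  then have "sc (\<beta> {#} n) * B (- int n) \<in> V3"
    using l(5)[OF subsetD[OF J_subset(3) sum] rest] by simp
  then have "sc (1 / \<beta> {#} n) * (sc (\<beta> {#} n) * B (- int n)) \<in> V3" by (rule l(3))
  then show ?thesis using \<beta> by (simp add: mult.assoc[symmetric] sc_mult[symmetric])
qed

section \<open>The affine relations modulo a left ideal of the free algebra\<close>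

lemma scalars_scal: "scalars (scal :: complex \<Rightarrow> 'g falg)"
proof
  fix s t :: complex and f :: "'g falg"
  show "scal (s + t) = (scal s + scal t :: 'g falg)" by (simp add: scal_def single_add)
  show "scal (s * t) = (scal s * scal t :: 'g falg)" by (simp add: scal_def mult_single)
  show "scal 1 = (1 :: 'g falg)" by (simp add: scal_def)
  show "scal s * f = f * scal s"
    by (induction f rule: poly_mapping_single_induct) (simp_all add: scal_def mult_single algebra_simps)
qed

lemma falg_induct [case_names one add scale gen]:
  fixes f :: "'g falg"
  assumes "Q 1" "\<And>f g. Q f \<Longrightarrow> Q g \<Longrightarrow> Q (f + g)" "\<And>s f. Q f \<Longrightarrow> Q (scal s * f)" "\<And>x f. Q f \<Longrightarrow> Q (gen x * f)"
  shows "Q f"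
proof -
  have word: "Q (Poly_Mapping.single (Mon ws) 1)" for ws
  proof (induction ws)
    case Nil
    then show ?case using assms(1) by (simp flip: zero_mon_def)
  next
    case (Cons x ws)
    have "Poly_Mapping.single (Mon (x # ws)) 1 = gen x * Poly_Mapping.single (Mon ws) (1 :: complex)"
      by (simp add: gen_def mult_single plus_mon_def)
    then show ?case using assms(4)[OF Cons] by simp
  qed
  show ?thesis
  proof (induction f rule: poly_mapping_single_induct)
    case zero
    then show ?case using assms(3)[OF assms(1), of 0] by (simp add: scal_def)
  next
    case (single w s)
    show ?case using assms(3)[OF word[of "letters w"], of s] by (simp add: scal_def mult_single)
  qed (rule assms(2))
qed

lemma nw_elt_linear: "nw_elt (u + v) p = nw_elt u p + nw_elt v p" "nw_elt (s *s u) p = nw_scale s (nw_elt u p)"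
  "nw_elt 0 p = 0"
  by (simp_all add: nw_elt_def single_add nw_scale_def zero_prod_def)

lemma nw_scale_central: "nw_scale s (0, \<kappa>) = (0, s * \<kappa>)"
proof -
  have "Poly_Mapping.map ((*s) s) (0 :: int \<Rightarrow>\<^sub>0 h4) = 0"
    by (intro poly_mapping_eqI) (simp add: Poly_Mapping.map.rep_eq)
  then show ?thesis by (simp add: nw_scale_def)
qed

lemma nw_bracket_elt: "nw_bracket (nw_elt u p) (nw_elt v q) =
    nw_elt (h4_bracket u v) (p + q) + nw_scale (if p + q = 0 then of_int p * h4_form u v else 0) (0, 1)"
proof -
  have "h4_bracket 0 v = 0" "h4_bracket u 0 = 0" "h4_form 0 v = 0" "h4_form u 0 = 0"
    by (simp_all add: h4_eq_iff h4_bracket_components h4_form_eq)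
  then show ?thesis
    by (cases "u = 0"; cases "v = 0") (simp_all add: nw_scale_central nw_bracket_def nw_elt_def zero_prod_def)
qed

lemma nw_bracket_central: "nw_bracket (0, \<kappa>) Y = 0" "nw_bracket (nw_elt hC 0) Y = 0"
proof -
  show "nw_bracket (0, \<kappa>) Y = 0" by (simp add: nw_bracket_def)
  have C: "h4_bracket hC v = 0" "h4_bracket 0 v = 0" "h4_form 0 v = 0" for v
    by (simp_all add: h4_eq_iff h4_bracket_components h4_form_eq)
  show "nw_bracket (nw_elt hC 0) Y = 0"
  proof (rule prod_eqI)
    show "fst (nw_bracket (nw_elt hC 0) Y) = fst 0"
      unfolding fst_nw_bracket fst_zero
      by (intro sum.neutral ballI) (simp add: nw_elt_def lookup_single when_def C)
    show "snd (nw_bracket (nw_elt hC 0) Y) = snd 0"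
      unfolding snd_nw_bracket snd_zero
      by (intro sum.neutral ballI) (simp add: nw_elt_def lookup_single when_def C)
  qed
qed

lemma h4_brackets:
  "h4_bracket hA hB = hC" "h4_bracket hD hA = hA" "h4_bracket hD hB = (- 1) *s hB"
  "h4_bracket hA hA = 0" "h4_bracket hB hB = 0" "h4_bracket hD hD = 0" "h4_bracket hC v = 0"
  by (simp_all add: h4_eq_iff h4_bracket_components)

lemma h4_forms:
  "h4_form hA hB = 1" "h4_form hD hA = 0" "h4_form hD hB = 0" "h4_form hA hA = 0" "h4_form hB hB = 0"
  "h4_form hD hD = 0" "h4_form hC hA = 0" "h4_form hC hB = 0" "h4_form hC hC = 0" "h4_form hC hD = 1"
  by (simp_all add: h4_form_eq)

locale vacuum_ideal = scalars "scal :: complex \<Rightarrow> nw falg"  +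
  fixes J :: "nw falg set" and m :: int and cc dd :: complex and \<alpha> :: h4
  assumes J: "left_ideal J" and env: "env_ideal UNIV nw_scale nw_bracket \<subseteq> J"
    and sub: "x \<in> nw_sub m \<Longrightarrow> gen x - scal (nw_char \<alpha> x) \<in> J"
    and \<alpha>: "\<alpha> = dd *s hC + cc *s hD"
begin

abbreviation G :: "h4 \<Rightarrow> int \<Rightarrow> nw falg" where "G u p \<equiv> gen (nw_elt u p)"

lemma lJ: "linsub J" by (rule linsub_left_ideal[OF J])

lemma relators:
  "(gen (x + y) - gen x - gen y) * w \<in> J" "(gen (nw_scale s x) - scal s * gen x) * w \<in> J"
  "(gen x * gen y - gen y * gen x - gen (nw_bracket x y)) * w \<in> J"
proof -
  have rel: "r * w \<in> J" if "r \<in> env_relators UNIV nw_scale nw_bracket" for r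
    using env_ideal_UNIV(2,3) env that by blast
  show "(gen (x + y) - gen x - gen y) * w \<in> J" by (rule rel, unfold env_relators_def) blast
  show "(gen (nw_scale s x) - scal s * gen x) * w \<in> J" by (rule rel, unfold env_relators_def) blast
  show "(gen x * gen y - gen y * gen x - gen (nw_bracket x y)) * w \<in> J"
    by (rule rel, unfold env_relators_def) blast
qed

lemma gen_0: "gen 0 * w \<in> J"
  using left_idealD(4)[OF J relators(1)[of 0 0 w]] by simp

text \<open>The left ideal need not absorb \<open>w\<close> on the right. But \<open>gen z\<close>
  commutes with every generator modulo \<open>J\<close>, hence by induction with \<open>w\<close>,
  and then the assumed relation is multiplied from the left.\<close>

lemma central:
  assumes z: "\<And>y. nw_bracket z y = 0" and s: "gen z - scal s \<in> J"
  shows "(gen z - scal s) * w \<in> J"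
proof -
  have comm: "gen z * (gen y * w) - gen y * (gen z * w) \<in> J" for y w
    using left_idealD(2)[OF J relators(3)[of z y w] gen_0[of w]] by (simp add: z algebra_simps)
  have "gen z * w - w * gen z \<in> J"
  proof (induction w rule: falg_induct)
    case (add f g)
    then show ?case using left_idealD(2)[OF J] by (fastforce simp: algebra_simps)
  next
    case (scale t f)
    have "gen z * (scal t * f) - scal t * f * gen z = scal t * (gen z * f - f * gen z)"
      by (simp add: right_diff_distrib mult.assoc[symmetric] sc_central[of t "gen z"])
    then show ?case using scale left_idealD(3)[OF J] by simp
  next
    case (gen y f)
    have "gen z * (gen y * f) - gen y * f * gen z =
        (gen z * (gen y * f) - gen y * (gen z * f)) + gen y * (gen z * f - f * gen z)"
      by (simp add: algebra_simps)
    then show ?case using left_idealD(2)[OF J comm[of y f] left_idealD(3)[OF J gen, of "gen y"]] by (simp only:)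
  qed (simp add: left_idealD(1)[OF J])
  moreover have "(gen z - scal s) * w = (gen z * w - w * gen z) + w * (gen z - scal s)"
    by (simp add: algebra_simps sc_central)
  ultimately show ?thesis using left_idealD(2,3)[OF J] s by metis
qed

lemma k_J: "(gen (0, 1) - 1) * w \<in> J"
proof -
  have "(0, 1) \<in> nw_sub m" by (simp add: nw_sub_def)
  then have "gen (0, 1) - scal 1 \<in> J" using sub[of "(0, 1)"] by (simp add: nw_char_def h4_form_eq)
  then show ?thesis using central[of "(0, 1)" 1 w] nw_bracket_central(1) by simp
qed

lemma comm_G: "comm_mod J (G u p) (G v q)
    (G (h4_bracket u v) (p + q) + scal (if p + q = 0 then of_int p * h4_form u v else 0))"
  unfolding comm_mod_def
proof
  fix w
  define \<kappa> where "\<kappa> = (if p + q = 0 then of_int p * h4_form u v else 0)"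
  let ?e = "nw_elt (h4_bracket u v) (p + q)"
  \<comment> \<open>The difference telescopes through four relations: the bracket, additivity,
    homogeneity, and the central element acting as 1.\<close>
  have "(G u p * G v q - G v q * G u p - (gen ?e + scal \<kappa>)) * w =
      (G u p * G v q - G v q * G u p - gen (nw_bracket (nw_elt u p) (nw_elt v q))) * w +
      (gen (?e + nw_scale \<kappa> (0, 1)) - gen ?e - gen (nw_scale \<kappa> (0, 1))) * w +
      (gen (nw_scale \<kappa> (0, 1)) - scal \<kappa> * gen (0, 1)) * w + scal \<kappa> * ((gen (0, 1) - 1) * w)"
    unfolding nw_bracket_elt \<kappa>_def[symmetric] by (simp add: algebra_simps)
  also have "\<dots> \<in> J" by (intro left_idealD(2)[OF J] left_idealD(3)[OF J] relators k_J)
  finally show "(G u p * G v q - G v q * G u p - (gen ?e + scal \<kappa>)) * w \<in> J" .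
qed

lemma comm_modes:
  "comm_mod J (G hA p) (G hA q) 0" "comm_mod J (G hB p) (G hB q) 0" "comm_mod J (G hC p) (G hC q) 0"
  "comm_mod J (G hD p) (G hD q) 0" "comm_mod J (G hC p) (G hA q) 0" "comm_mod J (G hC p) (G hB q) 0"
  "comm_mod J (G hA p) (G hB q) (G hC (p + q) + scal (if p + q = 0 then of_int p else 0))"
  "comm_mod J (G hD p) (G hA q) (G hA (p + q))" "comm_mod J (G hD p) (G hB q) (- G hB (p + q))"
  "comm_mod J (G hC p) (G hD q) (scal (if p + q = 0 then of_int p else 0))"
proof -
  have neg: "(gen (nw_scale (- 1) x) - - gen x) * w \<in> J" for x w
    using relators(2)[of "- 1" x w] by (simp add: sc_minus)
  have "comm_mod J (G u p) (G v q) 0" if "h4_bracket u v = 0" "h4_form u v = 0" for u v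
    using comm_mod_cong[OF lJ comm_G[of u p v q], of 0] gen_0 that by (simp add: nw_elt_linear cong: if_cong)
  then show "comm_mod J (G hA p) (G hA q) 0" "comm_mod J (G hB p) (G hB q) 0" "comm_mod J (G hC p) (G hC q) 0"
    "comm_mod J (G hD p) (G hD q) 0" "comm_mod J (G hC p) (G hA q) 0" "comm_mod J (G hC p) (G hB q) 0"
    by (simp_all add: h4_brackets h4_forms)
  show "comm_mod J (G hA p) (G hB q) (G hC (p + q) + scal (if p + q = 0 then of_int p else 0))"
    using comm_G[of hA p hB q] by (simp add: h4_brackets h4_forms cong: if_cong)
  show "comm_mod J (G hD p) (G hA q) (G hA (p + q))"
    using comm_G[of hD p hA q] by (simp add: h4_brackets h4_forms cong: if_cong)
  show "comm_mod J (G hD p) (G hB q) (- G hB (p + q))"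
    using comm_mod_cong[OF lJ comm_G[of hD p hB q], of "- G hB (p + q)"] neg
    by (simp add: h4_brackets h4_forms nw_elt_linear cong: if_cong)
  show "comm_mod J (G hC p) (G hD q) (scal (if p + q = 0 then of_int p else 0))"
    using comm_mod_cong[OF lJ comm_G[of hC p hD q], of "scal (if p + q = 0 then of_int p else 0)"] gen_0
    by (simp add: h4_brackets h4_forms nw_elt_linear cong: if_cong)
qed

lemma vacuum:
  "p \<ge> - m \<Longrightarrow> G hA p \<in> J" "p \<ge> m + 1 \<Longrightarrow> G hB p \<in> J" "p \<ge> 1 \<Longrightarrow> G hC p \<in> J" "p \<ge> 1 \<Longrightarrow> G hD p \<in> J"
  "G hD 0 - scal dd \<in> J" "(G hC 0 - scal cc) * w \<in> J"
proof -
  have *: "G u p - scal (if p = 0 then h4_form \<alpha> u else 0) \<in> J" if "nw_elt u p \<in> nw_sub m" for u p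
    using sub[OF that] h4_form_eq[of \<alpha> 0]
    by (cases "p = 0") (simp_all add: nw_char_def nw_elt_def lookup_single when_def)
  have s: "nw_elt u p \<in> nw_sub m" if "(u $ IA \<noteq> 0 \<longrightarrow> p \<ge> - m) \<and> (u $ IB \<noteq> 0 \<longrightarrow> p \<ge> m + 1) \<and>
      (u $ IC \<noteq> 0 \<longrightarrow> p \<ge> 0) \<and> (u $ ID \<noteq> 0 \<longrightarrow> p \<ge> 0)" for u p
    using that by (auto simp: nw_sub_def nw_elt_def lookup_single when_def)
  have f: "h4_form \<alpha> hA = 0" "h4_form \<alpha> hB = 0" "h4_form \<alpha> hC = cc" "h4_form \<alpha> hD = dd"
    by (simp_all add: h4_form_eq \<alpha>)
  show "p \<ge> - m \<Longrightarrow> G hA p \<in> J" using *[of hA p] s[of hA p] by (simp add: f cong: if_cong)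
  show "p \<ge> m + 1 \<Longrightarrow> G hB p \<in> J" using *[of hB p] s[of hB p] by (simp add: f cong: if_cong)
  show "p \<ge> 1 \<Longrightarrow> G hC p \<in> J" using *[of hC p] s[of hC p] by simp
  show "p \<ge> 1 \<Longrightarrow> G hD p \<in> J" using *[of hD p] s[of hD p] by simp
  show "G hD 0 - scal dd \<in> J" using *[of hD 0] s[of hD 0] by (simp add: f)
  have "G hC 0 - scal cc \<in> J" using *[of hC 0] s[of hC 0] by (simp add: f)
  then show "(G hC 0 - scal cc) * w \<in> J" by (rule central[OF nw_bracket_central(2)])
qed

lemma generated:
  assumes M: "linsub M" "J \<subseteq> M" "1 \<in> M"
    and closed: "\<And>p x. x \<in> M \<Longrightarrow> G hA p * x \<in> M \<and> G hB p * x \<in> M \<and> G hC p * x \<in> M \<and> G hD p * x \<in> M"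
  shows "M = UNIV"
proof -
  note l = linsubD[OF M(1)]
  have rel: "gen (x + y) * w \<in> M" if "gen x * w \<in> M" "gen y * w \<in> M" for x y w
  proof -
    have "gen (x + y) * w = (gen (x + y) - gen x - gen y) * w + gen x * w + gen y * w" by (simp add: algebra_simps)
    then show ?thesis using l(2)[OF l(2)[OF subsetD[OF M(2) relators(1)[of x y w]] that(1)] that(2)] by (simp only:)
  qed
  have scale: "gen (nw_scale s x) * w \<in> M" if "gen x * w \<in> M" for s x w
  proof -
    have "gen (nw_scale s x) * w = (gen (nw_scale s x) - scal s * gen x) * w + scal s * (gen x * w)" by (simp add: algebra_simps)
    then show ?thesis using l(2)[OF subsetD[OF M(2) relators(2)[of s x w]] l(3)[OF that]] by (simp only:)
  qed
  have elt: "G u p * w \<in> M" if w: "w \<in> M" for u p w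
  proof -
    have "u = u $ IA *s hA + u $ IB *s hB + u $ IC *s hC + u $ ID *s hD"
      by (simp add: h4_eq_iff)
    then have "nw_elt u p = nw_elt (u $ IA *s hA + u $ IB *s hB + u $ IC *s hC + u $ ID *s hD) p"
      by (rule arg_cong)
    then have "nw_elt u p = nw_scale (u $ IA) (nw_elt hA p) + nw_scale (u $ IB) (nw_elt hB p) +
        nw_scale (u $ IC) (nw_elt hC p) + nw_scale (u $ ID) (nw_elt hD p)" by (simp only: nw_elt_linear(1,2))
    then show ?thesis using closed[OF w] by (simp add: rel scale)
  qed
  have "gen (f, 0) * w \<in> M" if w: "w \<in> M" for f w
  proof (induction f rule: poly_mapping_single_induct)
    case zero
    then show ?case using elt[OF w, of 0 0] by (simp add: nw_elt_def)
  next
    case (add f g)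
    then show ?case using rel[of "(f, 0)" w "(g, 0)"] by simp
  next
    case (single p u)
    then show ?case using elt[OF w, of u p] by (simp add: nw_elt_def)
  qed
  moreover have "gen (0, \<kappa>) * w \<in> M" if w: "w \<in> M" for \<kappa> w
  proof -
    have "gen (0, 1) * w = (gen (0, 1) - 1) * w + w" by (simp add: algebra_simps)
    then have "gen (0, 1) * w \<in> M" using l(2)[OF subsetD[OF M(2) k_J[of w]] w] by (simp only:)
    then show ?thesis using scale[of "(0, 1)" w \<kappa>] by (simp add: nw_scale_central)
  qed
  ultimately have gen: "gen x * w \<in> M" if "w \<in> M" for x w
    using rel[of "(fst x, 0)" w "(0, snd x)"] that by simp
  have "f \<in> M" for f
    by (induction f rule: falg_induct) (use M(3) l gen in auto)
  then show ?thesis by auto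
qed

lemma comm_mod_shift:
  "comm_mod J X Y Z \<Longrightarrow> comm_mod J (X + scal s) Y Z" "comm_mod J X Y Z \<Longrightarrow> comm_mod J X (Y + scal s) Z"
  "comm_mod J X Y Z \<Longrightarrow> comm_mod J (- X) Y (- Z)" "comm_mod J X Y Z \<Longrightarrow> comm_mod J X (- Y) (- Z)"
proof -
  show "comm_mod J X Y Z \<Longrightarrow> comm_mod J (X + scal s) Y Z"
    by (simp add: comm_mod_def distrib_left distrib_right sc_central[of s Y])
  show "comm_mod J X Y Z \<Longrightarrow> comm_mod J X (Y + scal s) Z"
    by (simp add: comm_mod_def distrib_left distrib_right sc_central[of s X])
  have *: "(- X * Y - Y * - X - - Z) * w = - ((X * Y - Y * X - Z) * w)"
    "(X * - Y - - Y * X - - Z) * w = - ((X * Y - Y * X - Z) * w)" for w by (simp_all add: algebra_simps)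
  show "comm_mod J X Y Z \<Longrightarrow> comm_mod J (- X) Y (- Z)" "comm_mod J X Y Z \<Longrightarrow> comm_mod J X (- Y) (- Z)"
    unfolding comm_mod_def * using left_idealD(4)[OF J] by blast+
qed

text \<open>Spectral flow by \<open>m\<close>. The bracket of a(p - m) with b(q + m) has central
  part p - m at p + q = 0; taking m off C 0 leaves the required p, and turns the eigenvalue of C 0
  into \<open>cc\<close> - m = - n.\<close>

lemma affine_system1:
  assumes "cc + of_nat n = of_int m"
  shows "affine_system scal (\<lambda>p. G hA (p - m)) (\<lambda>q. G hB (q + m))
    (\<lambda>k. G hC k + scal (if k = 0 then - of_int m else 0)) (G hD) J n dd"
proof (intro affine_system.intro affine_system_axioms.intro scalars_axioms)
  fix p q
  show "comm_mod J (G hA (p - m)) (G hB (q + m)) (G hC (p + q) +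
      scal (if p + q = 0 then - of_int m else 0) + scal (if p + q = 0 then of_int p else 0))"
    using comm_modes(7)[of "p - m" "q + m"]
    by (cases "p + q = 0") (simp_all add: add.assoc sc_add[symmetric])
  show "comm_mod J (G hD p) (G hA (q - m)) (G hA (p + q - m))"
    using comm_modes(8)[of p "q - m"] by (simp add: algebra_simps)
  show "comm_mod J (G hD p) (G hB (q + m)) (- G hB (p + q + m))"
    using comm_modes(9)[of p "q + m"] by (simp add: algebra_simps)
  fix w
  have "G hC 0 + scal (if (0::int) = 0 then - of_int m else 0) + scal (of_nat n) = G hC 0 - scal cc"
  proof -
    have "- of_int m + of_nat n = - cc" using assms by (simp add: algebra_simps)
    then show ?thesis by (simp add: add.assoc sc_add[symmetric] sc_minus[symmetric])
  qed
  then show "(G hC 0 + scal (if (0::int) = 0 then - of_int m else 0) + scal (of_nat n)) * w \<in> J"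
    using vacuum(6)[of w] by (simp only:)
next
  fix M
  assume M: "linsub M" "J \<subseteq> M" "1 \<in> M"
    and cl: "\<And>p x. x \<in> M \<Longrightarrow> G hA (p - m) * x \<in> M \<and> G hB (p + m) * x \<in> M \<and>
      (G hC p + scal (if p = 0 then - of_int m else 0)) * x \<in> M \<and> G hD p * x \<in> M"
  show "M = UNIV"
  proof (rule generated[OF M])
    fix p x assume x: "x \<in> M"
    have "G hC p * x = (G hC p + scal (if p = 0 then - of_int m else 0)) * x - scal (if p = 0 then - of_int m else 0) * x"
      by (simp add: algebra_simps)
    moreover have "(G hC p + scal (if p = 0 then - of_int m else 0)) * x \<in> M" using cl[OF x, of p] by blast
    ultimately have "G hC p * x \<in> M" using linsubD(5)[OF M(1) _ linsubD(3)[OF M(1) x]] by (simp only:)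
    then show "G hA p * x \<in> M \<and> G hB p * x \<in> M \<and> G hC p * x \<in> M \<and> G hD p * x \<in> M"
      using cl[OF x, of p] cl[OF x, of "p + m"] cl[OF x, of "p - m"] by simp
  qed
qed (use J comm_modes comm_mod_shift vacuum in auto)

text \<open>Now b plays the role of \<open>A\<close> and a that of \<open>B\<close>. The shift by m
  + 1 puts the annihilators b at p \<ge> 0 and the annihilators a at q \<ge> 1. The central part p +
  m + 1 is balanced by adding m + 1 to - c(0), whose eigenvalue becomes - \<open>cc\<close> + m + 1
  = - n.\<close>

lemma affine_system2:
  assumes "cc - of_nat (Suc n) = of_int m"
  shows "affine_system scal (\<lambda>p. G hB (p + m + 1)) (\<lambda>q. G hA (q - m - 1))
    (\<lambda>k. - G hC k + scal (if k = 0 then of_int (m + 1) else 0)) (\<lambda>k. - G hD k) J n (- dd)"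
proof (intro affine_system.intro affine_system_axioms.intro scalars_axioms)
  fix p q
  have "comm_mod J (G hB (p + m + 1)) (G hA (q - m - 1))
      (- (G hC (p + q) + scal (if p + q = 0 then of_int (q - m - 1) else 0)))"
    using comm_mod_sym[OF lJ comm_modes(7)[of "q - m - 1" "p + m + 1"]] by (simp add: algebra_simps cong: if_cong)
  moreover have "- (G hC (p + q) + scal (if p + q = 0 then of_int (q - m - 1) else 0)) =
      - G hC (p + q) + scal (if p + q = 0 then of_int (m + 1) else 0) + scal (if p + q = 0 then of_int p else 0)"
  proof (cases "p + q = 0")
    case True
    then have "q = - p" by simp
    have "- (of_int (q - m - 1) :: complex) = of_int (m + 1) + of_int p" using \<open>q = - p\<close> by simp
    then show ?thesis using True by (simp add: add.assoc sc_add[symmetric] sc_minus[symmetric] del: of_int_diff of_int_add)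
  qed simp
  ultimately show "comm_mod J (G hB (p + m + 1)) (G hA (q - m - 1))
      (- G hC (p + q) + scal (if p + q = 0 then of_int (m + 1) else 0) + scal (if p + q = 0 then of_int p else 0))"
    by (simp only:)
  show "comm_mod J (- G hD p) (G hB (q + m + 1)) (G hB (p + q + m + 1))"
    using comm_mod_shift(3)[OF comm_modes(9)[of p "q + m + 1"]] by (simp add: algebra_simps)
  show "comm_mod J (- G hD p) (G hA (q - m - 1)) (- G hA (p + q - m - 1))"
    using comm_mod_shift(3)[OF comm_modes(8)[of p "q - m - 1"]] by (simp add: algebra_simps)
  show "comm_mod J (- G hC p + scal (if p = 0 then of_int (m + 1) else 0)) (- G hD q)
      (scal (if p + q = 0 then of_int p else 0))"
    using comm_mod_shift(1)[OF comm_mod_shift(3)[OF comm_mod_shift(4)[OF comm_modes(10)[of p q]]]] by simp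
  show "comm_mod J (- G hC p + scal (if p = 0 then of_int (m + 1) else 0)) (G hB (q + m + 1)) 0"
    using comm_mod_shift(1)[OF comm_mod_shift(3)[OF comm_modes(6)]] by simp
  show "comm_mod J (- G hC p + scal (if p = 0 then of_int (m + 1) else 0)) (G hA (q - m - 1)) 0"
    using comm_mod_shift(1)[OF comm_mod_shift(3)[OF comm_modes(5)]] by simp
  show "comm_mod J (- G hC p + scal (if p = 0 then of_int (m + 1) else 0))
      (- G hC q + scal (if q = 0 then of_int (m + 1) else 0)) 0"
    using comm_mod_shift(1)[OF comm_mod_shift(2)[OF comm_mod_shift(3)[OF comm_mod_shift(4)[OF comm_modes(3)]]]] by simp
  show "comm_mod J (- G hD p) (- G hD q) 0"
    using comm_mod_shift(3)[OF comm_mod_shift(4)[OF comm_modes(4)]] by simp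
  show "p \<ge> 1 \<Longrightarrow> - G hC p + scal (if p = 0 then of_int (m + 1) else 0) \<in> J" "p \<ge> 1 \<Longrightarrow> - G hD p \<in> J"
    using left_idealD(4)[OF J] vacuum(3,4) by auto
  show "- G hD 0 - scal (- dd) \<in> J"
    using left_idealD(4)[OF J vacuum(5)] by (simp add: sc_minus)
  fix w
  have "of_int (m + 1) + of_nat n = cc" by (simp add: flip: assms)
  then have "- G hC 0 + scal (if (0::int) = 0 then of_int (m + 1) else 0) + scal (of_nat n) = - (G hC 0 - scal cc)"
    by (simp add: add.assoc sc_add[symmetric])
  then show "(- G hC 0 + scal (if (0::int) = 0 then of_int (m + 1) else 0) + scal (of_nat n)) * w \<in> J"
    using left_idealD(4)[OF J vacuum(6)[of w]] by (simp only: minus_mult_left)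
next
  fix M
  assume M: "linsub M" "J \<subseteq> M" "1 \<in> M"
    and cl: "\<And>p x. x \<in> M \<Longrightarrow> G hB (p + m + 1) * x \<in> M \<and> G hA (p - m - 1) * x \<in> M \<and>
      (- G hC p + scal (if p = 0 then of_int (m + 1) else 0)) * x \<in> M \<and> - G hD p * x \<in> M"
  show "M = UNIV"
  proof (rule generated[OF M])
    fix p x assume x: "x \<in> M"
    have "G hC p * x = scal (if p = 0 then of_int (m + 1) else 0) * x - (- G hC p + scal (if p = 0 then of_int (m + 1) else 0)) * x"
      by (simp add: algebra_simps)
    moreover have "(- G hC p + scal (if p = 0 then of_int (m + 1) else 0)) * x \<in> M" using cl[OF x, of p] by blast
    ultimately have "G hC p * x \<in> M" using linsubD(5)[OF M(1) linsubD(3)[OF M(1) x]] by (simp only:)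
    moreover have "G hD p * x \<in> M" using cl[OF x, of p] linsubD(4)[OF M(1), of "- G hD p * x"] by simp
    ultimately show "G hA p * x \<in> M \<and> G hB p * x \<in> M \<and> G hC p * x \<in> M \<and> G hD p * x \<in> M"
      using cl[OF x, of "p - m - 1"] cl[OF x, of "p + m + 1"] by simp
  qed
qed (use J comm_modes vacuum in auto)

lemma c_part_empty: "c_part {#} = 1"
  by (simp add: c_part_def)

lemma c_part_stable:
  assumes M: "\<And>k w. w \<in> M \<Longrightarrow> G hC k * w \<in> M" and w: "w \<in> M"
  shows "c_part \<rho> * w \<in> M"
proof -
  have "prod_list (map (\<lambda>k. gen (nw_elt hC (- int k))) ks) * w \<in> M" for ks
    by (induction ks) (use M w in \<open>auto simp: mult.assoc\<close>)
  then show ?thesis by (simp add: c_part_def)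
qed

lemma maximal1:
  assumes cc: "cc + of_nat n = of_int m" and \<beta>: "\<beta> {#} n \<noteq> 0"
    and u: "(\<Sum>(\<rho>, p)\<in>index_pairs n. scal (\<beta> \<rho> p) * c_part \<rho> * G hB (- int p + m)) \<in> J"
    and N: "left_ideal N" "J \<subset> N"
  shows "1 \<in> N"
proof -
  interpret S: affine_system scal "\<lambda>p. G hA (p - m)" "\<lambda>q. G hB (q + m)"
    "\<lambda>k. G hC k + scal (if k = 0 then - of_int m else 0)" "G hD" J n dd
    by (rule affine_system1[OF cc])
  have C: "G hC k * w \<in> S.V3" if w: "w \<in> S.V3" for k w
  proof -
    have "G hC k * w = (G hC k + scal (if k = 0 then - of_int m else 0)) * w - scal (if k = 0 then - of_int m else 0) * w"
      by (simp add: algebra_simps)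
    then show ?thesis using linsubD(5)[OF S.linsub_V(4) S.C_V3[OF w, of k] linsubD(3)[OF S.linsub_V(4) w]] by (simp only:)
  qed
  have "G hB (- int n + m) \<in> S.V3"
  proof (rule S.redundant_mode[where X = c_part and \<beta> = \<beta>])
    show "(\<Sum>(\<rho>, p)\<in>index_pairs n. scal (\<beta> \<rho> p) * (c_part \<rho> * G hB (- int p + m))) \<in> J"
      using u by (simp only: mult.assoc)
    show "c_part \<rho> * w \<in> S.V3" if "w \<in> S.V3" for \<rho> w by (rule c_part_stable[OF C that])
  qed (rule c_part_empty, rule \<beta>)
  then show ?thesis by (rule S.maximal_left_ideal[OF _ N])
qed

lemma maximal2:
  assumes cc: "cc - of_nat (Suc n) = of_int m" and \<beta>: "\<beta> {#} n \<noteq> 0"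
    and u: "(\<Sum>(\<rho>, p)\<in>index_pairs n. scal (\<beta> \<rho> p) * c_part \<rho> * G hA (- int (Suc p) - m)) \<in> J"
    and N: "left_ideal N" "J \<subset> N"
  shows "1 \<in> N"
proof -
  interpret S: affine_system scal "\<lambda>p. G hB (p + m + 1)" "\<lambda>q. G hA (q - m - 1)"
    "\<lambda>k. - G hC k + scal (if k = 0 then of_int (m + 1) else 0)" "\<lambda>k. - G hD k" J n "- dd"
    by (rule affine_system2[OF cc])
  have C: "G hC k * w \<in> S.V3" if w: "w \<in> S.V3" for k w
  proof -
    have "G hC k * w = scal (if k = 0 then of_int (m + 1) else 0) * w - (- G hC k + scal (if k = 0 then of_int (m + 1) else 0)) * w"
      by (simp add: algebra_simps)
    then show ?thesis using linsubD(5)[OF S.linsub_V(4) linsubD(3)[OF S.linsub_V(4) w] S.C_V3[OF w, of k]] by (simp only:)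
  qed
  have "G hA (- int n - m - 1) \<in> S.V3"
  proof (rule S.redundant_mode[where X = c_part and \<beta> = \<beta>])
    have "- int (Suc p) - m = - int p - m - 1" for p by simp
    then show "(\<Sum>(\<rho>, p)\<in>index_pairs n. scal (\<beta> \<rho> p) * (c_part \<rho> * G hA (- int p - m - 1))) \<in> J"
      using u by (simp only: mult.assoc)
    show "c_part \<rho> * w \<in> S.V3" if "w \<in> S.V3" for \<rho> w by (rule c_part_stable[OF C that])
  qed (rule c_part_empty, rule \<beta>)
  then show ?thesis by (rule S.maximal_left_ideal[OF _ N])
qed

end

section \<open>Irreducibility\<close>

context fock_h4
begin

lemma act_elt: "act (nw_elt hA p) f = a p f" "act (nw_elt hB p) f = b p f" "act (nw_elt hC p) f = c p f"
  by (simp_all add: nw_elt_def act_single mode_def)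

text \<open>In the two cases \<epsilon> is 1 and - 1. On the Fock space c(-\<rho>) is multiplication
  by a monomial up to sign, so the sorting in \<open>c_part\<close> leaves no trace.\<close>

lemma rho_singular:
  assumes fc: "fock_character nw_scale nw_bracket (nw_sub m) (nw_char \<alpha>) act"
    and c: "\<And>k f. k \<ge> 1 \<Longrightarrow> c (- int k) f = cst \<epsilon> * (var (Cv (k - 1)) * f)"
  shows "fock_character.rho act (\<Sum>(\<rho>, p)\<in>index_pairs n. scal (\<gamma> \<rho> p) * c_part \<rho> * gen (X p)) 1 =
    (\<Sum>(\<rho>, p)\<in>index_pairs n. cst (\<epsilon> ^ size \<rho> * \<gamma> \<rho> p) * (Cmon \<rho> * act (X p) 1))"
proof -
  interpret fock_character nw_scale nw_bracket "nw_sub m" "nw_char \<alpha>" act by (rule fc)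
  have list: "rho (prod_list (map (\<lambda>k. gen (nw_elt hC (- int k))) ks)) y =
      cst (\<epsilon> ^ length ks) * (Cmon (mset ks) * y)" if "0 \<notin> set ks" for ks y
    using that
  proof (induction ks)
    case Nil
    then show ?case by (simp add: rho_gen Cmon_def)
  next
    case (Cons k ks)
    then have k: "k \<ge> 1" by (simp add: Suc_le_eq)
    have "rho (prod_list (map (\<lambda>k. gen (nw_elt hC (- int k))) (k # ks))) y =
        cst \<epsilon> * (var (Cv (k - 1)) * (cst (\<epsilon> ^ length ks) * (Cmon (mset ks) * y)))"
      using Cons by (simp add: rho_mult rho_gen act_elt c[OF k])
    also have "\<dots> = cst (\<epsilon> ^ length (k # ks)) * (Cmon (mset (k # ks)) * y)"
      by (simp add: Cmon_def cst_simps(2) ac_simps)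
    finally show ?case .
  qed
  have part: "rho (c_part \<rho>) y = cst (\<epsilon> ^ size \<rho>) * (Cmon \<rho> * y)" if "0 \<notin># \<rho>" for \<rho> y
  proof -
    have "0 \<notin> set (sorted_list_of_multiset \<rho>)" using that by simp
    from list[OF this, of y] show ?thesis
      by (simp add: c_part_def) (metis mset_sorted_list_of_multiset size_mset)
  qed
  have sum: "rho (sum g A) y = (\<Sum>i\<in>A. rho (g i) y)" for g :: "nat multiset \<times> nat \<Rightarrow> nw falg" and A y
    by (induction A rule: infinite_finite_induct) (simp_all add: rho_0 rho_add)
  show ?thesis
    unfolding sum
    by (intro sum.cong refl)
      (auto simp: index_pairs_def rho_mult rho_gen part cst_simps(2) ac_simps)
qed

end

lemma irreducible_nw_L:
  assumes fc: "fock_character nw_scale nw_bracket (nw_sub m) (nw_char \<alpha>) act"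
    and \<alpha>: "\<alpha> = dd *s hC + cc *s hD" and u: "fock_character.rho act u 1 = 0"
    and max: "\<And>J N. vacuum_ideal J m cc dd \<alpha> \<Longrightarrow> u \<in> J \<Longrightarrow> left_ideal N \<Longrightarrow> J \<subset> N \<Longrightarrow> 1 \<in> N"
  shows "irreducible_module nw_U (nw_L m \<alpha> u)"
proof -
  interpret fock_character nw_scale nw_bracket "nw_sub m" "nw_char \<alpha>" act by (rule fc)
  show ?thesis
    unfolding nw_L_def nw_V_def nw_vac_def
  proof (rule irreducible_quotient[OF u])
    fix J N
    assume J: "left_ideal J" "env_ideal UNIV nw_scale nw_bracket \<subseteq> J"
      "\<And>x. x \<in> nw_sub m \<Longrightarrow> gen x - scal (nw_char \<alpha> x) \<in> J" and uJ: "u \<in> J" and N: "left_ideal N" "J \<subset> N"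
    have "vacuum_ideal J m cc dd \<alpha>"
      by (intro vacuum_ideal.intro vacuum_ideal_axioms.intro scalars_scal J \<alpha>)
    then show "1 \<in> N" by (rule max[OF _ uJ N])
  qed
qed

lemma irreducible1:
  assumes \<alpha>: "\<alpha> = dd *s hC + cc *s hD" and n: "n \<ge> 1" and cc: "cc + of_nat n = of_int m"
    and ab: "coeffs1 n a b"
  shows "irreducible_module nw_U (nw_L m \<alpha> (vec1 m n a b))"
proof -
  \<comment> \<open>The eigenvalue of C 0 after the flow. The value of \<mu> then follows from D 0
    acting on the vacuum as \<mu> + \<zeta> / 2, which has to be \<open>dd\<close>.\<close>
  define \<zeta> where "\<zeta> = - (of_nat n :: complex)"
  define \<mu> where "\<mu> = dd - \<zeta> / 2"
  define \<beta> where "\<beta> = (\<lambda>\<rho> p. if p = 0 then a \<rho> else b \<rho> p)"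
  have \<beta>: "recursion n \<beta>" "\<beta> {#} n \<noteq> 0" using coeffs1_recursion[OF ab n] by (simp_all add: \<beta>_def)
  \<comment> \<open>The spectral flow is undone: \<open>m\<close> is added back to C 0, and the
    indices of a and b are shifted the other way.\<close>
  define c' where "c' k f = fC \<zeta> k f + cst (if k = 0 then of_int m else 0) * f" for k f
  interpret H: fock_h4 "\<lambda>p. fbe (p + m)" "\<lambda>q. fB \<zeta> (q - m)" c' "fD \<zeta> \<mu>"
  proof
    fix p q f
    show "lin (c' p)" unfolding c'_def[abs_def] by (intro lin_add lin_modes(3) lin_mult(1))
    show "c' p (c' q f) = c' q (c' p f)"
      by (simp add: c'_def linD[OF lin_modes(3)] mode_commutators(6)[of \<zeta> p q] distrib_left
          mult.left_commute add.left_commute add.assoc del: single_of_int)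
    show "c' p (fbe (q + m) f) = fbe (q + m) (c' p f)"
      by (simp add: c'_def linD[OF lin_modes(1)] mode_commutators(4))
    show "c' p (fB \<zeta> (q - m) f) = fB \<zeta> (q - m) (c' p f)"
      by (simp add: c'_def linD[OF lin_fB] fC_fB)
    show "fbe (p + m) (fB \<zeta> (q - m) f) = fB \<zeta> (q - m) (fbe (p + m) f) + c' (p + q) f +
        cst (if p + q = 0 then of_int p else 0) * f"
      by (simp add: fbe_fB c'_def cst_simps distrib_right)
    show "c' p (fD \<zeta> \<mu> q f) = fD \<zeta> \<mu> q (c' p f) + cst (if p + q = 0 then of_int p else 0) * f"
      by (simp add: c'_def linD[OF lin_fD] fC_fD)
    show "fD \<zeta> \<mu> p (fbe (q + m) f) = fbe (q + m) (fD \<zeta> \<mu> p f) + fbe (p + q + m) f"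
      by (simp add: fD_commutators(1) add.assoc)
    show "fD \<zeta> \<mu> p (fB \<zeta> (q - m) f) = fB \<zeta> (q - m) (fD \<zeta> \<mu> p f) - fB \<zeta> (p + q - m) f"
      by (simp add: fD_fB add_diff_eq)
  qed (simp_all add: lin_modes lin_fB lin_fD mode_commutators(1) fB_fB fD_fD)
  have fc: "fock_character nw_scale nw_bracket (nw_sub m) (nw_char \<alpha>) H.act"
  proof (rule H.fock_character[OF \<alpha>])
    have "\<zeta> + of_int m = cc" using cc by (simp add: \<zeta>_def algebra_simps)
    then show "c' 0 1 = cst cc" by (simp add: c'_def fC_def single_add[symmetric] del: single_of_int)
    show "fD \<zeta> \<mu> 0 1 = cst dd" by (simp add: fD_one \<mu>_def)
  qed (simp_all add: c'_def mode_one fB_one_pos fD_one)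
  have vec: "vec1 m n a b = (\<Sum>(\<rho>, p)\<in>index_pairs n. scal (\<beta> \<rho> p) * c_part \<rho> * gen (nw_elt hB (- int p + m)))"
    unfolding vec1_eq \<beta>_def ..
  show ?thesis
  proof (rule irreducible_nw_L[OF fc \<alpha>])
    show "fock_character.rho H.act (vec1 m n a b) 1 = 0"
      unfolding vec
    proof (subst H.rho_singular[OF fc, of 1])
      show "c' (- int k) f = cst 1 * (var (Cv (k - 1)) * f)" if "k \<ge> 1" for k f
        using that by (simp add: c'_def fC_def nat_diff_distrib)
      show "(\<Sum>(\<rho>, p)\<in>index_pairs n. cst (1 ^ size \<rho> * \<beta> \<rho> p) * (Cmon \<rho> * H.act (nw_elt hB (- int p + m)) 1)) = 0"
        unfolding H.act_elt using singular_vector_vanishes[OF \<beta>(1), folded \<zeta>_def] by simp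
    qed
    fix J N assume "vacuum_ideal J m cc dd \<alpha>" and uJ: "vec1 m n a b \<in> J" and N: "left_ideal N" "J \<subset> N"
    then interpret vacuum_ideal J m cc dd \<alpha> by simp
    show "1 \<in> N" by (rule maximal1[OF cc \<beta>(2) uJ[unfolded vec] N])
  qed
qed

lemma irreducible2:
  assumes \<alpha>: "\<alpha> = dd *s hC + cc *s hD" and cc: "cc - of_nat (Suc n) = of_int m"
    and c: "coeffs2 (Suc n) c"
  shows "irreducible_module nw_U (nw_L m \<alpha> (vec2 m (Suc n) c))"
proof -
  define \<zeta> where "\<zeta> = - (of_nat n :: complex)"
  \<comment> \<open>Here d(0) is the negative of D 0, so \<mu> + \<zeta> / 2 has to be -
    \<open>dd\<close>.\<close>
  define \<mu> where "\<mu> = - dd - \<zeta> / 2"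
  define \<beta> where "\<beta> = (\<lambda>\<rho> p. (- 1) ^ size \<rho> * c \<rho> (Suc p))"
  have \<beta>: "recursion n \<beta>" "\<beta> {#} n \<noteq> 0" using coeffs2_recursion[OF c] by (simp_all add: \<beta>_def)
  \<comment> \<open>The flow and the exchange are undone together: the composite field
    \<open>fB\<close> represents a, and \<beta> represents b.\<close>
  define c' where "c' k f = - fC \<zeta> k f + cst (if k = 0 then of_int (m + 1) else 0) * f" for k f
  define d' where "d' k f = - fD \<zeta> \<mu> k f" for k f
  interpret H: fock_h4 "\<lambda>q. fB \<zeta> (q + m + 1)" "\<lambda>p. fbe (p - m - 1)" c' d'
  proof
    fix p q f
    show "lin (c' p)" unfolding c'_def[abs_def] by (intro lin_add lin_minus(1) lin_modes(3) lin_mult(1))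
    show "lin (d' p)" unfolding d'_def[abs_def] by (intro lin_minus(1) lin_fD)
    show "c' p (c' q f) = c' q (c' p f)"
      by (simp add: c'_def linD[OF lin_modes(3)] mode_commutators(6)[of \<zeta> p q] distrib_left
          mult.left_commute add.left_commute add.assoc del: single_of_int)
    show "d' p (d' q f) = d' q (d' p f)" by (simp add: d'_def linD[OF lin_fD] fD_fD[of _ _ p q])
    show "c' p (fbe (q - m - 1) f) = fbe (q - m - 1) (c' p f)"
      by (simp add: c'_def linD[OF lin_modes(1)] mode_commutators(4))
    show "c' p (fB \<zeta> (q + m + 1) f) = fB \<zeta> (q + m + 1) (c' p f)"
      by (simp add: c'_def linD[OF lin_fB] fC_fB)
    have "cst (if p + q = 0 then of_int (m + 1) else 0) + cst (if p + q = 0 then of_int p else 0) =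
        - cst (if p + q = 0 then of_int (q - m - 1) else 0)"
    proof (cases "p + q = 0")
      case True
      then have "q = - p" by simp
      then have "of_int (m + 1) + of_int p = - (of_int (q - m - 1) :: complex)" by simp
      then show ?thesis using True by (simp only: simp_thms if_True cst_simps(1,3)[symmetric])
    qed simp
    then have "cst (if p + q = 0 then of_int (m + 1) else 0) * f + cst (if p + q = 0 then of_int p else 0) * f =
        - (cst (if p + q = 0 then of_int (q - m - 1) else 0) * f)"
      by (simp only: distrib_right[symmetric] minus_mult_left)
    then show "fB \<zeta> (p + m + 1) (fbe (q - m - 1) f) = fbe (q - m - 1) (fB \<zeta> (p + m + 1) f) + c' (p + q) f +
        cst (if p + q = 0 then of_int p else 0) * f"
      using fbe_fB[of "q - m - 1" \<zeta> "p + m + 1" f] by (simp add: c'_def add.commute[of q p] del: single_of_int of_int_add of_int_diff cong: if_cong)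
    show "c' p (d' q f) = d' q (c' p f) + cst (if p + q = 0 then of_int p else 0) * f"
      by (simp add: c'_def d'_def linD[OF lin_fD] linD[OF lin_modes(3)] fC_fD)
    show "d' p (fB \<zeta> (q + m + 1) f) = fB \<zeta> (q + m + 1) (d' p f) + fB \<zeta> (p + q + m + 1) f"
      by (simp add: d'_def fD_fB linD[OF lin_fB] add.assoc)
    show "d' p (fbe (q - m - 1) f) = fbe (q - m - 1) (d' p f) - fbe (p + q - m - 1) f"
      by (simp add: d'_def fD_commutators(1) linD[OF lin_modes(1)] add_diff_eq)
  qed (simp_all add: lin_modes lin_fB mode_commutators(1) fB_fB)
  have fc: "fock_character nw_scale nw_bracket (nw_sub m) (nw_char \<alpha>) H.act"
  proof (rule H.fock_character[OF \<alpha>])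
    have "- \<zeta> + of_int (m + 1) = cc" unfolding of_int_add cc[symmetric] by (simp add: \<zeta>_def)
    then show "c' 0 1 = cst cc"
      by (simp add: c'_def fC_def cst_simps(1,3)[symmetric] del: single_of_int of_int_add)
    show "d' 0 1 = cst dd" by (simp add: d'_def fD_one \<mu>_def single_uminus)
  qed (simp_all add: c'_def d'_def mode_one fB_one_pos fD_one)
  have vec: "vec2 m (Suc n) c = (\<Sum>(\<rho>, p)\<in>index_pairs n.
      scal (c \<rho> (Suc p)) * c_part \<rho> * gen (nw_elt hA (- int (Suc p) - m)))"
    by (rule vec2_eq)
  have nz: "c {#} (Suc n) \<noteq> 0" using \<beta>(2) by (simp add: \<beta>_def)
  show ?thesis
  proof (rule irreducible_nw_L[OF fc \<alpha>])
    show "fock_character.rho H.act (vec2 m (Suc n) c) 1 = 0"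
      unfolding vec
    proof (subst H.rho_singular[OF fc, of "- 1"])
      show "c' (- int k) f = cst (- 1) * (var (Cv (k - 1)) * f)" if "k \<ge> 1" for k f
        using that by (simp add: c'_def fC_def nat_diff_distrib single_uminus)
      show "(\<Sum>(\<rho>, p)\<in>index_pairs n. cst ((- 1) ^ size \<rho> * c \<rho> (Suc p)) *
          (Cmon \<rho> * H.act (nw_elt hA (- int (Suc p) - m)) 1)) = 0"
        unfolding H.act_elt using singular_vector_vanishes[OF \<beta>(1), folded \<zeta>_def] by (simp add: \<beta>_def)
    qed
    fix J N assume "vacuum_ideal J m cc dd \<alpha>" and uJ: "vec2 m (Suc n) c \<in> J" and N: "left_ideal N" "J \<subset> N"
    then interpret vacuum_ideal J m cc dd \<alpha> by simp
    show "1 \<in> N" by (rule maximal2[where \<beta> = "\<lambda>\<rho> p. c \<rho> (Suc p)", OF cc nz uJ[unfolded vec] N])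
  qed
qed

theorem corollary3p4:
  fixes m :: int and cc dd :: complex and \<alpha> :: h4
  assumes "cc \<noteq> 0 \<or> dd \<noteq> 0"
    and "\<alpha> = dd *s hC + cc *s hD"
  shows "(\<forall>n::nat. n \<ge> 1 \<and> cc + of_nat n = of_int m \<longrightarrow>
            (\<exists>a b. coeffs1 n a b) \<and>
            (\<forall>a b. coeffs1 n a b \<longrightarrow> irreducible_module nw_U (nw_L m \<alpha> (vec1 m n a b)))) \<and>
         (\<forall>n::nat. n \<ge> 1 \<and> cc - of_nat n = of_int m \<longrightarrow>
            (\<exists>c. coeffs2 n c) \<and>
            (\<forall>c. coeffs2 n c \<longrightarrow> irreducible_module nw_U (nw_L m \<alpha> (vec2 m n c))))"
proof (intro conjI allI impI; elim conjE)
  fix n :: nat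
  assume n: "n \<ge> 1"
  show "\<exists>a b. coeffs1 n a b" by (rule coeffs1_exists[OF n])
  show "\<exists>c. coeffs2 n c" by (rule coeffs2_exists[OF n])
  show "irreducible_module nw_U (nw_L m \<alpha> (vec1 m n a b))"
    if "cc + of_nat n = of_int m" "coeffs1 n a b" for a b
    by (rule irreducible1[OF assms(2) n that])
  show "irreducible_module nw_U (nw_L m \<alpha> (vec2 m n c))"
    if "cc - of_nat n = of_int m" "coeffs2 n c" for c
    \<comment> \<open>Degree n of case (2) is degree n - 1 of the recursion.\<close>
    using irreducible2[OF assms(2), of "n - 1" m c] that n by simp
qed

end
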